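(* Let $\alpha>0$ and let $X=(X_t)_{t\in\mathbb{R}}$ be a real-valued two-sided Lévy process such that $X_0=0$, $X_t$ is non-degenerate for $t\ne0$, $\mathbb{E}[|X_1|]<\infty$ and $|\mathbb{E}[X_1]|<\alpha$. Let $M$ be the $\alpha$-Lipschitz minorant of $X$ and $\mathcal{Z}=\{t\in\mathbb{R}:M_t=X_t\wedge X_{t-}\}$. If $\sigma=0$, $\Pi(\mathbb{R})<\infty$ and $|d|=\alpha$, then the Lebesgue measure of $\mathcal{Z}$ is almost surely infinite. If $X$ is not of this form, then the Lebesgue measure of $\mathcal{Z}$ is almost surely zero if and only if zero is regular for the interval $(-\infty,0]$ for at least one of the Lévy processes $(X_t+\alpha t)_{t\ge0}$ and $(-X_t+\alpha t)_{t\ge0}$.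
   Context: A two-sided real-valued Lévy process $X=(X_t)_{t\in\mathbb{R}}$ has càdlàg paths, $X_0=0$, and for $s<t$ the increment $X_t-X_s$ is independent of $\{X_r:r\le s\}$ with the same distribution as $X_{t-s}$. For $t\ge0$, $\mathbb{E}[e^{i\theta X_t}]=e^{-t\Psi(\theta)}$ with $\Psi(\theta)=-ia\theta+\frac12\sigma^2\theta^2+\int_{\mathbb{R}}(1-e^{i\theta x}+i\theta x1_{\{|x|<1\}})\,\Pi(dx)$, where $a\in\mathbb{R}$, $\sigma\ge0$ and $\Pi$ is the Lévy measure. When $\sigma=0$ and $\int(1\wedge|x|)\,\Pi(dx)<\infty$ (bounded variation paths), $\Psi(\theta)=-id\theta+\int_{\mathbb{R}}(1-e^{i\theta x})\,\Pi(dx)$ and $d$ is the drift coefficient. Non-degenerate means not almost surely constant. A function $g:\mathbb{R}\to\mathbb{R}$ is $\alpha$-Lipschitz if $|g(s)-g(t)|\le\alpha|s-t|$ for all $s,t$. The $\alpha$-Lipschitz minorant of $f$ is the greatest $\alpha$-Lipschitz function dominated by $f$; under the stated assumptions it exists almost surely for the paths of $X$. Zero is regular for a set $B$ for a process $(Z_t)_{t\ge0}$ with $Z_0=0$ if $\inf\{t>0:Z_t\in B\}=0$ almost surely. *)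

theory Defs
  imports "HOL-Probability.Probability"
begin

text \<open>Independence of an increment and the past is stated for the generated \<open>\<sigma>\<close>-algebras, since
  \<open>indep_var\<close> requires both variables to have the same codomain type. The second \<open>\<sigma>\<close>-algebra is
  the one generated by all \<open>X r\<close> with \<open>r \<le> s\<close>.\<close>

locale two_sided_levy_process = prob_space M
  for M :: "'a measure" and X :: "real \<Rightarrow> 'a \<Rightarrow> real" +
  assumes random_variable_X: "random_variable borel (X t)"
    and right_continuous: "\<omega> \<in> space M \<Longrightarrow> continuous (at_right t) (\<lambda>s. X s \<omega>)"
    and left_limits: "\<omega> \<in> space M \<Longrightarrow> \<exists>l. ((\<lambda>s. X s \<omega>) \<longlongrightarrow> l) (at_left t)"
    and start_at_zero: "\<omega> \<in> space M \<Longrightarrow> X 0 \<omega> = 0"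
    and indep_increments:
      "s < t \<Longrightarrow> indep_set
         (sets (vimage_algebra (space M) (\<lambda>\<omega>. X t \<omega> - X s \<omega>) borel))
         (sets (vimage_algebra (space M) (\<lambda>\<omega>. \<lambda>r\<in>{..s}. X r \<omega>) (\<Pi>\<^sub>M r\<in>{..s}. borel)))"
    and stationary_increments:
      "s < t \<Longrightarrow> distr M borel (\<lambda>\<omega>. X t \<omega> - X s \<omega>) = distr M borel (X (t - s))"

definition levy_measure :: "real measure \<Rightarrow> bool" where
  "levy_measure \<nu> \<longleftrightarrow> sets \<nu> = sets borel \<and> emeasure \<nu> {0} = 0 \<and>
     (\<integral>\<^sup>+x. ennreal (min 1 (x\<^sup>2)) \<partial>\<nu>) < \<infinity>"

definition levy_exponent :: "real \<Rightarrow> real \<Rightarrow> real measure \<Rightarrow> real \<Rightarrow> complex" where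
  "levy_exponent a \<sigma> \<nu> \<theta> =
     - \<i> * complex_of_real a * complex_of_real \<theta> + complex_of_real (\<sigma>\<^sup>2 * \<theta>\<^sup>2 / 2)
     + (CLINT x|\<nu>. 1 - iexp (\<theta> * x)
                     + \<i> * complex_of_real (\<theta> * x * indicator {x. \<bar>x\<bar> < 1} x))"

definition levy_triplet ::
  "'a measure \<Rightarrow> (real \<Rightarrow> 'a \<Rightarrow> real) \<Rightarrow> real \<Rightarrow> real \<Rightarrow> real measure \<Rightarrow> bool" where
  "levy_triplet M X a \<sigma> \<nu> \<longleftrightarrow> \<sigma> \<ge> 0 \<and> levy_measure \<nu> \<and>
     (\<forall>t\<ge>0. \<forall>\<theta>. char (distr M borel (X t)) \<theta>
                  = exp (- complex_of_real t * levy_exponent a \<sigma> \<nu> \<theta>))"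

text \<open>The drift is meaningful only if \<open>\<sigma> = 0\<close> and \<open>min 1 \<bar>x\<bar>\<close> is \<open>\<nu>\<close>-integrable;
  it then exists and is unique. In particular it does for \<open>\<sigma> = 0\<close> and a finite \<open>\<nu>\<close>.\<close>

definition levy_drift :: "real \<Rightarrow> real \<Rightarrow> real measure \<Rightarrow> real" where
  "levy_drift a \<sigma> \<nu> =
     (THE d. \<forall>\<theta>. levy_exponent a \<sigma> \<nu> \<theta> =
        - \<i> * complex_of_real d * complex_of_real \<theta> + (CLINT x|\<nu>. 1 - iexp (\<theta> * x)))"

text \<open>The order on functions is the pointwise one, and \<open>Greatest\<close> is the greatest element, not
  just a maximal one. If there is none, the value is unspecified.\<close>

definition lipschitz_minorant :: "real \<Rightarrow> (real \<Rightarrow> real) \<Rightarrow> real \<Rightarrow> real" where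
  "lipschitz_minorant \<alpha> f = (GREATEST g. \<alpha>-lipschitz_on UNIV g \<and> g \<le> f)"

definition contact_set :: "real \<Rightarrow> (real \<Rightarrow> real) \<Rightarrow> real set" where
  "contact_set \<alpha> f = {t. lipschitz_minorant \<alpha> f t = min (f t) (Lim (at_left t) f)}"

text \<open>The infimum is taken in \<open>ereal\<close>, so that it is \<open>\<infinity>\<close> on paths that never hit \<open>B\<close>.\<close>

definition zero_regular_for ::
  "'a measure \<Rightarrow> (real \<Rightarrow> 'a \<Rightarrow> real) \<Rightarrow> real set \<Rightarrow> bool" where
  "zero_regular_for M Z B \<longleftrightarrow>
     (AE \<omega> in M. Inf (ereal ` {t. t > 0 \<and> Z t \<omega> \<in> B}) = 0)"

end

theory Submission imports Defs
begin

text \<open>Write \<open>V t = X t + \<alpha> * t\<close> and \<open>V' t = - X t + \<alpha> * t\<close>, two Levy processes with positive mean. Up to a Lebesgue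
  null set, \<open>t\<close> is a contact time iff \<open>X t \<le> X s + \<alpha> * \<bar>s - t\<bar>\<close> for all \<open>s\<close>. The conditions on \<open>s \<ge> t\<close> and on \<open>s \<le> t\<close>
  are independent, and by stationarity and time reversal they have the probabilities \<open>p\<close> and \<open>p'\<close> that \<open>V\<close> and
  \<open>V'\<close> stay nonnegative on \<open>[0, \<infinity>)\<close>. If \<open>p * p' = 0\<close> then the contact set is null by Fubini; otherwise it has
  infinite measure, because contact at distant times is asymptotically independent.

  If \<open>0\<close> is not regular for \<open>{..0}\<close> then \<open>V\<close> can reach a positive level before becoming negative, and from there it stays
  nonnegative with positive probability, by the maximal ergodic lemma. Conversely, let \<open>0\<close> be regular. On
  the set of times after which \<open>V\<close> does not go below its present value, \<open>V\<close> is then locally constant, which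
  forces \<open>p = 0\<close> unless \<open>V\<close> vanishes with positive probability at every time. In that case Lebesgue density
  gives \<open>P (V h = 0) \<rightarrow> 1\<close> along some \<open>h \<rightarrow> 0\<close>, so that the characteristic exponent is bounded and \<open>V\<close> is
  a compound Poisson process without drift, which is the exceptional case. There \<open>p\<close> and \<open>p'\<close> are
  positive, since \<open>V\<close> vanishes on an initial interval with positive probability.\<close>

section \<open>Laws of the shifted and the reversed path\<close>

text \<open>Two restrictions shape the proof. \<open>levy_triplet\<close> fixes only the
  characteristic functions at single times, and no decomposition of the paths into jumps is
  constructed. Jumps are therefore accessible only through the atom of \<open>X t\<close> at zero: a
  large atom bounds the characteristic exponent, and a finite Levy measure with the drift removed
  forces an atom at least as large as the probability of no jump. Gaussian averages of cosines and
  of characteristic functions carry out both translations. Moreover, independence is given at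
  deterministic times only. Hitting arguments run along grids, where the first hitting index splits
  an event into countably many pieces, each in the past of a fixed time, and the mesh is refined
  afterwards. Right continuity reduces conditions at all real times to dyadic ones, which also makes
  the events measurable. Since staying above 0 cannot be reached directly by such limits, the
  argument first gets positive probability for staying above \<open>- \<eta>\<close> with an
  arbitrary positive \<eta>, and then looks for a start that provides this slack.\<close>

abbreviation paths :: "(real \<Rightarrow> real) measure" where
  "paths \<equiv> Pi\<^sub>M UNIV (\<lambda>_. borel)"

lemma borel_measurable_indicator_Collect:
  "Measurable.pred N P \<Longrightarrow> (\<lambda>x. indicator {x. P x} x :: 'b :: {topological_space, zero_neq_one}) \<in> borel_measurable N"
  unfolding indicator_def by simp

lemma (in prob_space) prob_Collect_mono:
  assumes "{w\<in>space M. Q w} \<in> events" "\<And>w. w \<in> space M \<Longrightarrow> P w \<Longrightarrow> Q w"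
  shows "prob {w\<in>space M. P w} \<le> prob {w\<in>space M. Q w}"
  using assms by (intro finite_measure_mono) auto

text \<open>Joint laws at finitely many times are to be reduced to laws of successive increments.
  The time 0 is inserted in front because the paths vanish there, so that partial sums of increments
  return the values themselves.\<close>

lemma finite_set_strict_enumeration:
  fixes J :: "real set"
  assumes "finite J" "J \<subseteq> {0..}"
  obtains n :: nat and u :: "nat \<Rightarrow> real"
  where "u 0 = 0" "\<And>i. i < n \<Longrightarrow> u i < u (Suc i)" "J \<subseteq> u ` {..n}"
proof -
  define L where "L = sorted_list_of_set (insert 0 J)"
  have L: "set L = insert 0 J" "sorted L" "distinct L" "L \<noteq> []"
    using assms by (auto simp: L_def simp del: sorted_list_of_set_insert_remove)
  have sw: "sorted_wrt (<) L"
    using L strict_sorted_iff by blast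
  have pos: "L ! 0 = 0"
  proof (rule antisym)
    obtain i where i: "i < length L" "L ! i = 0" by (metis L(1) in_set_conv_nth insertI1)
    then show "L ! 0 \<le> 0" using L(2) by (metis le0 sorted_nth_mono)
    show "0 \<le> L ! 0" using L assms by (metis atLeast_iff insert_iff le_less_trans nth_mem length_greater_0_conv order_refl subsetD)
  qed
  show ?thesis
  proof (rule that[of "\<lambda>i. L ! i" "length L - 1"])
    show "L ! i < L ! Suc i" if "i < length L - 1" for i
      using that sorted_wrt_nth_less[OF sw, of i "Suc i"] by auto
    show "J \<subseteq> (!) L ` {..length L - 1}"
    proof
      fix x assume "x \<in> J"
      then obtain i where "i < length L" "L ! i = x" by (metis L(1) in_set_conv_nth insert_iff)
      then show "x \<in> (!) L ` {..length L - 1}" by (intro image_eqI[of _ _ i]) auto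
    qed
  qed (use pos in auto)
qed

lemma sets_paths_Collect:
  "Measurable.pred paths S \<Longrightarrow> {x. S x} \<in> sets paths"
  by (simp add: pred_def space_PiM)

text \<open>A path that vanishes at 0 is recovered at finitely many times from its increments along
  an increasing chain, so increment laws determine all cylinder probabilities. The measures are
  merely finite because \<open>markov\<close> applies this to a restriction and to a multiple of
  \<open>M\<close>.\<close>

lemma path_measure_eqI:
  fixes Y1 :: "real \<Rightarrow> 'a \<Rightarrow> real" and Y2 :: "real \<Rightarrow> 'b \<Rightarrow> real"
  assumes fin: "finite_measure N1" "finite_measure N2"
    and [measurable]: "\<And>q. Y1 q \<in> borel_measurable N1" "\<And>q. Y2 q \<in> borel_measurable N2"
    and abs: "\<And>q w. Y1 q w = Y1 \<bar>q\<bar> w" "\<And>q w. Y2 q w = Y2 \<bar>q\<bar> w"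
    and zero: "\<And>w. w \<in> space N1 \<Longrightarrow> Y1 0 w = 0" "\<And>w. w \<in> space N2 \<Longrightarrow> Y2 0 w = 0"
    and chain: "\<And>n u A. u 0 = 0 \<Longrightarrow> (\<And>i. i < n \<Longrightarrow> u i < u (Suc i)) \<Longrightarrow> (\<And>i. A i \<in> sets borel) \<Longrightarrow>
        emeasure N1 {w\<in>space N1. \<forall>i<n::nat. Y1 (u (Suc i)) w - Y1 (u i) w \<in> A i}
      = emeasure N2 {w\<in>space N2. \<forall>i<n. Y2 (u (Suc i)) w - Y2 (u i) w \<in> A i}"
  shows "distr N1 paths (\<lambda>w q. Y1 q w) = distr N2 paths (\<lambda>w q. Y2 q w)"
proof (rule measure_eqI_PiM_infinite[where I = UNIV and M = "\<lambda>_. borel"])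
  interpret N1: finite_measure N1 by fact
  interpret N2: finite_measure N2 by fact
  have m1: "(\<lambda>w q. Y1 q w) \<in> measurable N1 paths"
    by (rule measurable_PiM_single') auto
  have m2: "(\<lambda>w q. Y2 q w) \<in> measurable N2 paths"
    by (rule measurable_PiM_single') auto
  show "finite_measure (distr N1 paths (\<lambda>w q. Y1 q w))"
    using m1 by (rule N1.finite_measure_distr)
  fix A :: "real \<Rightarrow> real set" and J :: "real set"
  assume J: "finite J" "J \<subseteq> UNIV" and A: "\<And>i. i \<in> J \<Longrightarrow> A i \<in> sets borel"
  have "abs ` J \<subseteq> {0..}" by auto
  then obtain n u where u: "u 0 = 0" "\<And>i. i < n \<Longrightarrow> u i < u (Suc i)" "abs ` J \<subseteq> u ` {..n::nat}"
    by (rule finite_set_strict_enumeration[OF finite_imageI[OF J(1)]]) blast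
  have "\<forall>q\<in>J. \<exists>k. k \<le> n \<and> u k = \<bar>q\<bar>" using u(3) by (force simp: image_subset_iff)
  then obtain k where k: "\<And>q. q \<in> J \<Longrightarrow> k q \<le> n \<and> u (k q) = \<bar>q\<bar>" by metis
  define D1 where "D1 w = (\<lambda>i\<in>{..<n}. Y1 (u (Suc i)) w - Y1 (u i) w)" for w
  define D2 where "D2 w = (\<lambda>i\<in>{..<n}. Y2 (u (Suc i)) w - Y2 (u i) w)" for w
  have [measurable]: "D1 \<in> measurable N1 (Pi\<^sub>M {..<n} (\<lambda>_. borel))" "D2 \<in> measurable N2 (Pi\<^sub>M {..<n} (\<lambda>_. borel))"
    unfolding D1_def[abs_def] D2_def[abs_def] by measurable
  have eq: "distr N1 (Pi\<^sub>M {..<n} (\<lambda>_. borel)) D1 = distr N2 (Pi\<^sub>M {..<n} (\<lambda>_. borel)) D2"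
  proof (rule measure_eqI_PiM_finite[where I = "{..<n}" and M = "\<lambda>_. borel" and A = "\<lambda>_. Pi\<^sub>E {..<n} (\<lambda>_. UNIV)"])
    fix B :: "nat \<Rightarrow> real set" assume B: "\<And>i. i \<in> {..<n} \<Longrightarrow> B i \<in> sets borel"
    \<comment> \<open>\<open>B\<close> is known to be Borel only below \<open>n\<close>, whereas
      \<open>chain\<close> wants every component Borel; the value beyond \<open>n\<close> is never
      consulted.\<close>
    define B' where "B' i = (if i < n then B i else {})" for i
    have B': "B' i \<in> sets borel" for i using B by (auto simp: B'_def)
    have [measurable]: "Pi\<^sub>E {..<n} B \<in> sets (Pi\<^sub>M {..<n} (\<lambda>_. borel))" using B by (intro sets_PiM_I_finite) auto
    have D1_iff: "D1 w \<in> Pi\<^sub>E {..<n} B \<longleftrightarrow> (\<forall>i<n. Y1 (u (Suc i)) w - Y1 (u i) w \<in> B' i)"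
      and D2_iff: "D2 w' \<in> Pi\<^sub>E {..<n} B \<longleftrightarrow> (\<forall>i<n. Y2 (u (Suc i)) w' - Y2 (u i) w' \<in> B' i)" for w w'
      unfolding D1_def D2_def B'_def restrict_PiE_iff by (simp_all add: Ball_def)
    have "D1 -` Pi\<^sub>E {..<n} B \<inter> space N1 = {w\<in>space N1. \<forall>i<n. Y1 (u (Suc i)) w - Y1 (u i) w \<in> B' i}"
         "D2 -` Pi\<^sub>E {..<n} B \<inter> space N2 = {w\<in>space N2. \<forall>i<n. Y2 (u (Suc i)) w - Y2 (u i) w \<in> B' i}"
      unfolding vimage_def D1_iff D2_iff by (simp_all add: Int_def conj_commute)
    then show "emeasure (distr N1 (Pi\<^sub>M {..<n} (\<lambda>_. borel)) D1) (Pi\<^sub>E {..<n} B) =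
               emeasure (distr N2 (Pi\<^sub>M {..<n} (\<lambda>_. borel)) D2) (Pi\<^sub>E {..<n} B)"
      using chain[of u n B'] u B' by (simp add: emeasure_distr)
  next
    show "range (\<lambda>_::nat. Pi\<^sub>E {..<n} (\<lambda>_. UNIV)) \<subseteq> prod_algebra {..<n} (\<lambda>_. borel::real measure)"
      by (auto intro!: prod_algebraI_finite)
    show "(\<Union>i::nat. Pi\<^sub>E {..<n} (\<lambda>_. UNIV)) = space (Pi\<^sub>M {..<n} (\<lambda>_. borel::real measure))"
      by (simp add: space_PiM)
    show "emeasure (distr N1 (Pi\<^sub>M {..<n} (\<lambda>_. borel)) D1) (Pi\<^sub>E {..<n} (\<lambda>_. UNIV)) \<noteq> \<infinity>" for i :: nat
      using N1.finite_measure_distr[of D1 "Pi\<^sub>M {..<n} (\<lambda>_. borel)"] finite_measure.emeasure_finite by fastforce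
  qed auto
  \<comment> \<open>\<open>S\<close> is the cylinder event rewritten for the vector of increments:
    by telescoping, the sum of the first \<open>k q\<close> of them is the value at
    \<open>q\<close>.\<close>
  define S where "S = {x \<in> space (Pi\<^sub>M {..<n} (\<lambda>_. borel :: real measure)). \<forall>q\<in>J. (\<Sum>i<k q. x i) \<in> A q}"
  have [measurable]: "S \<in> sets (Pi\<^sub>M {..<n} (\<lambda>_. borel))"
    unfolding S_def
  proof (intro sets.sets_Collect_finite_All J(1))
    fix q assume q: "q \<in> J"
    have [measurable]: "A q \<in> sets borel" using A q .
    have "(\<lambda>x. \<Sum>i<k q. x i) \<in> borel_measurable (Pi\<^sub>M {..<n} (\<lambda>_. borel :: real measure))"
      using k[OF q] by (intro borel_measurable_sum measurable_component_singleton) auto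
    then show "{x \<in> space (Pi\<^sub>M {..<n} (\<lambda>_. borel::real measure)). (\<Sum>i<k q. x i) \<in> A q} \<in> sets (Pi\<^sub>M {..<n} (\<lambda>_. borel))"
      by measurable
  qed
  have "prod_emb UNIV (\<lambda>_. borel) J (Pi\<^sub>E J A) = {x. \<forall>q\<in>J. x q \<in> A q}"
    by (auto simp: prod_emb_def space_PiM vimage_def restrict_PiE_iff)
  note emb = this
  have meas: "prod_emb UNIV (\<lambda>_. borel) J (Pi\<^sub>E J A) \<in> sets paths"
    using J A by (intro sets_PiM_I) auto
  have tel1: "(\<Sum>i<k q. D1 w i) = Y1 q w" if "w \<in> space N1" "q \<in> J" for q w
  proof -
    have "(\<Sum>i<k q. D1 w i) = (\<Sum>i<k q. Y1 (u (Suc i)) w - Y1 (u i) w)"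
      using k[OF that(2)] by (intro sum.cong) (auto simp: D1_def)
    also have "\<dots> = Y1 (u (k q)) w - Y1 (u 0) w" by (rule sum_lessThan_telescope)
    finally show ?thesis using zero(1)[OF that(1)] u k[OF that(2)] abs(1)[of q] by simp
  qed
  have tel2: "(\<Sum>i<k q. D2 w i) = Y2 q w" if "w \<in> space N2" "q \<in> J" for q w
  proof -
    have "(\<Sum>i<k q. D2 w i) = (\<Sum>i<k q. Y2 (u (Suc i)) w - Y2 (u i) w)"
      using k[OF that(2)] by (intro sum.cong) (auto simp: D2_def)
    also have "\<dots> = Y2 (u (k q)) w - Y2 (u 0) w" by (rule sum_lessThan_telescope)
    finally show ?thesis using zero(2)[OF that(1)] u k[OF that(2)] abs(2)[of q] by simp
  qed
  have 1: "(\<lambda>w q. Y1 q w) -` {x. \<forall>q\<in>J. x q \<in> A q} \<inter> space N1 = D1 -` S \<inter> space N1"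
    using tel1 measurable_space[of D1 N1 "Pi\<^sub>M {..<n} (\<lambda>_. borel)"] by (auto simp: S_def)
  have 2: "(\<lambda>w q. Y2 q w) -` {x. \<forall>q\<in>J. x q \<in> A q} \<inter> space N2 = D2 -` S \<inter> space N2"
    using tel2 measurable_space[of D2 N2 "Pi\<^sub>M {..<n} (\<lambda>_. borel)"] by (auto simp: S_def)
  have "emeasure N1 (D1 -` S \<inter> space N1) = emeasure N2 (D2 -` S \<inter> space N2)"
    using arg_cong[OF eq, of "\<lambda>M. emeasure M S"] by (simp add: emeasure_distr)
  then show "emeasure (distr N1 paths (\<lambda>w q. Y1 q w)) (prod_emb UNIV (\<lambda>_. borel) J (Pi\<^sub>E J A)) =
             emeasure (distr N2 paths (\<lambda>w q. Y2 q w)) (prod_emb UNIV (\<lambda>_. borel) J (Pi\<^sub>E J A))"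
    using meas 1 2 by (simp add: emeasure_distr m1 m2 emb)
qed simp_all

text \<open>This is how \<open>affine\<close> inherits independence: generated sigma-algebras can
  only shrink when a measurable function is applied.\<close>

lemma vimage_algebra_compose_subset:
  assumes "h \<in> measurable N' N" "f \<in> \<Omega> \<rightarrow> space N'" "\<And>x. x \<in> \<Omega> \<Longrightarrow> g x = h (f x)"
  shows "sets (vimage_algebra \<Omega> g N) \<subseteq> sets (vimage_algebra \<Omega> f N')"
proof -
  have "g \<in> measurable (vimage_algebra \<Omega> f N') N \<longleftrightarrow> (\<lambda>x. h (f x)) \<in> measurable (vimage_algebra \<Omega> f N') N"
    using assms(3) by (intro measurable_cong) simp
  then have "g \<in> measurable (vimage_algebra \<Omega> f N') N"
    using measurable_compose[OF measurable_vimage_algebra1[OF assms(2)] assms(1)] by simp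
  from measurable_space[OF this] measurable_sets[OF this] show ?thesis
    by (subst sets_vimage_algebra2) auto
qed

context two_sided_levy_process
begin

lemmas measurable_X [measurable] = random_variable_X

definition past :: "real \<Rightarrow> 'a measure" where
  "past t = vimage_algebra (space M) (\<lambda>w. \<lambda>r\<in>{..t}. X r w) (\<Pi>\<^sub>M r\<in>{..t}. borel)"

lemma space_past [simp]: "space (past t) = space M"
  by (simp add: past_def)

lemma measurable_past: "r \<le> t \<Longrightarrow> X r \<in> borel_measurable (past t)"
proof -
  assume r: "r \<le> t"
  have "(\<lambda>w. \<lambda>r\<in>{..t}. X r w) \<in> measurable (past t) (\<Pi>\<^sub>M r\<in>{..t}. borel)"
    unfolding past_def by (rule measurable_vimage_algebra1) (auto simp: space_PiM)
  from measurable_compose[OF this measurable_component_singleton[of r]] r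
  show ?thesis by simp
qed

text \<open>Minimality of a generated sigma-algebra. Applied to the identity, with \<open>K\<close>
  a later past or \<open>M\<close>, it yields the inclusions \<open>past_mono\<close> and
  \<open>past_events\<close>.\<close>

lemma measurable_from_past:
  assumes "f \<in> measurable (past s) N" "\<And>r. r \<le> s \<Longrightarrow> X r \<in> borel_measurable K" "space K = space M"
  shows "f \<in> measurable K N"
proof -
  have "(\<lambda>w. \<lambda>r\<in>{..s}. X r w) \<in> measurable K (\<Pi>\<^sub>M r\<in>{..s}. borel)"
    using assms(2) by (intro measurable_restrict) auto
  then have "sets (past s) \<subseteq> sets K"
    unfolding past_def sets_vimage_algebra2[of "\<lambda>w. \<lambda>r\<in>{..s}. X r w" "space M" "Pi\<^sub>M {..s} (\<lambda>_. borel)", simplified space_PiM, simplified]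
    using measurable_sets[of "\<lambda>w. \<lambda>r\<in>{..s}. X r w" K "\<Pi>\<^sub>M r\<in>{..s}. borel"] assms(3) by auto
  then show ?thesis using assms by (intro measurable_mono[THEN subsetD, OF _ _ _ _ assms(1)]) auto
qed

lemma past_mono: "s \<le> t \<Longrightarrow> A \<in> sets (past s) \<Longrightarrow> A \<in> sets (past t)"
proof -
  assume s: "s \<le> t" and A: "A \<in> sets (past s)"
  have "(\<lambda>w. w) \<in> measurable (past t) (past s)"
    by (rule measurable_from_past[of _ s]) (use s in \<open>auto intro: measurable_past\<close>)
  from measurable_sets[OF this A] A sets.sets_into_space[OF A] show ?thesis by (auto simp: Int_absorb2)
qed

lemma past_events: "A \<in> sets (past s) \<Longrightarrow> A \<in> events"
proof -
  assume A: "A \<in> sets (past s)"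
  have "(\<lambda>w. w) \<in> measurable M (past s)"
    by (rule measurable_from_past[of _ s]) auto
  from measurable_sets[OF this A] A sets.sets_into_space[OF A] show ?thesis by (auto simp: Int_absorb2)
qed

lemma increment_indep:
  assumes "s < t" "A \<in> sets (past s)" "B \<in> sets borel"
  shows "prob {w\<in>A. X t w - X s w \<in> B} = prob A * prob {w\<in>space M. X (t - s) w \<in> B}"
proof -
  let ?I = "{w\<in>space M. X t w - X s w \<in> B}"
  have "?I \<in> sets (vimage_algebra (space M) (\<lambda>w. X t w - X s w) borel)"
    using in_vimage_algebra[OF assms(3), of "\<lambda>w. X t w - X s w" "space M"]
    by (auto simp: vimage_def Int_def conj_commute)
  then have "prob (?I \<inter> A) = prob ?I * prob A"
    using indep_setD[OF indep_increments[OF assms(1)], of ?I A] assms(2) by (simp add: past_def)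
  moreover have "?I \<inter> A = {w\<in>A. X t w - X s w \<in> B}"
    using sets.sets_into_space[OF assms(2)] by auto
  moreover have "prob ?I = measure (distr M borel (\<lambda>w. X t w - X s w)) B"
    using assms(3) by (subst measure_distr) (auto intro!: arg_cong[of _ _ prob])
  moreover have "\<dots> = prob {w\<in>space M. X (t - s) w \<in> B}"
    unfolding stationary_increments[OF assms(1)]
    using assms(3) by (subst measure_distr) (auto intro!: arg_cong[of _ _ prob])
  ultimately show ?thesis by simp
qed

text \<open>Induction on \<open>n\<close>: \<open>A\<close> together with the first \<open>n\<close>
  increments is an event of \<open>past (u n)\<close>, so \<open>increment_indep\<close> splits off
  the last one. Carrying \<open>A\<close> along is what turns independence of increments into the
  Markov property.\<close>

lemma chain_indep:
  assumes "\<And>i. i < n \<Longrightarrow> u i < u (Suc i)" "A \<in> sets (past (u 0))" "\<And>i. B i \<in> sets borel"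
  shows "prob {w\<in>A. \<forall>i<n. X (u (Suc i)) w - X (u i) w \<in> B i}
       = prob A * (\<Prod>i<n. prob {w\<in>space M. X (u (Suc i) - u i) w \<in> B i})"
  using assms(1)
proof (induction n)
  case 0
  then show ?case by simp
next
  case (Suc n)
  let ?E = "{w\<in>A. \<forall>i<n. X (u (Suc i)) w - X (u i) w \<in> B i}"
  have mono: "u i \<le> u n" if "i \<le> n" for i
    using that
  proof (induction rule: inc_induct)
    case (step i)
    then show ?case using Suc.prems[of i] by simp
  qed simp
  have m[measurable]: "X (u i) \<in> borel_measurable (past (u n))" if "i \<le> n" for i
    using mono[OF that] by (rule measurable_past)
  have A: "A \<in> sets (past (u n))" using past_mono[OF mono[of 0]] assms(2) by simp
  have "{w\<in>space (past (u n)). \<forall>i<n. X (u (Suc i)) w - X (u i) w \<in> B i} \<in> sets (past (u n))"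
  proof (rule sets.sets_Collect_countable_All)
    show "{w \<in> space (past (u n)). i < n \<longrightarrow> X (u (Suc i)) w - X (u i) w \<in> B i} \<in> sets (past (u n))" for i
    proof (cases "i < n")
      case True
      have [measurable]: "B i \<in> sets borel" using assms(3) .
      have [measurable]: "X (u i) \<in> borel_measurable (past (u n))" "X (u (Suc i)) \<in> borel_measurable (past (u n))"
        using True m[of i] m[of "Suc i"] by auto
      show ?thesis by measurable
    next
      case False
      then show ?thesis using sets.top[of "past (u n)"] by simp
    qed
  qed
  from sets.Int[OF A this] have "A \<inter> {w\<in>space M. \<forall>i<n. X (u (Suc i)) w - X (u i) w \<in> B i} \<in> sets (past (u n))" by simp
  also have "A \<inter> {w\<in>space M. \<forall>i<n. X (u (Suc i)) w - X (u i) w \<in> B i} = ?E"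
    using sets.sets_into_space[OF A] by auto
  finally have E: "?E \<in> sets (past (u n))" .
  have "{w\<in>A. \<forall>i<Suc n. X (u (Suc i)) w - X (u i) w \<in> B i} = {w\<in>?E. X (u (Suc n)) w - X (u n) w \<in> B n}"
    by (auto simp: less_Suc_eq)
  then show ?case
    using increment_indep[OF Suc.prems[of n] E assms(3)[of n]] Suc.IH[OF Suc.prems] by (simp add: mult.assoc)
qed

text \<open>The absolute value makes both paths total functions of a real argument, so that they live in a product
  over \<open>UNIV\<close>.\<close>

definition path_from :: "real \<Rightarrow> 'a \<Rightarrow> real \<Rightarrow> real" where
  "path_from t w q = X (t + \<bar>q\<bar>) w - X t w"

definition path_to :: "real \<Rightarrow> 'a \<Rightarrow> real \<Rightarrow> real" where
  "path_to t w q = X t w - X (t - \<bar>q\<bar>) w"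

lemma measurable_path_from [measurable]: "path_from t \<in> measurable M paths"
  unfolding path_from_def[abs_def] by (rule measurable_PiM_single') auto

lemma measurable_path_to [measurable]: "path_to t \<in> measurable M paths"
  unfolding path_to_def[abs_def] by (rule measurable_PiM_single') auto

lemma path_from_event:
  assumes "{x. S x} \<in> sets paths"
  shows "{w\<in>space M. S (path_from t w)} \<in> events" and "{w\<in>space M. S (path_to t w)} \<in> events"
  using measurable_sets[OF measurable_path_from assms, of t] measurable_sets[OF measurable_path_to assms, of t]
  by (simp_all add: vimage_def Int_def conj_commute)

lemma path_from_0: "w \<in> space M \<Longrightarrow> path_from 0 w q = X \<bar>q\<bar> w"
  by (simp add: path_from_def start_at_zero)

lemma finite_measure_density_indicator: "A \<in> events \<Longrightarrow> finite_measure (density M (indicator A))"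
  by (rule finite_measureI) (simp add: emeasure_density nn_integral_cmult_indicator cong: nn_integral_cong)

text \<open>As functions of \<open>S\<close> both sides are finite measures on path space, images of
  \<open>M\<close> restricted to \<open>A\<close> and of \<open>M\<close> scaled by
  \<open>prob A\<close>. They agree on increments by \<open>chain_indep\<close>, hence everywhere by
  \<open>path_measure_eqI\<close>.\<close>

theorem markov:
  assumes A: "A \<in> sets (past t)" and S: "{x. S x} \<in> sets paths"
  shows "prob {w\<in>A. S (path_from t w)} = prob A * prob {w\<in>space M. S (path_from 0 w)}"
proof -
  have Ae: "A \<in> events" using A by (rule past_events)
  note Asp = sets.sets_into_space[OF Ae]
  define N1 where "N1 = density M (indicator A)"
  define N2 where "N2 = scale_measure (prob A) M"
  have e1: "emeasure N1 E = ennreal (prob (A \<inter> E))" if "E \<in> events" for E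
    using that Ae by (simp add: N1_def emeasure_density emeasure_eq_measure[symmetric] indicator_inter_arith[symmetric] nn_integral_indicator)
  have e2: "emeasure N2 E = ennreal (prob A * prob E)" for E
    by (simp add: N2_def emeasure_eq_measure ennreal_mult)
  have space_N: "space N1 = space M" "space N2 = space M"
    by (auto simp: N1_def N2_def space_scale_measure)
  have eq: "distr N1 paths (\<lambda>w q. (\<lambda>q w. path_from t w q) q w)
          = distr N2 paths (\<lambda>w q. (\<lambda>q w. path_from 0 w q) q w)"
  proof (rule path_measure_eqI)
    show "finite_measure N1" unfolding N1_def using Ae by (rule finite_measure_density_indicator)
    show "finite_measure N2"
      by (rule finite_measureI) (simp add: N2_def space_scale_measure emeasure_eq_measure ennreal_mult_eq_top_iff)
    show "(\<lambda>w. path_from t w q) \<in> borel_measurable N1" "(\<lambda>w. path_from 0 w q) \<in> borel_measurable N2" for q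
      by (auto simp: N1_def N2_def path_from_def measurable_cong_sets[of "scale_measure (prob A) M" M])
    fix n :: nat and u :: "nat \<Rightarrow> real" and B :: "nat \<Rightarrow> real set"
    assume u: "u 0 = 0" "\<And>i. i < n \<Longrightarrow> u i < u (Suc i)" and B: "\<And>i. B i \<in> sets borel"
    have [measurable]: "\<And>i. B i \<in> sets borel" by fact
    have pos: "i \<le> n \<Longrightarrow> 0 \<le> u i" for i
      by (induction i) (use u in \<open>auto simp: Suc_le_eq intro: order.trans[OF _ less_imp_le]\<close>)
    have absu: "i < n \<Longrightarrow> \<bar>u i\<bar> = u i" "i < n \<Longrightarrow> \<bar>u (Suc i)\<bar> = u (Suc i)" for i using pos[of i] pos[of "Suc i"] by auto
    have "prob (A \<inter> {w \<in> space M. \<forall>i<n. path_from t w (u (Suc i)) - path_from t w (u i) \<in> B i})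
        = prob {w\<in>A. \<forall>i<n. X (t + u (Suc i)) w - X (t + u i) w \<in> B i}"
      using Asp by (intro arg_cong[of _ _ prob]) (auto simp: path_from_def absu)
    also have "\<dots> = prob A * (\<Prod>i<n. prob {w\<in>space M. X (u (Suc i) - u i) w \<in> B i})"
      using chain_indep[of n "\<lambda>i. t + u i" A B] u A B by simp
    also have "(\<Prod>i<n. prob {w\<in>space M. X (u (Suc i) - u i) w \<in> B i}) = prob {w\<in>space M. \<forall>i<n. X (u (Suc i)) w - X (u i) w \<in> B i}"
      using chain_indep[of n u "space M" B] u B by (simp add: prob_space sets.top[of "past 0", simplified])
    also have "{w\<in>space M. \<forall>i<n. X (u (Suc i)) w - X (u i) w \<in> B i} =
       {w \<in> space M. \<forall>i<n. path_from 0 w (u (Suc i)) - path_from 0 w (u i) \<in> B i}"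
      by (auto simp: path_from_def absu)
    finally show "emeasure N1 {w \<in> space N1. \<forall>i<n. path_from t w (u (Suc i)) - path_from t w (u i) \<in> B i} =
        emeasure N2 {w \<in> space N2. \<forall>i<n. path_from 0 w (u (Suc i)) - path_from 0 w (u i) \<in> B i}"
      unfolding e2 space_N by (subst e1) (auto simp: path_from_def)
  qed (auto simp: path_from_def)
  have m1: "path_from t \<in> measurable N1 paths" by (simp add: N1_def)
  have m2: "path_from 0 \<in> measurable N2 paths"
    by (simp add: N2_def measurable_cong_sets[of "scale_measure (prob A) M" M])
  have "emeasure N1 (path_from t -` {x. S x} \<inter> space N1) = emeasure N2 (path_from 0 -` {x. S x} \<inter> space N2)"
    using arg_cong[OF eq, of "\<lambda>M. emeasure M {x. S x}"] S m1 m2 by (simp add: emeasure_distr)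
  then have "ennreal (prob (A \<inter> {w\<in>space M. S (path_from t w)})) = ennreal (prob A * prob {w\<in>space M. S (path_from 0 w)})"
    using e1[of "path_from t -` {x. S x} \<inter> space M"] measurable_sets[OF measurable_path_from S, of t]
    by (simp add: e2 space_N vimage_def Int_def conj_commute)
  moreover have "A \<inter> {w\<in>space M. S (path_from t w)} = {w\<in>A. S (path_from t w)}" using Asp by auto
  ultimately show ?thesis by (simp add: ennreal_inj)
qed

corollary path_from_law:
  assumes "{x. S x} \<in> sets paths"
  shows "prob {w\<in>space M. S (path_from t w)} = prob {w\<in>space M. S (path_from 0 w)}"
  using markov[OF sets.top assms, of t] by (simp add: prob_space)

text \<open>Reversing time only permutes the independent stationary increments along a chain, and a
  product of probabilities does not depend on the order.\<close>

theorem path_to_law: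
  assumes S: "{x. S x} \<in> sets paths"
  shows "prob {w\<in>space M. S (path_to t w)} = prob {w\<in>space M. S (path_from 0 w)}"
proof -
  have eq: "distr M paths (\<lambda>w q. (\<lambda>q w. path_to t w q) q w)
          = distr M paths (\<lambda>w q. (\<lambda>q w. path_from 0 w q) q w)"
  proof (rule path_measure_eqI)
    show "(\<lambda>w. path_to t w q) \<in> borel_measurable M" "(\<lambda>w. path_from 0 w q) \<in> borel_measurable M" for q
      by (auto simp: path_to_def path_from_def)
    fix n :: nat and u :: "nat \<Rightarrow> real" and B :: "nat \<Rightarrow> real set"
    assume u: "u 0 = 0" "\<And>i. i < n \<Longrightarrow> u i < u (Suc i)" and B: "\<And>i. B i \<in> sets borel"
    have pos: "i \<le> n \<Longrightarrow> 0 \<le> u i" for i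
      by (induction i) (use u in \<open>auto simp: Suc_le_eq intro: order.trans[OF _ less_imp_le]\<close>)
    have absu: "i < n \<Longrightarrow> \<bar>u i\<bar> = u i" "i < n \<Longrightarrow> \<bar>u (Suc i)\<bar> = u (Suc i)" for i using pos[of i] pos[of "Suc i"] by auto
    \<comment> \<open>The reversed times form an increasing chain that ends at \<open>t\<close>, as
      \<open>chain_indep\<close> requires.\<close>
    define v where "v i = t - u (n - i)" for i
    have v: "v i < v (Suc i)" if "i < n" for i
      using u(2)[of "n - Suc i"] that by (simp add: v_def Suc_diff_Suc)
    have sv: "v (Suc i) - v i = u (Suc (n - Suc i)) - u (n - Suc i)" if "i < n" for i
      using that by (simp add: v_def Suc_diff_Suc)
    have rev: "(\<forall>i<n. P (n - Suc i)) \<longleftrightarrow> (\<forall>i<n. P i)" for P :: "nat \<Rightarrow> bool"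
      by (metis diff_Suc_less Suc_diff_Suc diff_diff_cancel less_imp_le_nat Suc_leI zero_less_diff diff_less zero_less_Suc gr_zeroI not_less0)
    have "{w \<in> space M. \<forall>i<n. path_to t w (u (Suc i)) - path_to t w (u i) \<in> B i} =
         {w \<in> space M. \<forall>i<n. X (t - u i) w - X (t - u (Suc i)) w \<in> B i}"
      by (auto simp: path_to_def absu)
    also have "\<dots> = {w \<in> space M. \<forall>i<n. X (t - u (n - Suc i)) w - X (t - u (Suc (n - Suc i))) w \<in> B (n - Suc i)}"
      using rev[of "\<lambda>i. X (t - u i) _ - X (t - u (Suc i)) _ \<in> B i"] by simp
    also have "\<dots> = {w \<in> space M. \<forall>i<n. X (v (Suc i)) w - X (v i) w \<in> B (n - Suc i)}"
      by (auto simp: v_def Suc_diff_Suc)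
    finally have E: "{w \<in> space M. \<forall>i<n. path_to t w (u (Suc i)) - path_to t w (u i) \<in> B i} =
      {w \<in> space M. \<forall>i<n. X (v (Suc i)) w - X (v i) w \<in> B (n - Suc i)}" .
    have "prob {w \<in> space M. \<forall>i<n. X (v (Suc i)) w - X (v i) w \<in> B (n - Suc i)}
       = (\<Prod>i<n. prob {w\<in>space M. X (v (Suc i) - v i) w \<in> B (n - Suc i)})"
      using chain_indep[of n v "space M" "\<lambda>i. B (n - Suc i)"] v B by (simp add: prob_space sets.top[of "past (v 0)", simplified])
    also have "\<dots> = (\<Prod>i<n. prob {w\<in>space M. X (u (Suc (n - Suc i)) - u (n - Suc i)) w \<in> B (n - Suc i)})"
      using sv by (intro prod.cong) auto
    also have "\<dots> = (\<Prod>i<n. prob {w\<in>space M. X (u (Suc i) - u i) w \<in> B i})"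
      by (rule prod.nat_diff_reindex)
    also have "\<dots> = prob {w\<in>space M. \<forall>i<n. X (u (Suc i)) w - X (u i) w \<in> B i}"
      using chain_indep[of n u "space M" B] u B by (simp add: prob_space sets.top[of "past 0", simplified])
    also have "{w\<in>space M. \<forall>i<n. X (u (Suc i)) w - X (u i) w \<in> B i} =
       {w \<in> space M. \<forall>i<n. path_from 0 w (u (Suc i)) - path_from 0 w (u i) \<in> B i}"
      by (auto simp: path_from_def absu)
    finally show "emeasure M {w \<in> space M. \<forall>i<n. path_to t w (u (Suc i)) - path_to t w (u i) \<in> B i} =
        emeasure M {w \<in> space M. \<forall>i<n. path_from 0 w (u (Suc i)) - path_from 0 w (u i) \<in> B i}"
      by (simp add: E emeasure_eq_measure)
  qed (auto simp: path_from_def path_to_def intro: finite_measure_axioms)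
  from arg_cong[OF eq, of "\<lambda>M. measure M {x. S x}"] S show ?thesis
    by (simp add: measure_distr vimage_def Int_def conj_commute)
qed

text \<open>With factor \<open>1\<close> or \<open>- 1\<close> and slope \<alpha> this makes every
  result of the locale available for \<open>V\<close> and \<open>V'\<close>.\<close>

lemma affine: "two_sided_levy_process M (\<lambda>t w. c * X t w + b * t)"
proof
  fix t
  show "random_variable borel (\<lambda>w. c * X t w + b * t)" by simp
  show "continuous (at_right t) (\<lambda>s. c * X s w + b * s)" if "w \<in> space M" for w
    using right_continuous[OF that] by (intro continuous_intros)
  show "\<exists>l. ((\<lambda>s. c * X s w + b * s) \<longlongrightarrow> l) (at_left t)" if "w \<in> space M" for w
  proof -
    obtain l where "((\<lambda>s. X s w) \<longlongrightarrow> l) (at_left t)" using left_limits \<open>w \<in> space M\<close> by blast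
    then have "((\<lambda>s. c * X s w + b * s) \<longlongrightarrow> c * l + b * t) (at_left t)" by (intro tendsto_intros)
    then show ?thesis by blast
  qed
  show "c * X 0 w + b * 0 = 0" if "w \<in> space M" for w using that by (simp add: start_at_zero)
  fix s assume st: "s < t"
  have 1: "sets (vimage_algebra (space M) (\<lambda>w. c * X t w + b * t - (c * X s w + b * s)) borel)
    \<subseteq> sets (vimage_algebra (space M) (\<lambda>w. X t w - X s w) borel)"
    by (rule vimage_algebra_compose_subset[where h = "\<lambda>x. c * x + b * (t - s)"]) (auto simp: algebra_simps)
  have 2: "sets (vimage_algebra (space M) (\<lambda>w. \<lambda>r\<in>{..s}. c * X r w + b * r) (\<Pi>\<^sub>M r\<in>{..s}. borel))
     \<subseteq> sets (vimage_algebra (space M) (\<lambda>w. \<lambda>r\<in>{..s}. X r w) (\<Pi>\<^sub>M r\<in>{..s}. borel))"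
    by (rule vimage_algebra_compose_subset[where h = "\<lambda>x. \<lambda>r\<in>{..s}. c * x r + b * r"]) (auto simp: space_PiM fun_eq_iff)
  show "indep_set (sets (vimage_algebra (space M) (\<lambda>w. c * X t w + b * t - (c * X s w + b * s)) borel))
     (sets (vimage_algebra (space M) (\<lambda>w. \<lambda>r\<in>{..s}. c * X r w + b * r) (\<Pi>\<^sub>M r\<in>{..s}. borel)))"
    using indep_setD[OF indep_increments[OF st]] 1 2
      indep_setD_ev1[OF indep_increments[OF st]] indep_setD_ev2[OF indep_increments[OF st]]
    by (intro indep_setI) (blast+)
  have "distr M borel (\<lambda>w. c * X t w + b * t - (c * X s w + b * s))
     = distr (distr M borel (\<lambda>w. X t w - X s w)) borel (\<lambda>x. c * x + b * (t - s))"
    by (subst distr_distr) (auto simp: o_def algebra_simps)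
  also have "\<dots> = distr (distr M borel (X (t - s))) borel (\<lambda>x. c * x + b * (t - s))"
    using stationary_increments[OF st] by simp
  also have "\<dots> = distr M borel (\<lambda>w. c * X (t - s) w + b * (t - s))"
    by (subst distr_distr) (auto simp: o_def)
  finally show "distr M borel (\<lambda>w. c * X t w + b * t - (c * X s w + b * s)) = distr M borel (\<lambda>w. c * X (t - s) w + b * (t - s))" .
qed

end

section \<open>Lower bounds for a process with positive mean\<close>

lemma dyadic_between:
  fixes a b :: real
  assumes "0 \<le> a" "a < b"
  obtains k j :: nat where "a < j / 2 ^ k" "j / 2 ^ k < b"
proof -
  obtain k :: nat where k: "(1/2) ^ k < b - a"
    using real_arch_pow_inv[of "b - a" "1/2"] assms by auto
  define j where "j = nat \<lfloor>a * 2 ^ k\<rfloor> + 1"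
  have j: "real j = of_int \<lfloor>a * 2 ^ k\<rfloor> + 1" using assms by (simp add: j_def)
  have "a * 2 ^ k < j" "real j \<le> a * 2 ^ k + 1" unfolding j by linarith+
  then have "a < j / 2 ^ k" "j / 2 ^ k \<le> a + (1/2) ^ k"
    by (auto simp: field_simps power_divide)
  then show ?thesis using k by (intro that[of j k]) auto
qed

text \<open>An open condition at \<open>t\<close> persists on a right neighbourhood, and since
  \<open>t\<close> is nonnegative this neighbourhood contains dyadic points with natural
  numerators.\<close>

lemma dyadic_right_approx:
  fixes f :: "real \<Rightarrow> real"
  assumes "continuous (at_right t) f" "0 \<le> t" "open U" "f t \<in> U" "t < r"
  shows "\<exists>k j::nat. t < j / 2 ^ k \<and> j / 2 ^ k < r \<and> f (j / 2 ^ k) \<in> U"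
proof -
  have "\<forall>\<^sub>F s in at_right t. f s \<in> U"
    using assms by (intro topological_tendstoD[of f "f t"]) (auto simp: continuous_within)
  then obtain d where d: "t < d" "\<And>s. t < s \<Longrightarrow> s < d \<Longrightarrow> f s \<in> U"
    unfolding eventually_at_right_field by auto
  obtain k j :: nat where "t < j / 2 ^ k" "j / 2 ^ k < min d r"
    by (rule dyadic_between[of t "min d r"]) (use assms d in auto)
  then show ?thesis using d by (intro exI[of _ k] exI[of _ j]) auto
qed

lemma continuous_at_right_shift:
  fixes f :: "real \<Rightarrow> real"
  assumes "continuous (at_right (r + s)) f"
  shows "continuous (at_right s) (\<lambda>x. f (r + x))"
proof -
  have "filterlim (\<lambda>x. r + x) (at_right (r + s)) (at_right s)"
    unfolding filterlim_at by (auto intro!: tendsto_eq_intros eventually_at_right_less simp: eventually_at_filter)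
  with assms show ?thesis
    unfolding continuous_within by (rule filterlim_compose)
qed

text \<open>Turns regularity into a countable condition. An empty set of hits fails on both sides,
  its infimum being \<infinity>.\<close>

lemma Inf_ereal_eq_0_iff:
  assumes "T \<subseteq> {0<..}"
  shows "Inf (ereal ` T) = 0 \<longleftrightarrow> (\<forall>n::nat. \<exists>t\<in>T. t \<le> 1 / 2 ^ n)"
proof
  assume L: "Inf (ereal ` T) = 0"
  show "\<forall>n::nat. \<exists>t\<in>T. t \<le> 1 / 2 ^ n"
  proof
    fix n :: nat
    have "Inf (ereal ` T) < ereal (1 / 2 ^ n)" using L by simp
    then show "\<exists>t\<in>T. t \<le> 1 / 2 ^ n" by (auto simp: Inf_less_iff intro: less_imp_le)
  qed
next
  assume R: "\<forall>n::nat. \<exists>t\<in>T. t \<le> 1 / 2 ^ n"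
  show "Inf (ereal ` T) = 0"
  proof (rule antisym)
    show "0 \<le> Inf (ereal ` T)" using assms by (intro Inf_greatest) (auto intro: less_imp_le)
    show "Inf (ereal ` T) \<le> 0"
    proof (rule ereal_le_epsilon2)
      fix e :: real assume "0 < e"
      then obtain n :: nat where n: "(1/2) ^ n < e" using real_arch_pow_inv[of e "1/2"] by auto
      obtain t where t: "t \<in> T" "t \<le> 1 / 2 ^ n" using R by blast
      have "Inf (ereal ` T) \<le> ereal t" using t by (intro Inf_lower) auto
      also have "\<dots> \<le> 0 + ereal e" using t n by (simp add: power_divide)
      finally show "Inf (ereal ` T) \<le> 0 + ereal e" .
    qed
  qed
qed

text \<open>One-sided limits bound the path near each point, and bisection (\<open>Bolzano\<close>)
  extends this to compact intervals.\<close>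

lemma cadlag_bounded_above:
  fixes f :: "real \<Rightarrow> real"
  assumes rc: "\<And>t. continuous (at_right t) f" and ll: "\<And>t. \<exists>l. (f \<longlongrightarrow> l) (at_left t)" and "a \<le> b"
  shows "\<exists>c. \<forall>t. a \<le> t \<and> t \<le> b \<longrightarrow> f t \<le> c"
  using \<open>a \<le> b\<close>
proof (induction rule: Bolzano)
  case (trans a b c)
  then obtain c1 c2 where "\<forall>t. a \<le> t \<and> t \<le> b \<longrightarrow> f t \<le> c1" "\<forall>t. b \<le> t \<and> t \<le> c \<longrightarrow> f t \<le> c2" by auto
  then have "\<forall>t. a \<le> t \<and> t \<le> c \<longrightarrow> f t \<le> max c1 c2" by (smt (verit))
  then show ?case by blast
next
  case (local x)
  have "\<forall>\<^sub>F s in at_right x. f s < f x + 1"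
    using rc[of x] by (intro order_tendstoD[of f "f x"]) (auto simp: continuous_within)
  then obtain d1 where d1: "x < d1" "\<And>s. x < s \<Longrightarrow> s < d1 \<Longrightarrow> f s < f x + 1"
    unfolding eventually_at_right_field by auto
  obtain l where l: "(f \<longlongrightarrow> l) (at_left x)" using ll by blast
  then have "\<forall>\<^sub>F s in at_left x. f s < l + 1"
    by (intro order_tendstoD[of f l]) auto
  then obtain d2 where d2: "d2 < x" "\<And>s. d2 < s \<Longrightarrow> s < x \<Longrightarrow> f s < l + 1"
    unfolding eventually_at_left_field by auto
  have *: "f t \<le> max (f x + 1) (l + 1)" if "d2 < t" "t < d1" for t
    using d1(2)[of t] d2(2)[of t] that by (cases t x rule: linorder_cases) auto
  show ?case
  proof (intro exI conjI allI impI)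
    show "0 < min (d1 - x) (x - d2)" using d1 d2 by simp
    fix a b t assume "a \<le> x \<and> x \<le> b \<and> b - a < min (d1 - x) (x - d2)" "a \<le> t \<and> t \<le> b"
    then show "f t \<le> max (f x + 1) (l + 1)" by (intro *) linarith+
  qed
qed

context two_sided_levy_process
begin

text \<open>A strict violation at a real time persists to its right by right continuity and is
  therefore seen at a dyadic displacement.\<close>

lemma path_from_dyadic_ge_iff:
  assumes "w \<in> space M"
  shows "(\<forall>k j::nat. c \<le> path_from t w (j / 2 ^ k)) \<longleftrightarrow> (\<forall>s\<ge>t. X t w + c \<le> X s w)"
proof (intro iffI allI impI)
  fix s :: real assume L: "\<forall>k j::nat. c \<le> path_from t w (j / 2 ^ k)" and s: "t \<le> s"
  show "X t w + c \<le> X s w"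
  proof (rule ccontr)
    assume "\<not> X t w + c \<le> X s w"
    then have neg: "X (t + (s - t)) w \<in> {..<X t w + c}" by simp
    have "continuous (at_right (s - t)) (\<lambda>s. X (t + s) w)"
      by (rule continuous_at_right_shift[OF right_continuous[OF assms]])
    from dyadic_right_approx[OF this _ open_lessThan neg, of "s - t + 1"] s
    obtain k j :: nat where "X (t + j / 2 ^ k) w < X t w + c" by auto
    moreover have "c \<le> path_from t w (j / 2 ^ k)" using L by blast
    ultimately show False by (simp add: path_from_def)
  qed
next
  fix k j :: nat assume "\<forall>s\<ge>t. X t w + c \<le> X s w"
  from this[rule_format, of "t + j / 2 ^ k"] show "c \<le> path_from t w (j / 2 ^ k)"
    by (simp add: path_from_def)
qed

lemma distr_path_from:
  "distr M paths (path_from t) = distr M paths (path_from 0)"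
proof (rule measure_eqI)
  fix A assume "A \<in> sets (distr M paths (path_from t))"
  then have A: "A \<in> sets paths" by simp
  show "emeasure (distr M paths (path_from t)) A = emeasure (distr M paths (path_from 0)) A"
    using path_from_law[of "\<lambda>x. x \<in> A" t] A
    by (simp add: emeasure_distr emeasure_eq_measure vimage_def Int_def conj_commute)
qed simp

section \<open>The integer skeleton: a maximal inequality and boundedness below\<close>

lemma integrable_X_nat:
  assumes "integrable M (X 1)"
  shows "integrable M (X (real n))"
proof (induction n)
  case 0
  have "integrable M (X 0) \<longleftrightarrow> integrable M (\<lambda>_. 0::real)"
    by (rule Bochner_Integration.integrable_cong) (auto simp: start_at_zero)
  then show ?case by simp
next
  case (Suc n)
  have "integrable (distr M borel (X (real (Suc n) - real n))) (\<lambda>x. x)"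
    using assms by (subst integrable_distr_eq) auto
  then have "integrable (distr M borel (\<lambda>w. X (real (Suc n)) w - X (real n) w)) (\<lambda>x. x)"
    by (subst stationary_increments) auto
  then have "integrable M (\<lambda>w. X (real (Suc n)) w - X (real n) w)"
    by (subst (asm) integrable_distr_eq) auto
  from Bochner_Integration.integrable_add[OF this Suc] show ?case by simp
qed

text \<open>On the event that the partial minimum of the skeleton is negative it equals \<open>X 1\<close> plus the
  partial minimum of the shifted path, up to one more step. Both minima have the same expectation,
  as in Garsia's proof of the maximal ergodic theorem.\<close>

lemma maximal_ergodic:
  assumes "integrable M (X 1)"
  shows "(\<integral>w. X 1 w * indicator {w. \<exists>k\<le>n. X (real k) w < 0} w \<partial>M) \<le> 0"
proof -
  define W where "W x = Min ((\<lambda>k. x (real k)) ` {..n})" for x :: "real \<Rightarrow> real"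
  have [measurable]: "W \<in> borel_measurable paths"
    unfolding W_def[abs_def] by measurable
  note int = integrable_X_nat[OF assms]
  have intW0: "integrable M (\<lambda>w. W (path_from 0 w))"
  proof (rule Bochner_Integration.integrable_bound)
    show "integrable M (\<lambda>w. \<Sum>k\<le>n. \<bar>X (real k) w\<bar>)"
      by (intro Bochner_Integration.integrable_sum integrable_abs int)
    show "AE w in M. norm (W (path_from 0 w)) \<le> norm (\<Sum>k\<le>n. \<bar>X (real k) w\<bar>)"
    proof (rule AE_I2)
      fix w assume w: "w \<in> space M"
      have "W (path_from 0 w) \<in> (\<lambda>k. path_from 0 w (real k)) ` {..n}"
        unfolding W_def by (rule Min_in) auto
      then obtain k where k: "k \<le> n" "W (path_from 0 w) = X (real k) w" using w by (auto simp: path_from_0)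
      have "\<bar>X (real k) w\<bar> \<le> (\<Sum>k\<le>n. \<bar>X (real k) w\<bar>)"
        using k by (intro member_le_sum) auto
      then show "norm (W (path_from 0 w)) \<le> norm (\<Sum>k\<le>n. \<bar>X (real k) w\<bar>)" using k by simp
    qed
  qed measurable
  have intW1: "integrable M (\<lambda>w. W (path_from 1 w))"
  proof -
    have "integrable (distr M paths (path_from 0)) W"
      using intW0 by (subst integrable_distr_eq) auto
    then show ?thesis unfolding distr_path_from[of 1, symmetric] by (subst (asm) integrable_distr_eq) auto
  qed
  have eqW: "(\<integral>w. W (path_from 1 w) \<partial>M) = (\<integral>w. W (path_from 0 w) \<partial>M)"
    using arg_cong[OF distr_path_from[of 1], of "\<lambda>N. integral\<^sup>L N W"] by (simp add: integral_distr)
  have "(\<integral>w. X 1 w * indicator {w. \<exists>k\<le>n. X (real k) w < 0} w \<partial>M)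
     \<le> (\<integral>w. W (path_from 0 w) - W (path_from 1 w) \<partial>M)"
  proof (rule integral_mono)
    have [measurable]: "(\<lambda>w. indicator {w. \<exists>k\<le>n. X (real k) w < 0} w :: real) \<in> borel_measurable M"
      by (rule borel_measurable_indicator_Collect) measurable
    show "integrable M (\<lambda>w. X 1 w * indicator {w. \<exists>k\<le>n. X (real k) w < 0} w)"
      by (rule Bochner_Integration.integrable_bound[OF assms]) (auto simp: indicator_def)
    show "integrable M (\<lambda>w. W (path_from 0 w) - W (path_from 1 w))"
      using intW0 intW1 by simp
    fix w assume w: "w \<in> space M"
    have W1: "W (path_from 1 w) \<le> X (real (Suc k)) w - X 1 w" if "k \<le> n" for k
    proof -
      have "W (path_from 1 w) \<le> path_from 1 w (real k)" unfolding W_def using that by (intro Min_le) auto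
      then show ?thesis by (simp add: path_from_def)
    qed
    have "W (path_from 0 w) \<in> (\<lambda>k. path_from 0 w (real k)) ` {..n}"
      unfolding W_def by (rule Min_in) auto
    then obtain k where k: "k \<le> n" "W (path_from 0 w) = X (real k) w" using w by (auto simp: path_from_0)
    have W0: "W (path_from 0 w) \<le> X (real i) w" if "i \<le> n" for i
    proof -
      have "W (path_from 0 w) \<le> path_from 0 w (real i)" unfolding W_def using that by (intro Min_le) auto
      then show ?thesis using w by (simp add: path_from_0)
    qed
    show "X 1 w * indicator {w. \<exists>k\<le>n. X (real k) w < 0} w \<le> W (path_from 0 w) - W (path_from 1 w)"
    proof (cases "\<exists>k\<le>n. X (real k) w < 0")
      case True
      then have "X (real k) w < 0" using W0 k by fastforce
      \<comment> \<open>A negative minimum is not attained at index 0, so the minimising time is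
        among those seen by the path restarted at time 1.\<close>
      then obtain k' where k': "k = Suc k'" using start_at_zero[OF w] by (cases k) auto
      have "W (path_from 1 w) \<le> X (real k) w - X 1 w" using W1[of k'] k k' by simp
      then show ?thesis using True k by simp
    next
      case False
      then have "0 \<le> W (path_from 0 w)" using k by (auto simp: not_less)
      moreover have "W (path_from 1 w) \<le> 0" using W1[of 0] by simp
      ultimately show ?thesis using False by simp
    qed
  qed
  also have "\<dots> = 0" using intW0 intW1 eqW by simp
  finally show ?thesis .
qed

text \<open>Otherwise the skeleton becomes negative almost surely, the events in
  \<open>maximal_ergodic\<close> increase to almost the whole space, and dominated convergence gives
  a nonpositive mean.\<close>

lemma prob_skeleton_nonneg:
  assumes "integrable M (X 1)" "0 < (\<integral>w. X 1 w \<partial>M)"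
  shows "0 < prob {w\<in>space M. \<forall>n::nat. 0 \<le> X (real n) w}"
proof (rule ccontr)
  assume "\<not> ?thesis"
  then have "prob {w\<in>space M. \<forall>n::nat. 0 \<le> X (real n) w} = 0"
    using measure_nonneg[of M] by (simp add: not_less antisym)
  then have AE: "AE w in M. \<exists>n::nat. X (real n) w < 0"
    by (subst (asm) prob_eq_0) (auto simp: not_le)
  define f where "f n w = X 1 w * indicator {w. \<exists>k\<le>n. X (real k) w < 0} w" for n :: nat and w
  have "(\<lambda>n. \<integral>w. f n w \<partial>M) \<longlonglongrightarrow> (\<integral>w. X 1 w \<partial>M)"
  proof (rule integral_dominated_convergence[where w = "\<lambda>w. \<bar>X 1 w\<bar>"])
    show "f n \<in> borel_measurable M" for n
      unfolding f_def[abs_def] by (intro borel_measurable_times borel_measurable_indicator_Collect) measurable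
    show "integrable M (\<lambda>w. \<bar>X 1 w\<bar>)" using assms by simp
    show "AE w in M. (\<lambda>n. f n w) \<longlonglongrightarrow> X 1 w"
      using AE
    proof eventually_elim
      case (elim w)
      then obtain m :: nat where m: "X (real m) w < 0" by blast
      have "f n w = X 1 w" if "m \<le> n" for n using m that by (auto simp: f_def indicator_def)
      then show ?case by (intro tendsto_eventually eventually_sequentiallyI[of m]) auto
    qed
  qed (auto simp: f_def indicator_def)
  then have "(\<integral>w. X 1 w \<partial>M) \<le> 0"
    by (rule LIMSEQ_le_const2) (use maximal_ergodic[OF assms(1)] in \<open>auto simp: f_def\<close>)
  with assms(2) show False by simp
qed

text \<open>A substitute for the strong Markov property. The event that \<open>j\<close> is the
  first index with \<open>X (u j)\<close> in \<open>B\<close> lies in \<open>past (u j)\<close>, so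
  \<open>markov\<close> applies to each \<open>j\<close> separately. Letting \<open>S\<close> depend
  on \<open>j\<close> allows continuations up to a deterministic later time.\<close>

lemma first_hit_sums:
  fixes u :: "nat \<Rightarrow> real"
  assumes u: "mono u" and B [measurable]: "B \<in> sets borel"
    and S: "\<And>j. {x. S j x} \<in> sets paths"
  shows "(\<lambda>j. prob {w\<in>space M. X (u j) w \<in> B \<and> (\<forall>i<j. X (u i) w \<notin> B)} * prob {w\<in>space M. S j (path_from 0 w)})
    sums prob {w\<in>space M. \<exists>j. X (u j) w \<in> B \<and> (\<forall>i<j. X (u i) w \<notin> B) \<and> S j (path_from (u j) w)}"
proof -
  define T where "T j = {w\<in>space M. X (u j) w \<in> B \<and> (\<forall>i<j. X (u i) w \<notin> B)}" for j
  have T: "T j \<in> sets (past (u j))" for j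
  proof -
    \<comment> \<open>The index \<open>min i j\<close> keeps every time within the past of
      \<open>u j\<close>, also for those \<open>i\<close> that the bounded quantifier
      excludes.\<close>
    have [measurable]: "X (u (min i j)) \<in> borel_measurable (past (u j))" for i
      using u by (intro measurable_past) (auto simp: mono_def)
    have "T j = {w\<in>space (past (u j)). X (u (min j j)) w \<in> B \<and> (\<forall>i<j. X (u (min i j)) w \<notin> B)}"
      by (auto simp: T_def)
    also have "\<dots> \<in> sets (past (u j))" by measurable
    finally show ?thesis .
  qed
  define E where "E j = {w\<in>T j. S j (path_from (u j) w)}" for j
  have "E j \<in> events" for j
  proof -
    have "E j = T j \<inter> (path_from (u j) -` {x. S j x} \<inter> space M)" by (auto simp: E_def T_def)
    then show ?thesis using past_events[OF T] measurable_sets[OF measurable_path_from S] by auto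
  qed
  moreover have "disjoint_family E"
    unfolding disjoint_family_on_def E_def T_def by (auto, metis linorder_neqE_nat)
  ultimately have "(\<lambda>j. prob (E j)) sums prob (\<Union>j. E j)"
    by (intro finite_measure_UNION) auto
  moreover have "prob (E j) = prob (T j) * prob {w\<in>space M. S j (path_from 0 w)}" for j
    unfolding E_def by (rule markov[OF T S])
  moreover have "(\<Union>j. E j) = {w\<in>space M. \<exists>j. X (u j) w \<in> B \<and> (\<forall>i<j. X (u i) w \<notin> B) \<and> S j (path_from (u j) w)}"
    by (auto simp: E_def T_def)
  ultimately show ?thesis by (simp add: T_def)
qed

lemma first_hit_total:
  fixes u :: "nat \<Rightarrow> real"
  assumes u: "mono u" and B [measurable]: "B \<in> sets borel"
  shows "(\<lambda>j. prob {w\<in>space M. X (u j) w \<in> B \<and> (\<forall>i<j. X (u i) w \<notin> B)})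
    sums prob {w\<in>space M. \<exists>j. X (u j) w \<in> B}"
proof -
  have "(\<exists>j. X (u j) w \<in> B \<and> (\<forall>i<j. X (u i) w \<notin> B)) \<longleftrightarrow> (\<exists>j. X (u j) w \<in> B)" for w
    using exists_least_iff[of "\<lambda>j. X (u j) w \<in> B"] by blast
  then show ?thesis
    using first_hit_sums[OF u B, of "\<lambda>_ _. True"] by (simp add: prob_space sets.top[of "paths", simplified space_PiM, simplified])
qed

text \<open>A bound on the continuation that is uniform in the hitting index can be taken out of the
  sum over that index.\<close>

lemma first_hit_lower:
  fixes u :: "nat \<Rightarrow> real"
  assumes "mono u" "B \<in> sets borel" "\<And>j. {x. S j x} \<in> sets paths"
    and "\<And>j. \<delta> \<le> prob {w\<in>space M. S j (path_from 0 w)}"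
  shows "\<delta> * prob {w\<in>space M. \<exists>j. X (u j) w \<in> B}
    \<le> prob {w\<in>space M. \<exists>j. X (u j) w \<in> B \<and> (\<forall>i<j. X (u i) w \<notin> B) \<and> S j (path_from (u j) w)}"
proof (rule sums_le[OF _ sums_mult[OF first_hit_total[OF assms(1,2)]] first_hit_sums[OF assms(1-3)]])
  fix n show "\<delta> * prob {w\<in>space M. X (u n) w \<in> B \<and> (\<forall>i<n. X (u i) w \<notin> B)}
    \<le> prob {w\<in>space M. X (u n) w \<in> B \<and> (\<forall>i<n. X (u i) w \<notin> B)} * prob {w\<in>space M. S n (path_from 0 w)}"
    by (subst mult.commute) (rule mult_left_mono[OF assms(4) measure_nonneg])
qed

lemma first_hit_upper:
  fixes u :: "nat \<Rightarrow> real"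
  assumes "mono u" "B \<in> sets borel" "\<And>j. {x. S j x} \<in> sets paths"
    and "\<And>j. prob {w\<in>space M. S j (path_from 0 w)} \<le> \<delta>"
  shows "prob {w\<in>space M. \<exists>j. X (u j) w \<in> B \<and> (\<forall>i<j. X (u i) w \<notin> B) \<and> S j (path_from (u j) w)}
    \<le> \<delta> * prob {w\<in>space M. \<exists>j. X (u j) w \<in> B}"
proof (rule sums_le[OF _ first_hit_sums[OF assms(1-3)] sums_mult[OF first_hit_total[OF assms(1,2)]]])
  fix n show "prob {w\<in>space M. X (u n) w \<in> B \<and> (\<forall>i<n. X (u i) w \<notin> B)} * prob {w\<in>space M. S n (path_from 0 w)}
    \<le> \<delta> * prob {w\<in>space M. X (u n) w \<in> B \<and> (\<forall>i<n. X (u i) w \<notin> B)}"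
    by (subst mult.commute[of \<delta>]) (rule mult_left_mono[OF assms(4) measure_nonneg])
qed

text \<open>Let U be the event in question and F the event that the skeleton becomes negative, which
  contains U. Restarting at the first negative value, the path is bounded below afterwards with
  probability 1 - P(U), and then U fails. Hence (1 - P(U)) P(F) + P(U) is at most P(F), that is,
  P(U) (1 - P(F)) is at most 0, while P(F) < 1 by \<open>prob_skeleton_nonneg\<close>.\<close>

lemma prob_skeleton_unbounded_below:
  assumes "integrable M (X 1)" "0 < (\<integral>w. X 1 w \<partial>M)"
  shows "prob {w\<in>space M. \<forall>k::nat. \<exists>n::nat. X (real n) w < - real k} = 0"
proof -
  let ?U = "{w\<in>space M. \<forall>k::nat. \<exists>n::nat. X (real n) w < - real k}"
  let ?F = "{w\<in>space M. \<exists>j::nat. X (real j) w \<in> {..<0}}"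
  let ?S = "\<lambda>x::real \<Rightarrow> real. \<exists>k::nat. \<forall>n::nat. - real k \<le> x (real n)"
  let ?E = "{w\<in>space M. \<exists>j::nat. X (real j) w \<in> {..<0} \<and> (\<forall>i<j. X (real i) w \<notin> {..<0}) \<and> ?S (path_from (real j) w)}"
  have Sm: "{x. ?S x} \<in> sets paths"
    by (rule sets_paths_Collect) measurable
  have "{w\<in>space M. ?S (path_from 0 w)} = space M - ?U"
    by (simp add: set_eq_iff path_from_0 not_less cong: conj_cong)
  then have S: "prob {w\<in>space M. ?S (path_from 0 w)} = 1 - prob ?U"
    by (simp add: prob_compl)
  have E: "(1 - prob ?U) * prob ?F \<le> prob ?E"
    by (rule first_hit_lower[of real "{..<0}" "\<lambda>_. ?S"]) (use S Sm in \<open>auto simp: mono_def\<close>)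
  have Ee: "?E \<in> events"
  proof -
    note [measurable] = path_from_event(1)[OF Sm]
    show ?thesis by measurable
  qed
  have disj: "?E \<inter> ?U = {}"
  proof (rule equals0I)
    fix w assume "w \<in> ?E \<inter> ?U"
    then obtain j k where j: "X (real j) w \<in> {..<0}" "\<forall>i<j. X (real i) w \<notin> {..<0}"
      and k: "\<forall>n::nat. - real k \<le> path_from (real j) w (real n)" and U: "\<forall>k::nat. \<exists>n::nat. X (real n) w < - real k"
      by blast
    obtain k' :: nat where k': "- X (real j) w \<le> real k'" using real_arch_simple by blast
    obtain n :: nat where n: "X (real n) w < - real (k + k')" using U by blast
    show False
    proof (cases "n < j")
      case True
      then have "0 \<le> X (real n) w" using j by (auto simp: not_less)
      then show ?thesis using n by simp
    next
      case False
      have "- real k \<le> X (real n) w - X (real j) w"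
        using k[rule_format, of "n - j"] False by (simp add: path_from_def of_nat_diff)
      then show ?thesis using n k' by simp
    qed
  qed
  have "?U \<subseteq> ?F"
  proof (rule subsetI)
    fix w assume "w \<in> ?U"
    then have "w \<in> space M" "\<exists>n::nat. X (real n) w < - real 0" by blast+
    then show "w \<in> ?F" by simp
  qed
  then have "prob ?E + prob ?U \<le> prob ?F"
    using disj Ee by (subst finite_measure_Union[symmetric]) (auto intro!: finite_measure_mono)
  with E have "prob ?U * (1 - prob ?F) \<le> 0" by (simp add: algebra_simps)
  moreover have "prob ?F < 1"
  proof -
    have "prob ?F = 1 - prob {w\<in>space M. \<forall>n::nat. 0 \<le> X (real n) w}"
      by (subst prob_neg[symmetric]) (measurable, simp add: not_le)
    then show ?thesis using prob_skeleton_nonneg[OF assms] by simp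
  qed
  ultimately have "prob ?U \<le> 0" by (auto simp only: mult_le_0_iff)
  with measure_nonneg[of M ?U] show ?thesis by (rule antisym[rotated])
qed

section \<open>From the integer skeleton to all dyadic times\<close>

lemma incseq_dyadic_events:
  "incseq (\<lambda>k. {w\<in>space M. \<exists>j::nat. P (X (real j / 2 ^ k) w)})"
proof (rule incseq_SucI, safe)
  fix k j w assume "P (X (real j / 2 ^ k) w)"
  then show "\<exists>j. P (X (real j / 2 ^ Suc k) w)" by (intro exI[of _ "2 * j"]) simp
qed

lemma LIMSEQ_prob_dyadic:
  assumes [measurable]: "Measurable.pred borel P"
  shows "(\<lambda>k. prob {w\<in>space M. \<exists>j::nat. P (X (real j / 2 ^ k) w)})
    \<longlonglongrightarrow> prob {w\<in>space M. \<exists>k j::nat. P (X (real j / 2 ^ k) w)}"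
proof -
  have "(\<Union>k. {w\<in>space M. \<exists>j::nat. P (X (real j / 2 ^ k) w)}) = {w\<in>space M. \<exists>k j::nat. P (X (real j / 2 ^ k) w)}"
    by auto
  moreover have m: "{w\<in>space M. \<exists>j::nat. P (X (real j / 2 ^ k) w)} \<in> events" for k
    by measurable
  ultimately show ?thesis
    using finite_Lim_measure_incseq[OF _ incseq_dyadic_events[of P]] m by (simp add: image_subset_iff)
qed

text \<open>Each path is bounded above on the unit interval, so the events \<open>A n\<close>
  exhaust the space and one of them has probability above one half. The point is that a single level
  serves for all \<open>s\<close>.\<close>

lemma bounded_above_in_probability:
  obtains b :: nat where "\<And>s. 0 \<le> s \<Longrightarrow> s \<le> 1 \<Longrightarrow> 1 / 2 \<le> prob {w\<in>space M. X s w \<le> real b}"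
proof -
  define A where "A n = {w\<in>space M. X 1 w \<le> real n \<and> (\<forall>k j::nat. real j / 2 ^ k \<le> 1 \<longrightarrow> X (real j / 2 ^ k) w \<le> real n)}" for n :: nat
  have Ae: "A n \<in> events" for n unfolding A_def by measurable
  have "incseq A" by (rule incseq_SucI) (force simp: A_def)
  moreover have "(\<Union>n. A n) = space M"
  proof safe
    fix w assume w: "w \<in> space M"
    obtain c where c: "\<forall>t. 0 \<le> t \<and> t \<le> 1 \<longrightarrow> X t w \<le> c"
      using cadlag_bounded_above[of "\<lambda>s. X s w" 0 1] right_continuous[OF w] left_limits[OF w] by auto
    obtain n :: nat where "c \<le> real n" using real_arch_simple by blast
    then have "w \<in> A n" using c w by (auto simp: A_def intro: order_trans[of _ c "real n"])
    then show "w \<in> (\<Union>n. A n)" by blast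
  qed (auto simp: A_def)
  ultimately have "(\<lambda>n. prob (A n)) \<longlonglongrightarrow> 1"
    using finite_Lim_measure_incseq[of A] Ae by (auto simp: prob_space)
  then have "\<forall>\<^sub>F n in sequentially. 1 / 2 < prob (A n)" by (rule order_tendstoD) simp
  then obtain n where n: "1 / 2 < prob (A n)" by (auto simp: eventually_sequentially)
  show ?thesis
  proof (rule that[of n])
    fix s :: real assume s: "0 \<le> s" "s \<le> 1"
    have "A n \<subseteq> {w\<in>space M. X s w \<le> real n}"
    \<comment> \<open>Approximation from the right within the unit interval is possible only for
      \<open>s < 1\<close>; the condition at time 1 is a conjunct of \<open>A n\<close>.\<close>
    proof (cases "s = 1")
      case False
      show ?thesis
      proof safe
        fix w assume A: "w \<in> A n"
        then have w: "w \<in> space M" by (simp add: A_def)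
        then show "w \<in> space M" .
        show "X s w \<le> real n"
        proof (rule ccontr)
          assume "\<not> ?thesis"
          then have "X s w \<in> {real n<..}" by simp
          from dyadic_right_approx[OF right_continuous[OF w, of s] s(1) open_greaterThan this, of 1]
          obtain k j :: nat where "j / 2 ^ k < 1" "X (j / 2 ^ k) w > real n" using s False by auto
          moreover have "\<forall>k j::nat. real j / 2 ^ k \<le> 1 \<longrightarrow> X (real j / 2 ^ k) w \<le> real n"
            using A unfolding A_def by blast
          ultimately show False by (meson less_imp_le not_less)
        qed
      qed
    qed (auto simp: A_def)
    then have "prob (A n) \<le> prob {w\<in>space M. X s w \<le> real n}" by (rule finite_measure_mono) measurable
    then show "1 / 2 \<le> prob {w\<in>space M. X s w \<le> real n}" using n by simp
  qed
qed

text \<open>From the first grid point with value below \<open>- c\<close> the next integer time is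
  at most 1 away, and with probability at least \<open>1 / 2\<close> the path rises by at most
  \<open>b\<close> until then. The skeleton is then below \<open>b - c\<close>; the factor 2 is the
  reciprocal of that probability.\<close>

lemma dyadic_inf_tail:
  assumes b: "\<And>s. 0 \<le> s \<Longrightarrow> s \<le> 1 \<Longrightarrow> 1 / 2 \<le> prob {w\<in>space M. X s w \<le> real b}"
  shows "prob {w\<in>space M. \<exists>k j::nat. X (real j / 2 ^ k) w < - c} \<le> 2 * prob {w\<in>space M. \<exists>m::nat. X (real m) w < real b - c}"
proof (rule LIMSEQ_le_const2[OF LIMSEQ_prob_dyadic[of "\<lambda>x. x < - c"]])
  show "Measurable.pred borel (\<lambda>x. x < - c)" by measurable
  show "\<exists>N. \<forall>k\<ge>N. prob {w\<in>space M. \<exists>j::nat. X (real j / 2 ^ k) w < - c} \<le> 2 * prob {w\<in>space M. \<exists>m::nat. X (real m) w < real b - c}"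
  proof (intro exI allI impI)
    fix k :: nat
    define u where "u j = real j / 2 ^ k" for j :: nat
    define m where "m j = nat \<lceil>u j\<rceil>" for j
    have u: "mono u" "0 \<le> u j" for j by (auto simp: mono_def u_def divide_right_mono)
    have m: "u j \<le> real (m j)" "real (m j) - u j \<le> 1" for j
      using u(2)[of j] unfolding m_def by (auto simp: ceiling_correct le_of_int_ceiling) linarith
    let ?S = "\<lambda>j x. x (real (m j) - u j) \<le> real b"
    have Sm: "{x. ?S j x} \<in> sets paths" for j
      by (rule sets_paths_Collect) measurable
    have S: "1 / 2 \<le> prob {w\<in>space M. ?S j (path_from 0 w)}" for j
      using b[of "real (m j) - u j"] m[of j] by (simp add: path_from_0 cong: conj_cong)
    have "1 / 2 * prob {w\<in>space M. \<exists>j. X (u j) w \<in> {..<- c}} \<le>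
        prob {w\<in>space M. \<exists>j. X (u j) w \<in> {..<- c} \<and> (\<forall>i<j. X (u i) w \<notin> {..<- c}) \<and> ?S j (path_from (u j) w)}"
      by (rule first_hit_lower[OF u(1) _ Sm S]) auto
    also have "\<dots> \<le> prob {w\<in>space M. \<exists>m::nat. X (real m) w < real b - c}"
    proof (rule prob_Collect_mono)
      fix w assume "\<exists>j. X (u j) w \<in> {..<- c} \<and> (\<forall>i<j. X (u i) w \<notin> {..<- c}) \<and> ?S j (path_from (u j) w)"
      then obtain j where "X (u j) w < - c" "?S j (path_from (u j) w)" by auto
      then show "\<exists>m::nat. X (real m) w < real b - c" using m[of j] by (auto simp: path_from_def intro!: exI[of _ "m j"])
    qed measurable
    finally show "prob {w\<in>space M. \<exists>j::nat. X (real j / 2 ^ k) w < - c} \<le> 2 * prob {w\<in>space M. \<exists>m::nat. X (real m) w < real b - c}"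
      by (simp add: u_def)
  qed
qed

lemma LIMSEQ_prob_dyadic_inf:
  assumes "integrable M (X 1)" "0 < (\<integral>w. X 1 w \<partial>M)"
  shows "(\<lambda>n. prob {w\<in>space M. \<exists>k j::nat. X (real j / 2 ^ k) w < - real n}) \<longlonglongrightarrow> 0"
proof -
  obtain b :: nat where b: "\<And>s. 0 \<le> s \<Longrightarrow> s \<le> 1 \<Longrightarrow> 1 / 2 \<le> prob {w\<in>space M. X s w \<le> real b}"
    using bounded_above_in_probability by metis
  define G where "G n = {w\<in>space M. \<exists>m::nat. X (real m) w < - real n}" for n :: nat
  have [measurable]: "G n \<in> events" for n unfolding G_def by measurable
  have "decseq G"
  proof (rule decseq_SucI, rule subsetI)
    fix n w assume "w \<in> G (Suc n)"
    then obtain m :: nat where "w \<in> space M" "X (real m) w < - real (Suc n)" by (auto simp: G_def)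
    then show "w \<in> G n" by (auto simp: G_def intro!: exI[of _ m])
  qed
  then have "(\<lambda>n. prob (G n)) \<longlonglongrightarrow> prob (\<Inter>n. G n)"
    by (intro finite_Lim_measure_decseq) auto
  moreover have "(\<Inter>n. G n) = {w\<in>space M. \<forall>k::nat. \<exists>n::nat. X (real n) w < - real k}" by (auto simp: G_def)
  ultimately have "(\<lambda>n. prob (G n)) \<longlonglongrightarrow> 0" using prob_skeleton_unbounded_below[OF assms] by simp
  then have lim: "(\<lambda>n. 2 * prob (G n)) \<longlonglongrightarrow> 0" by (simp add: tendsto_mult_right_zero)
  \<comment> \<open>Lowering the level by \<open>b\<close> compensates for the possible rise up to
    the next integer time.\<close>
  have "(\<lambda>n. prob {w\<in>space M. \<exists>k j::nat. X (real j / 2 ^ k) w < - real (n + b)}) \<longlonglongrightarrow> 0"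
  proof (rule tendsto_sandwich[OF _ _ tendsto_const lim])
    show "\<forall>\<^sub>F n in sequentially. prob {w\<in>space M. \<exists>k j::nat. X (real j / 2 ^ k) w < - real (n + b)} \<le> 2 * prob (G n)"
      using dyadic_inf_tail[OF b, of "real (_ + b)"] by (intro always_eventually) (simp add: G_def)
  qed auto
  then show ?thesis by (rule LIMSEQ_offset)
qed

lemma AE_bounded_below:
  assumes "integrable M (X 1)" "0 < (\<integral>w. X 1 w \<partial>M)"
  shows "AE w in M. \<exists>c. \<forall>k j::nat. c \<le> X (real j / 2 ^ k) w"
proof -
  let ?N = "{w\<in>space M. \<forall>n::nat. \<exists>k j::nat. X (real j / 2 ^ k) w < - real n}"
  have "prob ?N \<le> 0"
  proof (rule LIMSEQ_le_const[OF LIMSEQ_prob_dyadic_inf[OF assms]])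
    show "\<exists>N. \<forall>n\<ge>N. prob ?N \<le> prob {w\<in>space M. \<exists>k j::nat. X (real j / 2 ^ k) w < - real n}"
      by (auto intro!: finite_measure_mono)
  qed
  then have "prob ?N = 0" using measure_nonneg[of M ?N] by simp
  then have "AE w in M. \<not> (\<forall>n::nat. \<exists>k j::nat. X (real j / 2 ^ k) w < - real n)"
    by (subst (asm) prob_eq_0) auto
  then show ?thesis by eventually_elim (auto simp: not_less)
qed

text \<open>If the path almost surely falls below \<open>- \<eta>\<close>, restarting at first hits
  repeats the fall. On the grid of mesh \<open>1 / 2 ^ k\<close> the level
  \<open>- (m + 1) * \<eta>\<close> is passed with probability at least
  \<open>q k ^ (m + 1)\<close>, which tends to 1 as \<open>k\<close> grows. For large
  \<open>m\<close> this contradicts \<open>LIMSEQ_prob_dyadic_inf\<close>.\<close>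

lemma prob_dyadic_ge_pos:
  assumes "integrable M (X 1)" "0 < (\<integral>w. X 1 w \<partial>M)" and \<eta>: "0 < \<eta>"
  shows "0 < prob {w\<in>space M. \<forall>k j::nat. - \<eta> \<le> X (real j / 2 ^ k) w}"
proof (rule ccontr)
  assume "\<not> ?thesis"
  then have 0: "prob {w\<in>space M. \<forall>k j::nat. - \<eta> \<le> X (real j / 2 ^ k) w} = 0"
    using measure_nonneg[of M] by (simp add: not_less antisym)
  define q where "q k = prob {w\<in>space M. \<exists>j::nat. X (real j / 2 ^ k) w < - \<eta>}" for k :: nat
  have "prob {w\<in>space M. \<exists>k j::nat. X (real j / 2 ^ k) w < - \<eta>} = 1 - prob {w\<in>space M. \<forall>k j::nat. - \<eta> \<le> X (real j / 2 ^ k) w}"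
    by (subst prob_neg[symmetric]) (measurable, simp add: not_le)
  then have q1: "q \<longlonglongrightarrow> 1"
    using LIMSEQ_prob_dyadic[of "\<lambda>x. x < - \<eta>"] 0 unfolding q_def by simp
  have iter: "q k ^ Suc m \<le> prob {w\<in>space M. \<exists>j::nat. X (real j / 2 ^ k) w < - (real (Suc m) * \<eta>)}" for k m :: nat
  proof (induction m)
    case (Suc m)
    let ?c = "- (real (Suc m) * \<eta>)" and ?u = "\<lambda>j::nat. real j / 2 ^ k"
    let ?S = "\<lambda>x::real \<Rightarrow> real. \<exists>i::nat. x (real i / 2 ^ k) < - \<eta>"
    have Sm: "{x. ?S x} \<in> sets paths"
      by (rule sets_paths_Collect) measurable
    have "q k * q k ^ Suc m \<le> q k * prob {w\<in>space M. \<exists>j::nat. X (?u j) w \<in> {..<?c}}"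
      using Suc.IH by (intro mult_left_mono) (auto simp: q_def)
    also have "\<dots> \<le> prob {w\<in>space M. \<exists>j. X (?u j) w \<in> {..<?c} \<and> (\<forall>i<j. X (?u i) w \<notin> {..<?c}) \<and> ?S (path_from (?u j) w)}"
      by (rule first_hit_lower[where S = "\<lambda>_. ?S"])
         (use Sm in \<open>auto simp: mono_def divide_right_mono q_def path_from_0 cong: conj_cong\<close>)
    also have "\<dots> \<le> prob {w\<in>space M. \<exists>j::nat. X (?u j) w < - (real (Suc (Suc m)) * \<eta>)}"
    proof (rule prob_Collect_mono)
      fix w assume "\<exists>j. X (?u j) w \<in> {..<?c} \<and> (\<forall>i<j. X (?u i) w \<notin> {..<?c}) \<and> ?S (path_from (?u j) w)"
      then obtain i j where "X (?u j) w < ?c" "path_from (?u j) w (?u i) < - \<eta>" by auto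
      then show "\<exists>j::nat. X (?u j) w < - (real (Suc (Suc m)) * \<eta>)"
        by (auto simp: path_from_def add_divide_distrib algebra_simps intro!: exI[of _ "j + i"])
    qed measurable
    finally show ?case by simp
  qed (simp add: q_def)
  obtain N :: nat where N: "prob {w\<in>space M. \<exists>k j::nat. X (real j / 2 ^ k) w < - real N} < 1 / 2"
    using order_tendstoD(2)[OF LIMSEQ_prob_dyadic_inf[OF assms(1,2)], of "1/2"] by (auto simp: eventually_sequentially)
  obtain m :: nat where m: "real N \<le> real m * \<eta>" using ex_less_of_nat_mult[OF \<eta>, of "real N"] by (auto intro: less_imp_le)
  have "1 ^ Suc m \<le> prob {w\<in>space M. \<exists>k j::nat. X (real j / 2 ^ k) w < - real N}"
  proof (rule LIMSEQ_le_const2[OF tendsto_power[OF q1]], intro exI allI impI)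
    fix k :: nat
    have "real N \<le> real (Suc m) * \<eta>" using m \<eta> by (simp add: algebra_simps)
    then show "q k ^ Suc m \<le> prob {w\<in>space M. \<exists>k j::nat. X (real j / 2 ^ k) w < - real N}"
      by (intro order_trans[OF iter] finite_measure_mono) (auto, smt (verit))
  qed
  with N show False by simp
qed

text \<open>A positive value at time \<open>r\<close> leaves room \<open>1 / (n + 1)\<close> for
  some \<open>n\<close> with positive probability. The independent path after \<open>r\<close> uses
  up no more than this room with positive probability, by \<open>prob_dyadic_ge_pos\<close>.\<close>

lemma prob_nonneg_pos:
  assumes "integrable M (X 1)" "0 < (\<integral>w. X 1 w \<partial>M)" and r: "0 \<le> r"
    and start: "0 < prob {w\<in>space M. (\<forall>k j::nat. real j / 2 ^ k \<le> r \<longrightarrow> 0 \<le> X (real j / 2 ^ k) w) \<and> 0 < X r w}"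
  shows "0 < prob {w\<in>space M. \<forall>k j::nat. 0 \<le> X (real j / 2 ^ k) w}"
proof -
  define A where "A n = {w\<in>space M. (\<forall>k j::nat. real j / 2 ^ k \<le> r \<longrightarrow> 0 \<le> X (real j / 2 ^ k) w) \<and> inverse (real (Suc n)) \<le> X r w}" for n
  have A: "A n \<in> sets (past r)" for n
  proof -
    have [measurable]: "X (min s r) \<in> borel_measurable (past r)" for s by (rule measurable_past) simp
    have "A n = {w\<in>space (past r). (\<forall>k j::nat. real j / 2 ^ k \<le> r \<longrightarrow> 0 \<le> X (min (real j / 2 ^ k) r) w) \<and> inverse (real (Suc n)) \<le> X (min r r) w}"
      by (auto simp: A_def)
    also have "\<dots> \<in> sets (past r)" by measurable
    finally show ?thesis .
  qed
  have "\<exists>n. prob (A n) \<noteq> 0"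
  proof (rule ccontr)
    assume "\<nexists>n. prob (A n) \<noteq> 0"
    then have "prob (\<Union>n. A n) = 0"
      using past_events[OF A] by (subst measure_eq_0_null_sets, intro null_sets_UN) (auto simp: null_sets_def emeasure_eq_measure)
    moreover have "(\<Union>n. A n) = {w\<in>space M. (\<forall>k j::nat. real j / 2 ^ k \<le> r \<longrightarrow> 0 \<le> X (real j / 2 ^ k) w) \<and> 0 < X r w}"
    proof (rule set_eqI)
      fix w
      have "(\<exists>n. inverse (real (Suc n)) \<le> X r w) \<longleftrightarrow> 0 < X r w"
      proof
        assume "\<exists>n. inverse (real (Suc n)) \<le> X r w"
        then obtain n where "inverse (real (Suc n)) \<le> X r w" ..
        moreover have "0 < inverse (real (Suc n))" by simp
        ultimately show "0 < X r w" by linarith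
      next
        assume "0 < X r w"
        from reals_Archimedean[OF this] show "\<exists>n. inverse (real (Suc n)) \<le> X r w" by (blast intro: less_imp_le)
      qed
      then show "w \<in> (\<Union>n. A n) \<longleftrightarrow> w \<in> {w\<in>space M. (\<forall>k j::nat. real j / 2 ^ k \<le> r \<longrightarrow> 0 \<le> X (real j / 2 ^ k) w) \<and> 0 < X r w}"
        unfolding A_def by blast
    qed
    ultimately show False using start by simp
  qed
  then obtain n where n: "0 < prob (A n)" unfolding zero_less_measure_iff ..
  let ?\<eta> = "inverse (real (Suc n))"
  let ?S = "\<lambda>x::real \<Rightarrow> real. \<forall>k j::nat. - ?\<eta> \<le> x (real j / 2 ^ k)"
  have Sm: "{x. ?S x} \<in> sets paths"
    by (rule sets_paths_Collect) measurable
  have "0 < prob (A n) * prob {w\<in>space M. ?S (path_from 0 w)}"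
    using n prob_dyadic_ge_pos[OF assms(1,2), of ?\<eta>] by (simp add: path_from_0 cong: conj_cong)
  also have "\<dots> = prob {w\<in>A n. ?S (path_from r w)}" by (rule markov[OF A Sm, symmetric])
  also have "\<dots> \<le> prob {w\<in>space M. \<forall>k j::nat. 0 \<le> X (real j / 2 ^ k) w}"
  proof (rule finite_measure_mono)
    show "{w\<in>A n. ?S (path_from r w)} \<subseteq> {w\<in>space M. \<forall>k j::nat. 0 \<le> X (real j / 2 ^ k) w}"
    proof safe
      fix w and k j :: nat assume w_A: "w \<in> A n" and S: "?S (path_from r w)"
      then show w: "w \<in> space M" by (simp add: A_def)
      let ?t = "real j / 2 ^ k"
      show "0 \<le> X ?t w"
      proof (cases "?t \<le> r")
        case True
        then show ?thesis using w_A by (auto simp: A_def)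
      next
        case False
        then have "X r w + - ?\<eta> \<le> X ?t w"
          using path_from_dyadic_ge_iff[OF w, of "- ?\<eta>" r] S by (meson not_le less_imp_le)
        moreover have "?\<eta> \<le> X r w" using w_A by (simp add: A_def)
        ultimately show ?thesis by linarith
      qed
    qed
  qed measurable
  finally show ?thesis .
qed

text \<open>The negation of \<open>zero_regular_for\<close> says only that the infimum fails to be
  almost surely 0. If for every \<open>n\<close> positivity at the dyadic points of
  \<open>(0, 1 / 2 ^ n]\<close> had probability 0, there would almost surely be hits at arbitrarily
  small times. So some \<open>n\<close> serves, and \<open>prob_nonneg_pos\<close> continues from
  \<open>1 / 2 ^ n\<close>.\<close>

lemma not_regular_prob_nonneg_pos:
  assumes "integrable M (X 1)" "0 < (\<integral>w. X 1 w \<partial>M)" and "\<not> zero_regular_for M X {..0}"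
  shows "0 < prob {w\<in>space M. \<forall>k j::nat. 0 \<le> X (real j / 2 ^ k) w}"
proof -
  let ?A = "\<lambda>n::nat. {w\<in>space M. \<forall>k j::nat. 0 < j \<and> real j / 2 ^ k \<le> 1 / 2 ^ n \<longrightarrow> 0 < X (real j / 2 ^ k) w}"
  have "\<exists>n. prob (?A n) \<noteq> 0"
  proof (rule ccontr)
    assume "\<nexists>n. prob (?A n) \<noteq> 0"
    then have "AE w in M. \<not> (\<forall>k j::nat. 0 < j \<and> real j / 2 ^ k \<le> 1 / 2 ^ n \<longrightarrow> 0 < X (real j / 2 ^ k) w)" for n :: nat
      using prob_eq_0[of "?A n"] by auto
    then have "AE w in M. \<forall>n. \<not> (\<forall>k j::nat. 0 < j \<and> real j / 2 ^ k \<le> 1 / 2 ^ n \<longrightarrow> 0 < X (real j / 2 ^ k) w)"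
      by (simp add: AE_all_countable)
    then have "AE w in M. Inf (ereal ` {t. t > 0 \<and> X t w \<in> {..0}}) = 0"
    proof eventually_elim
      case (elim w)
      show ?case
      proof (subst Inf_ereal_eq_0_iff, force, intro allI)
        fix n :: nat
        from elim[THEN spec, of n] have "\<exists>k j::nat. (0 < j \<and> real j / 2 ^ k \<le> 1 / 2 ^ n) \<and> \<not> 0 < X (real j / 2 ^ k) w"
          by (simp only: not_all not_imp simp_thms)
        then obtain k j :: nat where "0 < j" "real j / 2 ^ k \<le> 1 / 2 ^ n" "\<not> 0 < X (real j / 2 ^ k) w"
          by (elim exE conjE)
        then show "\<exists>t\<in>{t. 0 < t \<and> X t w \<in> {..0}}. t \<le> 1 / 2 ^ n" by (intro bexI[of _ "real j / 2 ^ k"]) (auto simp: not_less)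
      qed
    qed
    then show False using assms(3) by (simp add: zero_regular_for_def)
  qed
  then obtain n where n: "0 < prob (?A n)" unfolding zero_less_measure_iff ..
  have "?A n \<subseteq> {w\<in>space M. (\<forall>k j::nat. real j / 2 ^ k \<le> 1 / 2 ^ n \<longrightarrow> 0 \<le> X (real j / 2 ^ k) w) \<and> 0 < X (1 / 2 ^ n) w}"
  proof safe
    fix w and k j :: nat
    assume w: "w \<in> space M" and *: "\<forall>k j::nat. 0 < j \<and> real j / 2 ^ k \<le> 1 / 2 ^ n \<longrightarrow> 0 < X (real j / 2 ^ k) w"
    show "0 < X (1 / 2 ^ n) w" using *[rule_format, of 1 n] by simp
    show "0 \<le> X (real j / 2 ^ k) w" if "real j / 2 ^ k \<le> 1 / 2 ^ n"
      using *[rule_format, of j k] that start_at_zero[OF w] by (cases "j = 0") auto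
  qed
  then have "0 < prob {w\<in>space M. (\<forall>k j::nat. real j / 2 ^ k \<le> 1 / 2 ^ n \<longrightarrow> 0 \<le> X (real j / 2 ^ k) w) \<and> 0 < X (1 / 2 ^ n) w}"
    by (intro less_le_trans[OF n] finite_measure_mono) measurable
  then show ?thesis by (intro prob_nonneg_pos[OF assms(1,2), of "1 / 2 ^ n"]) auto
qed

end

section \<open>Atoms at zero and regularity\<close>

lemma emeasure_lborel_shift:
  fixes A :: "real set"
  assumes [measurable]: "A \<in> sets borel"
  shows "emeasure lborel {t. t + h \<in> A} = emeasure lborel A"
proof -
  have "emeasure lborel A = emeasure (distr lborel borel ((+) h)) A" by (simp only: lborel_distr_plus)
  also have "\<dots> = emeasure lborel {t. t + h \<in> A}" by (subst emeasure_distr) (auto simp: vimage_def add.commute)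
  finally show ?thesis ..
qed

text \<open>Squeeze a compact \<open>T\<close> inside \<open>L\<close> and an open \<open>U\<close>
  around \<open>T\<close>, each up to mass \<open>e\<close>. Below the distance from
  \<open>T\<close> to the complement of \<open>U\<close>, a translate of a point of \<open>T\<close>
  stays in \<open>U\<close>, so it can leave \<open>L\<close> only into \<open>U - T\<close>. The
  loss is thus at most the mass of \<open>L - T\<close> plus that of \<open>U - T\<close>.\<close>

lemma emeasure_translate_inter:
  fixes L :: "real set" and e :: real
  assumes L [measurable]: "L \<in> sets borel" and "bounded L" "0 < e"
  obtains \<delta> where "0 < \<delta>"
    "\<And>h. 0 < h \<Longrightarrow> h < \<delta> \<Longrightarrow> emeasure lborel L \<le> emeasure lborel (L \<inter> {t. t + h \<in> L}) + 2 * ennreal e"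
proof -
  obtain T where T: "closed T" "T \<subseteq> L" "emeasure lebesgue (L - T) < ennreal e"
    using sets_lebesgue_inner_closed[of L e] L \<open>0 < e\<close> by (metis sets_completionI_sets sets_lborel)
  have [measurable]: "T \<in> sets borel" using T by simp
  have LT: "emeasure lborel (L - T) \<le> ennreal e" using T(3) by (simp add: less_imp_le)
  have "compact T" using T \<open>bounded L\<close> bounded_subset compact_eq_bounded_closed by blast
  obtain U where U: "open U" "T \<subseteq> U" "emeasure lborel (U - T) < ennreal e"
    using outer_regular_lborel[of T e] \<open>0 < e\<close> by auto
  have [measurable]: "U \<in> sets borel" using U by simp
  obtain d where d: "d > 0" "\<forall>x\<in>T. \<forall>y\<in>- U. d \<le> dist x y"
    using separate_compact_closed[of T "- U"] \<open>compact T\<close> U by (auto simp: closed_Compl)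
  show ?thesis
  proof (rule that[OF d(1)])
    fix h assume h: "0 < h" "h < d"
    have "L \<subseteq> (L \<inter> {t. t + h \<in> L}) \<union> ((L - T) \<union> {t. t + h \<in> U - T})"
    proof
      fix t assume t: "t \<in> L"
      show "t \<in> (L \<inter> {t. t + h \<in> L}) \<union> ((L - T) \<union> {t. t + h \<in> U - T})"
      proof (cases "t \<in> T")
        case True
        have "t + h \<in> U"
        proof (rule ccontr)
          assume "t + h \<notin> U"
          then have "d \<le> dist t (t + h)" using d(2) True by blast
          then show False using h by (simp add: dist_real_def)
        qed
        then show ?thesis using t T(2) by blast
      qed (use t in blast)
    qed
    then have "emeasure lborel L \<le> emeasure lborel ((L \<inter> {t. t + h \<in> L}) \<union> ((L - T) \<union> {t. t + h \<in> U - T}))"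
      by (rule emeasure_mono) measurable
    also have "\<dots> \<le> emeasure lborel (L \<inter> {t. t + h \<in> L}) + (emeasure lborel (L - T) + emeasure lborel {t. t + h \<in> U - T})"
      by (intro order_trans[OF emeasure_subadditive] add_left_mono emeasure_subadditive) measurable
    also have "emeasure lborel {t. t + h \<in> U - T} = emeasure lborel (U - T)"
      by (rule emeasure_lborel_shift) measurable
    also have "emeasure lborel (L - T) + emeasure lborel (U - T) \<le> ennreal e + ennreal e"
      using LT U(3) by (intro add_mono) auto
    finally show "emeasure lborel L \<le> emeasure lborel (L \<inter> {t. t + h \<in> L}) + 2 * ennreal e"
      by (simp add: mult_2 add_left_mono)
  qed
qed

text \<open>The form in which translation continuity meets Fatou's lemma in
  \<open>zero_prob_near_1\<close>.\<close>

lemma emeasure_translate_liminf: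
  fixes L :: "real set" and h :: "nat \<Rightarrow> real"
  assumes L: "L \<in> sets borel" "bounded L" and h: "\<And>n. 0 < h n" "h \<longlonglongrightarrow> 0"
  shows "emeasure lborel L \<le> liminf (\<lambda>n. emeasure lborel (L \<inter> {t. t + h n \<in> L}))"
proof (rule ennreal_le_epsilon)
  fix e :: real assume "0 < e"
  then have "0 < e / 2" by simp
  from emeasure_translate_inter[OF L this] obtain \<delta> where \<delta>: "0 < \<delta>"
    "\<And>h. 0 < h \<Longrightarrow> h < \<delta> \<Longrightarrow> emeasure lborel L \<le> emeasure lborel (L \<inter> {t. t + h \<in> L}) + 2 * ennreal (e / 2)"
    by blast
  have e2: "2 * ennreal (e / 2) = ennreal e"
    using \<open>0 < e\<close> by (simp add: ennreal_mult[symmetric] flip: ennreal_numeral)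
  have "\<forall>\<^sub>F n in sequentially. h n < \<delta>" using h(2) \<delta>(1) by (rule order_tendstoD)
  then have "\<forall>\<^sub>F n in sequentially. emeasure lborel L - ennreal e \<le> emeasure lborel (L \<inter> {t. t + h n \<in> L})"
  proof eventually_elim
    case (elim n)
    then show ?case using \<delta>(2)[OF h(1) elim] e2 by (simp add: ennreal_minus_le_iff add.commute)
  qed
  then have "emeasure lborel L - ennreal e \<le> liminf (\<lambda>n. emeasure lborel (L \<inter> {t. t + h n \<in> L}))"
    by (rule Liminf_bounded)
  then show "emeasure lborel L \<le> liminf (\<lambda>n. emeasure lborel (L \<inter> {t. t + h n \<in> L})) + ennreal e"
    by (simp add: ennreal_minus_le_iff add.commute)
qed

section \<open>The set of zeros of the process\<close>

context two_sided_levy_process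
begin

text \<open>The times \<open>r i t\<close> lie strictly to the right of \<open>t\<close>, within
  \<open>1 / (i + 1)\<close>, and take countably many values. Each approximation is therefore
  jointly measurable, and right continuity gives the limit.\<close>

lemma measurable_X_pair [measurable]: "(\<lambda>(t, w). X t w) \<in> borel_measurable (borel \<Otimes>\<^sub>M M)"
proof (rule borel_measurable_LIMSEQ_real)
  define r where "r i t = real_of_int (\<lfloor>t * real (Suc i)\<rfloor> + 1) / real (Suc i)" for i and t :: real
  show "(\<lambda>i. X (r i (fst x)) (snd x)) \<longlonglongrightarrow> (case x of (t, w) \<Rightarrow> X t w)" if "x \<in> space (borel \<Otimes>\<^sub>M M)" for x
  proof -
    obtain t w where x: "x = (t, w)" by (cases x)
    have w: "w \<in> space M" using that by (simp add: x space_pair_measure)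
    have b: "t < r i t" "r i t \<le> t + 1 / real (Suc i)" for i
    proof -
      have "t * real (Suc i) < real_of_int (\<lfloor>t * real (Suc i)\<rfloor> + 1)" "real_of_int (\<lfloor>t * real (Suc i)\<rfloor> + 1) \<le> t * real (Suc i) + 1"
        by linarith+
      then show "t < r i t" "r i t \<le> t + 1 / real (Suc i)"
        by (simp_all add: r_def field_simps del: of_nat_Suc)
    qed
    have "(\<lambda>i. t + 1 / real (Suc i)) \<longlonglongrightarrow> t + 0"
      by (intro tendsto_intros LIMSEQ_Suc lim_1_over_n)
    then have "(\<lambda>i. r i t) \<longlonglongrightarrow> t"
      using tendsto_sandwich[OF always_eventually always_eventually tendsto_const, of t "\<lambda>i. r i t" "\<lambda>i. t + 1 / real (Suc i)" sequentially] b
      by (simp del: of_nat_Suc add: less_imp_le)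
    then have "filterlim (\<lambda>i. r i t) (at_right t) sequentially"
      unfolding filterlim_at using b by (auto simp: less_imp_neq[symmetric])
    moreover have "((\<lambda>s. X s w) \<longlongrightarrow> X t w) (at_right t)"
      using right_continuous[OF w, of t] by (simp add: continuous_within)
    ultimately show ?thesis by (auto simp: x intro: filterlim_compose)
  qed
  show "(\<lambda>x. X (r i (fst x)) (snd x)) \<in> borel_measurable (borel \<Otimes>\<^sub>M M)" for i
  proof -
    have [measurable]: "(\<lambda>x. \<lfloor>fst x * real (Suc i)\<rfloor>) \<in> measurable (borel \<Otimes>\<^sub>M M) (count_space UNIV)" by measurable
    show ?thesis unfolding r_def
      by (rule measurable_compose_countable[where f = "\<lambda>k x. X (real_of_int (k + 1) / real (Suc i)) (snd x)" and g = "\<lambda>x. \<lfloor>fst x * real (Suc i)\<rfloor>"]) measurable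
  qed
qed

lemma measurable_X_compose [measurable (raw)]:
  "f \<in> borel_measurable N \<Longrightarrow> g \<in> measurable N M \<Longrightarrow> (\<lambda>x. X (f x) (g x)) \<in> borel_measurable N"
  using measurable_compose[OF measurable_Pair[of f N borel g M] measurable_X_pair] by simp

abbreviation zero_prob :: "real \<Rightarrow> real" where
  "zero_prob t \<equiv> prob {w\<in>space M. X t w = 0}"

lemma prob_zero_zero:
  assumes "0 < s" "0 < t"
  shows "prob {w\<in>space M. X s w = 0 \<and> X (s + t) w = 0} = zero_prob s * zero_prob t"
proof -
  have [measurable]: "X s \<in> borel_measurable (past s)" by (rule measurable_past) simp
  have "{w\<in>space (past s). X s w = 0} \<in> sets (past s)" by measurable
  from increment_indep[OF _ this, of "s + t" "{0}"] assms
  have "prob {w\<in>{w\<in>space M. X s w = 0}. X (s + t) w - X s w \<in> {0}} = zero_prob s * zero_prob t" by simp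
  also have "{w\<in>{w\<in>space M. X s w = 0}. X (s + t) w - X s w \<in> {0}} = {w\<in>space M. X s w = 0 \<and> X (s + t) w = 0}"
    by auto
  finally show ?thesis .
qed

lemma zero_prob_mult: "0 < s \<Longrightarrow> 0 < t \<Longrightarrow> zero_prob s * zero_prob t \<le> zero_prob (s + t)"
  unfolding prob_zero_zero[symmetric] by (intro finite_measure_mono) auto

lemma zero_prob_multiple_pos:
  assumes "0 < t" "0 < zero_prob t"
  shows "0 < zero_prob (real (Suc n) * t)"
proof (induction n)
  case (Suc n)
  have "0 < zero_prob (real (Suc n) * t) * zero_prob t" using Suc assms by simp
  also have "\<dots> \<le> zero_prob (real (Suc n) * t + t)" using assms by (intro zero_prob_mult) auto
  also have "real (Suc n) * t + t = real (Suc (Suc n)) * t" by (simp add: algebra_simps)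
  finally show ?case .
qed (use assms in simp)

text \<open>Take \<open>\<delta> = t / (K * N!)\<close> with \<open>zero_prob t = 0\<close>. Every
  \<open>i\<close> up to \<open>N\<close> divides \<open>N!\<close>, so \<open>t\<close> is a
  multiple of \<open>i * \<delta>\<close>; an atom at time \<open>i * \<delta>\<close> would produce
  one at time \<open>t\<close>. The factor \<open>K\<close> only makes \<delta> smaller than
  \<epsilon>.\<close>

lemma zero_prob_pos_or_avoids:
  assumes "\<exists>t>0. zero_prob t = 0" "0 < \<epsilon>"
  shows "\<exists>\<delta>>0. \<delta> < \<epsilon> \<and> (\<forall>i\<in>{1..N::nat}. zero_prob (real i * \<delta>) = 0)"
proof (rule ccontr)
  assume neg: "\<not> ?thesis"
  obtain t where t: "0 < t" "zero_prob t = 0" using assms by blast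
  obtain K :: nat where K: "t / \<epsilon> < real K" using reals_Archimedean2 by blast
  have "0 < t / \<epsilon>" using t assms(2) by simp
  then have K0: "0 < real K" using K by linarith
  define \<delta> where "\<delta> = t / (real K * fact N)"
  have "\<delta> \<le> t / real K" using t K0 by (auto simp: \<delta>_def fact_ge_1 field_simps)
  also have "t / real K < \<epsilon>" using K K0 assms(2) by (simp add: field_simps)
  finally have "\<delta> < \<epsilon>" .
  moreover have "0 < \<delta>" using t K0 by (simp add: \<delta>_def)
  ultimately obtain i where i: "i \<in> {1..N}" "0 < zero_prob (real i * \<delta>)"
    using neg by (auto simp: zero_less_measure_iff)
  have "i dvd fact N" using i by (intro dvd_fact) auto
  then obtain m where m: "fact N = i * m" by (auto elim: dvdE)
  then have fm: "(fact N :: real) = real i * real m" by (metis of_nat_fact of_nat_mult)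
  have "(fact N :: real) > 0" by simp
  then have m0: "0 < m" unfolding fm by (auto intro: gr0I)
  have "real K * real m * (real i * \<delta>) = t"
    using K0 i m0 by (simp add: \<delta>_def fm)
  moreover have "0 < K * m" using K0 m0 by simp
  then obtain n where n: "K * m = Suc n" using gr0_implies_Suc by blast
  then have "real K * real m = real (Suc n)" by (metis of_nat_mult)
  ultimately have "0 < zero_prob t"
    using zero_prob_multiple_pos[OF _ i(2), of n] \<open>0 < \<delta>\<close> i(1) by simp
  with t show False by simp
qed

text \<open>If zeros are charged at all times, then the zero set has positive Lebesgue measure on average,
  and almost all of its points are density points.\<close>

lemma zero_prob_near_1:
  assumes pos: "\<And>t. 0 < t \<Longrightarrow> 0 < zero_prob t" and "r < 1" "0 < \<epsilon>"
  shows "\<exists>h>0. h < \<epsilon> \<and> r < zero_prob h"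
proof (rule ccontr)
  assume neg: "\<not> ?thesis"
  define h where "h n = \<epsilon> / 2 * inverse (real (Suc n))" for n :: nat
  have h: "0 < h n" "h n < \<epsilon>" for n using \<open>0 < \<epsilon>\<close> by (auto simp: h_def field_simps add_pos_nonneg)
  have h0: "h \<longlonglongrightarrow> 0" unfolding h_def[abs_def] by (rule tendsto_mult_right_zero[OF LIMSEQ_inverse_real_of_nat])
  have r: "zero_prob (h n) \<le> r" for n using neg h by (meson not_le)
  have "0 \<le> r" using order_trans[OF measure_nonneg r] .
  define L where "L w = {t\<in>{0<..<1}. X t w = 0}" for w
  have L [measurable]: "L w \<in> sets borel" if "w \<in> space M" for w
  proof -
    have [measurable]: "(\<lambda>t. X t w) \<in> borel_measurable borel" using that by measurable
    show ?thesis unfolding L_def by measurable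
  qed
  have meas: "{x\<in>space (M \<Otimes>\<^sub>M lborel). snd x \<in> {0<..<1} \<and> X (snd x) (fst x) = 0 \<and> snd x + h n \<in> {0<..<1} \<and> X (snd x + h n) (fst x) = 0} \<in> sets (M \<Otimes>\<^sub>M lborel)" for n
    by measurable
  interpret pair_sigma_finite M lborel ..
  \<comment> \<open>The expected Lebesgue measure of the zero set in the unit interval. By Fubini it
    is the integral of \<open>zero_prob\<close>, hence positive, and it is at most 1.\<close>
  define c where "c = (\<integral>\<^sup>+w. emeasure lborel (L w) \<partial>M)"
  have c: "c = (\<integral>\<^sup>+t. indicator {0<..<1} t * ennreal (zero_prob t) \<partial>lborel)"
  proof -
    have "c = (\<integral>\<^sup>+w. \<integral>\<^sup>+t. indicator {0<..<1} t * indicator {0} (X t w) \<partial>lborel \<partial>M)"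
      unfolding c_def
    proof (rule nn_integral_cong)
      fix w assume w: "w \<in> space M"
      have "emeasure lborel (L w) = (\<integral>\<^sup>+t. indicator (L w) t \<partial>lborel)" using L[OF w] by simp
      also have "\<dots> = (\<integral>\<^sup>+t. indicator {0<..<1} t * indicator {0} (X t w) \<partial>lborel)"
        by (intro nn_integral_cong) (auto simp: L_def indicator_def)
      finally show "emeasure lborel (L w) = \<dots>" .
    qed
    also have "\<dots> = (\<integral>\<^sup>+t. \<integral>\<^sup>+w. indicator {0<..<1} t * indicator {0} (X t w) \<partial>M \<partial>lborel)"
      by (rule Fubini'[symmetric]) measurable
    also have "\<dots> = (\<integral>\<^sup>+t. indicator {0<..<1} t * ennreal (zero_prob t) \<partial>lborel)"
    proof (intro nn_integral_cong)
      fix t :: real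
      have "(\<integral>\<^sup>+w. indicator {0<..<1} t * indicator {0} (X t w) \<partial>M) = indicator {0<..<1} t * (\<integral>\<^sup>+w. indicator {0} (X t w) \<partial>M)"
        by (rule nn_integral_cmult) measurable
      also have "(\<integral>\<^sup>+w. indicator {0} (X t w) \<partial>M) = (\<integral>\<^sup>+w. indicator {w\<in>space M. X t w = 0} w \<partial>M)"
        by (intro nn_integral_cong) (auto simp: indicator_def)
      finally show "(\<integral>\<^sup>+w. indicator {0<..<1} t * indicator {0} (X t w) \<partial>M) = indicator {0<..<1} t * ennreal (zero_prob t)"
        by (simp add: emeasure_eq_measure)
    qed
    finally show ?thesis .
  qed
  have "c \<le> (\<integral>\<^sup>+w. 1 \<partial>M)"
    unfolding c_def
  proof (rule nn_integral_mono)
    fix w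
    have "emeasure lborel (L w) \<le> emeasure lborel {0<..<1::real}" by (rule emeasure_mono) (auto simp: L_def)
    then show "emeasure lborel (L w) \<le> 1" by simp
  qed
  then have c_fin: "c < \<infinity>" using emeasure_space_1 by (auto simp: top.not_eq_extremum intro: le_less_trans)
  have zm [measurable]: "(\<lambda>t. ennreal (zero_prob t)) \<in> borel_measurable borel"
  proof -
    have "(\<lambda>t. \<integral>\<^sup>+w. indicator {0} (X t w) \<partial>M) \<in> borel_measurable borel" by measurable
    moreover have "(\<integral>\<^sup>+w. indicator {0} (X t w) \<partial>M) = ennreal (zero_prob t)" for t
    proof -
      have "(\<integral>\<^sup>+w. indicator {0} (X t w) \<partial>M) = (\<integral>\<^sup>+w. indicator {w\<in>space M. X t w = 0} w \<partial>M)"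
        by (intro nn_integral_cong) (auto simp: indicator_def)
      then show ?thesis by (simp add: emeasure_eq_measure)
    qed
    ultimately show ?thesis by simp
  qed
  have c_pos: "0 < c"
  proof (rule ccontr)
    assume "\<not> 0 < c"
    then have "AE t in lborel. indicator {0<..<1} t * ennreal (zero_prob t) = 0"
      unfolding c by (subst (asm) not_gr_zero, subst (asm) nn_integral_0_iff_AE) auto
    then have "AE t in lborel. t \<notin> {0<..<1::real}"
    proof eventually_elim
      case (elim t)
      then show ?case using pos[of t] by (auto simp: indicator_def split: if_splits)
    qed
    then have "emeasure lborel {0<..<1::real} = 0"
      by (subst (asm) AE_iff_measurable[of "{0<..<1}"]) auto
    then show False by simp
  qed
  \<comment> \<open>Zeros at \<open>t\<close> and at \<open>t + h n\<close> mean two independent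
    zero increments, which costs a factor \<open>zero_prob (h n)\<close>, at most
    \<open>r\<close>.\<close>
  have step: "(\<integral>\<^sup>+w. emeasure lborel (L w \<inter> {t. t + h n \<in> L w}) \<partial>M) \<le> ennreal r * c" for n
  proof -
    have "(\<integral>\<^sup>+w. emeasure lborel (L w \<inter> {t. t + h n \<in> L w}) \<partial>M) \<le>
      (\<integral>\<^sup>+w. \<integral>\<^sup>+t. indicator {0<..<1} t * indicator {(0, 0)} (X t w, X (t + h n) w) \<partial>lborel \<partial>M)"
    proof (rule nn_integral_mono)
      fix w assume w: "w \<in> space M"
      have [measurable]: "L w \<in> sets borel" by (rule L[OF w])
      have "emeasure lborel (L w \<inter> {t. t + h n \<in> L w}) = (\<integral>\<^sup>+t. indicator (L w \<inter> {t. t + h n \<in> L w}) t \<partial>lborel)"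
        by (subst nn_integral_indicator) auto
      also have "\<dots> \<le> (\<integral>\<^sup>+t. indicator {0<..<1} t * indicator {(0, 0)} (X t w, X (t + h n) w) \<partial>lborel)"
        by (intro nn_integral_mono) (auto simp: L_def indicator_def)
      finally show "emeasure lborel (L w \<inter> {t. t + h n \<in> L w}) \<le> \<dots>" .
    qed
    also have "\<dots> = (\<integral>\<^sup>+t. \<integral>\<^sup>+w. indicator {0<..<1} t * indicator {(0, 0)} (X t w, X (t + h n) w) \<partial>M \<partial>lborel)"
      by (rule Fubini'[symmetric]) measurable
    also have "\<dots> \<le> (\<integral>\<^sup>+t. ennreal r * (indicator {0<..<1} t * ennreal (zero_prob t)) \<partial>lborel)"
    proof (intro nn_integral_mono)
      fix t :: real
      show "(\<integral>\<^sup>+w. indicator {0<..<1} t * indicator {(0, 0)} (X t w, X (t + h n) w) \<partial>M) \<le> ennreal r * (indicator {0<..<1} t * ennreal (zero_prob t))"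
      proof (cases "t \<in> {0<..<1}")
        case True
        have "(\<integral>\<^sup>+w. indicator {0<..<1} t * indicator {(0, 0)} (X t w, X (t + h n) w) \<partial>M)
           = (\<integral>\<^sup>+w. indicator {w\<in>space M. X t w = 0 \<and> X (t + h n) w = 0} w \<partial>M)"
          using True by (intro nn_integral_cong) (auto simp: indicator_def)
        also have "\<dots> = ennreal (zero_prob t * zero_prob (h n))"
          using True h(1)[of n] prob_zero_zero[of t "h n"] by (simp add: emeasure_eq_measure)
        also have "\<dots> \<le> ennreal (r * zero_prob t)"
          using mult_right_mono[OF r[of n], of "zero_prob t"] by (intro ennreal_leI) (simp add: mult.commute)
        finally show ?thesis using True \<open>0 \<le> r\<close> by (simp add: ennreal_mult)
      qed simp
    qed
    also have "\<dots> = ennreal r * c" unfolding c by (rule nn_integral_cmult) measurable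
    finally show ?thesis .
  qed
  have em: "(\<lambda>w. emeasure lborel (L w \<inter> {t. t + h n \<in> L w})) \<in> borel_measurable M" for n
  proof -
    have "(\<lambda>w. emeasure lborel (Pair w -` {x\<in>space (M \<Otimes>\<^sub>M lborel). snd x \<in> {0<..<1} \<and> X (snd x) (fst x) = 0 \<and> snd x + h n \<in> {0<..<1} \<and> X (snd x + h n) (fst x) = 0})) \<in> borel_measurable M"
      by (rule lborel.measurable_emeasure_Pair[OF meas])
    moreover have "Pair w -` {x\<in>space (M \<Otimes>\<^sub>M lborel). snd x \<in> {0<..<1} \<and> X (snd x) (fst x) = 0 \<and> snd x + h n \<in> {0<..<1} \<and> X (snd x + h n) (fst x) = 0}
        = L w \<inter> {t. t + h n \<in> L w}" if "w \<in> space M" for w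
      using that by (auto simp: L_def space_pair_measure)
    ultimately show ?thesis by (simp only: cong: measurable_cong)
  qed
  \<comment> \<open>Translation continuity and Fatou's lemma give \<open>c \<le> r * c\<close>,
    which is impossible for a positive finite \<open>c\<close> and \<open>r < 1\<close>.\<close>
  have "c \<le> (\<integral>\<^sup>+w. liminf (\<lambda>n. emeasure lborel (L w \<inter> {t. t + h n \<in> L w})) \<partial>M)"
    unfolding c_def
  proof (rule nn_integral_mono)
    fix w assume "w \<in> space M"
    then show "emeasure lborel (L w) \<le> liminf (\<lambda>n. emeasure lborel (L w \<inter> {t. t + h n \<in> L w}))"
      by (intro emeasure_translate_liminf L h h0 bounded_subset[OF bounded_closed_interval[of 0 1]]) (auto simp: L_def)
  qed
  also have "\<dots> \<le> liminf (\<lambda>n. \<integral>\<^sup>+w. emeasure lborel (L w \<inter> {t. t + h n \<in> L w}) \<partial>M)"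
    by (rule nn_integral_liminf) (rule em)
  also have "\<dots> \<le> ennreal r * c"
    by (rule Liminf_le) (use step in auto)
  finally have le: "c \<le> ennreal r * c" .
  obtain c' where c': "c = ennreal c'" "0 < c'" using c_fin c_pos by (cases c) auto
  have "c' \<le> r * c'" using le c' \<open>0 \<le> r\<close> by (simp add: ennreal_mult[symmetric])
  with c' \<open>r < 1\<close> show False by simp
qed

text \<open>Let \<open>H\<close> be the set of times \<open>t\<close> such that \<open>X\<close> stays above \<open>X t\<close> after \<open>t\<close>, but comes arbitrarily close to it
  after \<open>t + 1 / 2 ^ n\<close>. Then \<open>X\<close> takes the same value at any two points of \<open>H\<close> with distance less than \<open>1 / 2 ^ n\<close>.\<close>

lemma regular_prob_nonneg_0:
  assumes reg: "zero_regular_for M X {..0}"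
    and avoid: "\<And>(N::nat) \<epsilon>. 0 < \<epsilon> \<Longrightarrow> \<exists>\<delta>>0. \<delta> < \<epsilon> \<and> (\<forall>i\<in>{1..N}. zero_prob (real i * \<delta>) = 0)"
  shows "prob {w\<in>space M. \<forall>k j::nat. 0 \<le> X (real j / 2 ^ k) w} = 0"
proof -
  \<comment> \<open>\<open>x\<close> stands for the path measured from its present value; the second
    clause says that its infimum from time \<open>1 / 2 ^ n\<close> on is at most 0.\<close>
  define S where "S n x \<longleftrightarrow> (\<forall>k j::nat. 0 \<le> x (real j / 2 ^ k)) \<and>
    (\<forall>m::nat. \<exists>k j::nat. 1 / 2 ^ n \<le> real j / 2 ^ k \<and> x (real j / 2 ^ k) < inverse (real (Suc m)))" for n :: nat and x :: "real \<Rightarrow> real"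
  have Sm: "{x. S n x} \<in> sets paths" for n
    by (rule sets_paths_Collect) (unfold S_def, measurable)
  have Sev: "{w\<in>space M. S n (path_from t w)} \<in> events" for n t
    by (rule path_from_event(1)[OF Sm])
  have eq: "X u w = X t w" if w: "w \<in> space M" and St: "S n (path_from t w)" and Su: "S n (path_from u w)"
    and tu: "t < u" "u < t + 1 / 2 ^ n" for n t u w
  proof (rule antisym)
    have inc: "\<forall>s\<ge>t. X t w \<le> X s w" "\<forall>s\<ge>u. X u w \<le> X s w"
      using St Su path_from_dyadic_ge_iff[OF w, of 0] by (auto simp: S_def)
    then show "X t w \<le> X u w" using tu by simp
    show "X u w \<le> X t w"
    proof (rule ccontr)
      assume "\<not> X u w \<le> X t w"
      then have "0 < X u w - X t w" by simp
      then obtain m where m: "inverse (real (Suc m)) < X u w - X t w" using reals_Archimedean by blast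
      obtain k j :: nat where kj: "1 / 2 ^ n \<le> real j / 2 ^ k" "path_from t w (real j / 2 ^ k) < inverse (real (Suc m))"
        using St unfolding S_def by blast
      have "X u w \<le> X (t + real j / 2 ^ k) w" using inc(2) kj tu by auto
      then show False using kj(2) m by (simp add: path_from_def)
    qed
  qed
  have zero: "prob {w\<in>space M. S n (path_from 0 w)} = 0" for n
  proof (rule ccontr)
    assume "prob {w\<in>space M. S n (path_from 0 w)} \<noteq> 0"
    then have p: "0 < prob {w\<in>space M. S n (path_from 0 w)}" (is "0 < ?p") by (simp add: zero_less_measure_iff)
    \<comment> \<open>The \<open>N\<close> times \<open>i * \<delta>\<close> span less than
      \<open>1 / 2 ^ n\<close>. If \<open>S n\<close> holds at two of them, the increment between
      them vanishes, an event that \<open>avoid\<close> makes null. So the \<open>N\<close> events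
      are almost surely disjoint, each of probability \<open>?p\<close>, and their total exceeds
      1.\<close>
    obtain N :: nat where N: "1 < real N * ?p" using reals_Archimedean3[OF p] by blast
    then have N0: "0 < N" by (auto intro: gr0I)
    then have "0 < 1 / (2 ^ n * real N)" by simp
    from avoid[OF this, of N] obtain \<delta> where \<delta>: "0 < \<delta>" "\<delta> < 1 / (2 ^ n * real N)" "\<forall>i\<in>{1..N}. zero_prob (real i * \<delta>) = 0"
      by blast
    have N\<delta>: "real N * \<delta> < 1 / 2 ^ n" using \<delta>(2) N0 by (simp add: field_simps)
    define E where "E i = {w\<in>space M. S n (path_from (real i * \<delta>) w)}" for i :: nat
    have Eev: "E i \<in> events" for i unfolding E_def by (rule Sev)
    have pE: "prob (E i) = ?p" for i unfolding E_def by (rule path_from_law[OF Sm])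
    have "AE w in M. \<not> (w \<in> E i \<and> w \<in> E j)" if ij: "i < j" "j < N" for i j
    proof -
      have "prob {w\<in>space M. path_from (real i * \<delta>) w (real (j - i) * \<delta>) \<in> {0}} = prob {w\<in>space M. path_from 0 w (real (j - i) * \<delta>) \<in> {0}}"
        by (rule path_from_law, rule sets_paths_Collect) measurable
      also have "\<dots> = zero_prob (real (j - i) * \<delta>)"
        using \<delta>(1) by (simp add: path_from_0 cong: conj_cong)
      also have "\<dots> = 0" using bspec[OF \<delta>(3), of "j - i"] ij by simp linarith
      finally have "AE w in M. path_from (real i * \<delta>) w (real (j - i) * \<delta>) \<noteq> 0"
        by (subst (asm) prob_eq_0) (auto simp: path_from_def)
      then show ?thesis
      proof eventually_elim
        case ne: (elim w)
        show ?case
        proof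
        assume both: "w \<in> E i \<and> w \<in> E j"
        have lt: "real i * \<delta> < real j * \<delta>" using ij \<delta>(1) by simp
        have "real j * \<delta> \<le> real N * \<delta>" using ij \<delta>(1) by simp
        then have "real j * \<delta> < real i * \<delta> + 1 / 2 ^ n" using N\<delta> \<delta>(1) by (smt (verit) mult_nonneg_nonneg of_nat_0_le_iff)
        then have "X (real j * \<delta>) w = X (real i * \<delta>) w" using both lt by (intro eq) (auto simp: E_def)
        moreover have "real i * \<delta> + real (j - i) * \<delta> = real j * \<delta>" using ij by (simp add: of_nat_diff algebra_simps)
        ultimately show False using ne \<delta>(1) by (simp add: path_from_def)
        qed
      qed
    qed
    then have "AE w in M. \<forall>j\<in>{..<N}. \<forall>i\<in>{..<j}. \<not> (w \<in> E i \<and> w \<in> E j)"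
      by (intro AE_finite_allI) auto
    then have "AE w in M. (\<Sum>i<N. indicator (E i) w :: real) \<le> 1"
    proof eventually_elim
      case (elim w)
      have card: "card {i\<in>{..<N}. w \<in> E i} \<le> 1"
        using elim by (auto simp: card_le_Suc0_iff_eq) (metis linorder_neqE_nat lessThan_iff)
      have "(\<Sum>i<N. indicator (E i) w :: real) = real (card {i\<in>{..<N}. w \<in> E i})"
        by (simp add: indicator_def sum.If_cases Int_def)
      with card show ?case by simp
    qed
    then have "(\<integral>w. (\<Sum>i<N. indicator (E i) w :: real) \<partial>M) \<le> (\<integral>w. 1 \<partial>M)"
      using Eev by (intro integral_mono_AE Bochner_Integration.integrable_sum) (auto simp: emeasure_eq_measure)
    also have "(\<integral>w. (\<Sum>i<N. indicator (E i) w :: real) \<partial>M) = (\<Sum>i<N. prob (E i))"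
      using Eev by (subst Bochner_Integration.integral_sum) (auto simp: emeasure_eq_measure)
    finally have "real N * ?p \<le> 1" by (simp add: pE prob_space)
    with N show False by simp
  qed
  have "AE w in M. \<forall>n. \<not> S n (path_from 0 w)"
    unfolding AE_all_countable
  proof
    fix n from zero[of n] show "AE w in M. \<not> S n (path_from 0 w)"
      by (subst (asm) prob_eq_0[OF Sev]) auto
  qed
  moreover have "AE w in M. Inf (ereal ` {t. t > 0 \<and> X t w \<in> {..0}}) = 0"
    using reg by (simp add: zero_regular_for_def)
  moreover have "AE w in M. w \<in> space M" by simp
  ultimately have "AE w in M. \<not> (\<forall>k j::nat. 0 \<le> X (real j / 2 ^ k) w)"
  proof eventually_elim
    case (elim w)
    then have w: "w \<in> space M" and S: "\<forall>n. \<not> S n (path_from 0 w)" and Inf: "Inf (ereal ` {t. t > 0 \<and> X t w \<in> {..0}}) = 0"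
      by simp_all
    show ?case
    proof
    assume nonneg: "\<forall>k j::nat. 0 \<le> X (real j / 2 ^ k) w"
    have "{t. t > 0 \<and> X t w \<in> {..0}} \<noteq> {}"
    proof
      assume "{t. t > 0 \<and> X t w \<in> {..0}} = {}"
      from Inf[unfolded this] show False by (simp add: top_ereal_def)
    qed
    \<comment> \<open>A nonnegative path with a value at most 0 at time \<open>t\<close> satisfies
      \<open>S n\<close> as soon as \<open>1 / 2 ^ n < t\<close>.\<close>
    then obtain t where t: "0 < t" "X t w \<le> 0" by auto
    obtain n :: nat where n: "(1/2) ^ n < t" using real_arch_pow_inv[OF t(1), of "1/2"] by auto
    have "S n (path_from 0 w)"
      unfolding S_def
    proof (intro conjI allI)
      show "0 \<le> path_from 0 w (real j / 2 ^ k)" for k j :: nat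
        using nonneg w by (simp add: path_from_0)
      fix m :: nat
      have "0 < inverse (real (Suc m))" by simp
      then have "X t w \<in> {..<inverse (real (Suc m))}" using t(2) by (simp only: lessThan_iff)
      from dyadic_right_approx[OF right_continuous[OF w] less_imp_le[OF t(1)] open_lessThan this, of "t + 1"]
      obtain k j :: nat where "t < real j / 2 ^ k" "X (real j / 2 ^ k) w < inverse (real (Suc m))" by auto
      then show "\<exists>k j::nat. 1 / 2 ^ n \<le> real j / 2 ^ k \<and> path_from 0 w (real j / 2 ^ k) < inverse (real (Suc m))"
        using n w by (intro exI[of _ k] exI[of _ j]) (simp add: path_from_0 power_divide)
    qed
    with S show False by blast
    qed
  qed
  then show ?thesis by (subst prob_eq_0) auto
qed

end

section \<open>The characteristic exponent and compound Poisson processes\<close>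

definition nu_hat :: "real measure \<Rightarrow> real \<Rightarrow> complex" where
  "nu_hat \<nu> \<theta> = (CLINT x|\<nu>. iexp (\<theta> * x))"

lemma nu_hat_measurable:
  assumes "finite_measure \<nu>" and s [measurable_cong]: "sets \<nu> = sets borel"
  shows "nu_hat \<nu> \<in> borel_measurable borel"
proof -
  interpret finite_measure \<nu> by fact
  show ?thesis unfolding nu_hat_def[abs_def] by measurable
qed

lemma norm_nu_hat_le: "cmod (nu_hat \<nu> \<theta>) \<le> measure \<nu> (space \<nu>)"
proof -
  have "cmod (nu_hat \<nu> \<theta>) \<le> (\<integral>x. cmod (iexp (\<theta> * x)) \<partial>\<nu>)"
    unfolding nu_hat_def by (rule integral_norm_bound)
  then show ?thesis by (simp del: of_real_mult)
qed

lemma levy_measureD: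
  assumes "levy_measure \<nu>"
  shows sets_levy_measure: "sets \<nu> = sets borel"
    and levy_measure_integrable: "integrable \<nu> (\<lambda>x. min 1 (x\<^sup>2))"
proof -
  show s [measurable_cong]: "sets \<nu> = sets borel" using assms by (simp add: levy_measure_def)
  show "integrable \<nu> (\<lambda>x. min 1 (x\<^sup>2))"
    using assms by (intro integrableI_bounded) (auto simp: levy_measure_def)
qed

text \<open>Second-order Taylor expansion gives \<open>\<theta>\<^sup>2 * x\<^sup>2 / 2\<close> for
  small jumps, the triangle inequality gives 2 for large ones; the constant is chosen to cover
  both.\<close>

lemma levy_integrand_bound:
  "cmod (1 - iexp (\<theta> * x) + \<i> * complex_of_real (\<theta> * x * indicator {x. \<bar>x\<bar> < 1} x)) \<le> (\<theta>\<^sup>2 + 2) * min 1 (x\<^sup>2)"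
proof (cases "\<bar>x\<bar> < 1")
  case True
  then have m: "min 1 (x\<^sup>2) = x\<^sup>2" by (simp add: abs_square_le_1 less_imp_le)
  have "cmod (iexp (\<theta> * x) - (1 + \<i> * complex_of_real (\<theta> * x))) \<le> (\<theta> * x)\<^sup>2 / 2"
    using iexp_approx1[of "\<theta> * x" 1] by (simp add: numeral_2_eq_2 power_abs[symmetric] power2_eq_square abs_mult)
  also have "\<dots> \<le> \<theta>\<^sup>2 * x\<^sup>2 + 2 * x\<^sup>2" by (simp add: power_mult_distrib field_simps)
  also have "\<dots> = (\<theta>\<^sup>2 + 2) * x\<^sup>2" by (simp add: algebra_simps)
  finally have "cmod (iexp (\<theta> * x) - (1 + \<i> * complex_of_real (\<theta> * x))) \<le> (\<theta>\<^sup>2 + 2) * x\<^sup>2" .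
  moreover have "1 - iexp (\<theta> * x) + \<i> * complex_of_real (\<theta> * x * indicator {x. \<bar>x\<bar> < 1} x) = - (iexp (\<theta> * x) - (1 + \<i> * complex_of_real (\<theta> * x)))"
    using True by simp
  ultimately show ?thesis unfolding m by (simp only: norm_minus_cancel)
next
  case False
  then have m: "min 1 (x\<^sup>2) = 1" using abs_le_square_iff[of 1 x] by simp
  have "cmod (1 - iexp (\<theta> * x)) \<le> 1 + 1"
    by (rule order_trans[OF norm_triangle_ineq4]) (simp del: of_real_mult)
  also have "\<dots> \<le> \<theta>\<^sup>2 + 2" by simp
  finally show ?thesis using False m by simp
qed

lemma levy_integrand_integrable:
  assumes "levy_measure \<nu>"
  shows "integrable \<nu> (\<lambda>x. 1 - iexp (\<theta> * x) + \<i> * complex_of_real (\<theta> * x * indicator {x. \<bar>x\<bar> < 1} x))"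
proof -
  note [measurable_cong] = sets_levy_measure[OF assms]
  show ?thesis
  proof (rule Bochner_Integration.integrable_bound)
    show "integrable \<nu> (\<lambda>x. (\<theta>\<^sup>2 + 2) * min 1 (x\<^sup>2))" using levy_measure_integrable[OF assms] by simp
    show "AE x in \<nu>. cmod (1 - iexp (\<theta> * x) + \<i> * complex_of_real (\<theta> * x * indicator {x. \<bar>x\<bar> < 1} x)) \<le> norm ((\<theta>\<^sup>2 + 2) * min 1 (x\<^sup>2))"
      using levy_integrand_bound by (intro AE_I2 order_trans[OF levy_integrand_bound]) (simp add: abs_mult)
  qed measurable
qed

lemma Re_levy_integrand: "Re (1 - iexp (\<theta> * x) + \<i> * complex_of_real r) = 1 - cos (\<theta> * x)"
  by (simp add: Re_exp)

lemma levy_cos_integrable: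
  assumes "levy_measure \<nu>"
  shows "integrable \<nu> (\<lambda>x. 1 - cos (\<theta> * x))"
  using integrable_Re[OF levy_integrand_integrable[OF assms, of \<theta>]] unfolding Re_levy_integrand .

lemma Re_levy_exponent:
  assumes "levy_measure \<nu>"
  shows "Re (levy_exponent a \<sigma> \<nu> \<theta>) = \<sigma>\<^sup>2 * \<theta>\<^sup>2 / 2 + (\<integral>x. 1 - cos (\<theta> * x) \<partial>\<nu>)"
  using integral_Re[OF levy_integrand_integrable[OF assms, of \<theta>]]
  unfolding Re_levy_integrand levy_exponent_def by simp

text \<open>For a finite measure the compensator of the small jumps is integrable and moves into the
  linear term, changing \<open>a\<close> to \<open>d\<close>. Since \<open>levy_drift\<close> is a
  definite description, uniqueness has to be shown as well; comparing at \<open>\<theta> = 1\<close>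
  settles it.\<close>

lemma levy_exponent_drift:
  assumes \<nu>: "levy_measure \<nu>" and fin: "emeasure \<nu> UNIV < \<infinity>"
  shows "levy_exponent a 0 \<nu> \<theta> = - \<i> * complex_of_real (levy_drift a 0 \<nu>) * complex_of_real \<theta> + (CLINT x|\<nu>. 1 - iexp (\<theta> * x))"
proof -
  note [measurable_cong] = sets_levy_measure[OF \<nu>]
  have sp: "space \<nu> = UNIV" using sets_eq_imp_space_eq[OF sets_levy_measure[OF \<nu>]] by simp
  interpret finite_measure \<nu> by (rule finite_measureI) (use fin sp in auto)
  define d where "d = a - (\<integral>x. x * indicator {x. \<bar>x\<bar> < 1} x \<partial>\<nu>)"
  have int1: "integrable \<nu> (\<lambda>x. 1 - iexp (\<theta> * x))" for \<theta>
    by (rule integrable_const_bound[where B = 2])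
       (auto intro!: order_trans[OF norm_triangle_ineq4] simp del: of_real_mult)
  have int2: "integrable \<nu> (\<lambda>x. x * indicator {x. \<bar>x\<bar> < 1} x)"
    by (rule integrable_const_bound[where B = 1]) (auto simp: indicator_def)
  have d: "levy_exponent a 0 \<nu> \<theta> = - \<i> * complex_of_real d * complex_of_real \<theta> + (CLINT x|\<nu>. 1 - iexp (\<theta> * x))" for \<theta>
  proof -
    have "(CLINT x|\<nu>. 1 - iexp (\<theta> * x) + \<i> * complex_of_real (\<theta> * x * indicator {x. \<bar>x\<bar> < 1} x))
      = (CLINT x|\<nu>. (1 - iexp (\<theta> * x)) + \<i> * complex_of_real \<theta> * complex_of_real (x * indicator {x. \<bar>x\<bar> < 1} x))"
      by (simp add: mult_ac)
    also have "\<dots> = (CLINT x|\<nu>. 1 - iexp (\<theta> * x)) + \<i> * complex_of_real \<theta> * complex_of_real (\<integral>x. x * indicator {x. \<bar>x\<bar> < 1} x \<partial>\<nu>)"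
      using int1 int2 by (subst Bochner_Integration.integral_add) (simp_all del: of_real_mult)
    finally show ?thesis by (simp add: levy_exponent_def d_def algebra_simps)
  qed
  have "levy_drift a 0 \<nu> = d"
    unfolding levy_drift_def
  proof (rule the_equality)
    show "\<forall>\<theta>. levy_exponent a 0 \<nu> \<theta> = - \<i> * complex_of_real d * complex_of_real \<theta> + (CLINT x|\<nu>. 1 - iexp (\<theta> * x))"
      using d by blast
    fix d' assume "\<forall>\<theta>. levy_exponent a 0 \<nu> \<theta> = - \<i> * complex_of_real d' * complex_of_real \<theta> + (CLINT x|\<nu>. 1 - iexp (\<theta> * x))"
    from this[rule_format, of 1] d[of 1] show "d' = d" by simp
  qed
  with d show ?thesis by simp
qed

section \<open>What an atom at zero says about the exponent\<close>

lemma (in prob_space) char_affine: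
  assumes [measurable]: "Z \<in> borel_measurable M"
  shows "char (distr M borel (\<lambda>w. c * Z w + b)) \<theta> = iexp (\<theta> * b) * char (distr M borel Z) (c * \<theta>)"
proof -
  have "iexp (\<theta> * (c * Z w + b)) = iexp (\<theta> * b) * iexp (c * \<theta> * Z w)" for w
    by (simp add: exp_add[symmetric] algebra_simps)
  then show ?thesis
    by (simp add: char_def integral_distr del: of_real_mult of_real_add)
qed

text \<open>\<open>cos (\<theta> * Y)\<close> is 1 on the atom and at least \<open>- 1\<close>
  elsewhere; the resulting bound is uniform in \<theta>.\<close>

lemma (in prob_space) Re_char_atom:
  assumes [measurable]: "Y \<in> borel_measurable M"
  shows "2 * prob {w\<in>space M. Y w = 0} - 1 \<le> Re (char (distr M borel Y) \<theta>)"
proof -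
  have int: "integrable M (\<lambda>w. iexp (\<theta> * Y w))"
    by (rule integrable_const_bound[where B = 1]) (auto simp del: of_real_mult)
  have "2 * prob {w\<in>space M. Y w = 0} - 1 = (\<integral>w. 2 * indicator {w\<in>space M. Y w = 0} w - 1 \<partial>M)"
    by (subst Bochner_Integration.integral_diff) (auto simp: prob_space emeasure_eq_measure)
  also have "\<dots> \<le> (\<integral>w. Re (iexp (\<theta> * Y w)) \<partial>M)"
  proof (rule integral_mono)
    show "integrable M (\<lambda>w. Re (iexp (\<theta> * Y w)))" using int by (rule integrable_Re)
    show "2 * indicator {w\<in>space M. Y w = 0} w - 1 \<le> Re (iexp (\<theta> * Y w))" if "w \<in> space M" for w
      using that by (cases "Y w = 0") (simp_all add: Re_exp)
  qed (auto simp: emeasure_eq_measure)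
  also have "\<dots> = Re (char (distr M borel Y) \<theta>)"
    using integral_Re[OF int] by (simp add: char_def integral_distr)
  finally show ?thesis .
qed

lemma prob_space_std_normal [simp]: "prob_space std_normal_distribution"
  using real_dist_normal_dist by (simp add: real_distribution_def)

lemma integral_cos_std_normal:
  "(\<integral>z. 1 - cos (y * z) \<partial>std_normal_distribution) = 1 - exp (- (y\<^sup>2) / 2)"
proof -
  interpret prob_space std_normal_distribution by simp
  have int: "integrable std_normal_distribution (\<lambda>z. iexp (y * z))"
    by (rule integrable_const_bound[where B = 1]) (auto simp del: of_real_mult)
  have "(\<integral>z. Re (iexp (y * z)) \<partial>std_normal_distribution) = exp (- (y\<^sup>2) / 2)"
    using integral_Re[OF int] fun_cong[OF char_std_normal_distribution, of y] by (simp add: char_def)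
  then have "(\<integral>z. cos (y * z) \<partial>std_normal_distribution) = exp (- (y\<^sup>2) / 2)" by (simp add: Re_exp)
  moreover have "integrable std_normal_distribution (\<lambda>z. cos (y * z))"
    by (rule integrable_const_bound[where B = 1]) auto
  moreover have "prob UNIV = 1" using prob_space by simp
  ultimately show ?thesis by simp
qed

text \<open>Averaging the bound over \<open>\<theta> = T z\<close> with a standard normal \<open>z\<close> turns \<open>1 - cos (\<theta> * x)\<close> into
  \<open>1 - exp (- (T * x)\<^sup>2 / 2)\<close>, which is at least \<open>1 / 2\<close> for \<open>\<bar>x\<bar> \<ge> 1 / (n + 1)\<close> and \<open>T = 2 * (n + 1)\<close>.\<close>

lemma levy_measure_finite_of_bounded:
  assumes \<nu>: "levy_measure \<nu>" and C: "\<And>\<theta>. (\<integral>x. 1 - cos (\<theta> * x) \<partial>\<nu>) \<le> C"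
  shows "emeasure \<nu> UNIV < \<infinity>"
proof -
  note [measurable_cong] = sets_levy_measure[OF \<nu>]
  have sp: "space \<nu> = UNIV" using sets_eq_imp_space_eq[OF sets_levy_measure[OF \<nu>]] by simp
  have nn: "(\<integral>\<^sup>+x. ennreal (1 - cos (\<theta> * x)) \<partial>\<nu>) \<le> ennreal C" for \<theta>
    using C[of \<theta>] levy_cos_integrable[OF \<nu>, of \<theta>]
    by (subst nn_integral_eq_integral) (auto intro: ennreal_leI)
  \<comment> \<open>Away from the origin the measure is finite, as Fubini's theorem requires
    below.\<close>
  define A where "A n = {x::real. inverse (real (Suc n)) \<le> \<bar>x\<bar>}" for n
  have [measurable]: "A n \<in> sets borel" for n unfolding A_def by measurable
  have fin: "emeasure \<nu> (A n) < \<infinity>" for n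
  proof -
    let ?\<delta> = "(inverse (real (Suc n)))\<^sup>2"
    have "ennreal ?\<delta> * emeasure \<nu> (A n) = (\<integral>\<^sup>+x. ennreal ?\<delta> * indicator (A n) x \<partial>\<nu>)"
      by (rule nn_integral_cmult_indicator[symmetric]) measurable
    also have "\<dots> \<le> (\<integral>\<^sup>+x. ennreal (min 1 (x\<^sup>2)) \<partial>\<nu>)"
    proof (rule nn_integral_mono)
      fix x
      show "ennreal ?\<delta> * indicator (A n) x \<le> ennreal (min 1 (x\<^sup>2))"
      proof (cases "x \<in> A n")
        case True
        then have "inverse (real (Suc n)) \<le> \<bar>x\<bar>" by (simp add: A_def)
        then have "?\<delta> \<le> \<bar>x\<bar>\<^sup>2" by (rule power_mono) simp
        moreover have "?\<delta> \<le> 1" by (intro power_le_one) (auto simp: field_simps)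
        ultimately show ?thesis using True by (simp add: ennreal_leI)
      qed simp
    qed
    also have "\<dots> < \<infinity>" using \<nu> by (simp add: levy_measure_def)
    finally have "ennreal ?\<delta> * emeasure \<nu> (A n) < \<infinity>" .
    then show ?thesis by (auto simp: ennreal_mult_less_top)
  qed
  have bound: "emeasure \<nu> (A n) \<le> 2 * ennreal C" for n
  proof -
    define \<nu>n where "\<nu>n = density \<nu> (indicator (A n))"
    have [measurable_cong]: "sets \<nu>n = sets borel" by (simp add: \<nu>n_def sets_levy_measure[OF \<nu>])
    interpret n: finite_measure \<nu>n
      by (rule finite_measureI) (use fin[of n] sp in \<open>simp add: \<nu>n_def emeasure_density\<close>)
    interpret N: prob_space std_normal_distribution by simp
    interpret pair_sigma_finite std_normal_distribution \<nu>n ..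
    define T where "T = 2 * real (Suc n)"
    have "emeasure \<nu> (A n) = (\<integral>\<^sup>+x. indicator (A n) x \<partial>\<nu>)" by simp
    also have "\<dots> \<le> (\<integral>\<^sup>+x. indicator (A n) x * (2 * ennreal (1 - exp (- ((T * x)\<^sup>2) / 2))) \<partial>\<nu>)"
    proof (rule nn_integral_mono)
      fix x :: real
      show "indicator (A n) x \<le> indicator (A n) x * (2 * ennreal (1 - exp (- ((T * x)\<^sup>2) / 2)))"
      proof (cases "x \<in> A n")
        case True
        then have "inverse (real (Suc n)) \<le> \<bar>x\<bar>" by (simp add: A_def)
        then have "T * inverse (real (Suc n)) \<le> T * \<bar>x\<bar>" by (intro mult_left_mono) (auto simp: T_def)
        moreover have "T * inverse (real (Suc n)) = 2" by (simp add: T_def del: of_nat_Suc)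
        ultimately have "2 \<le> T * \<bar>x\<bar>" by simp
        then have "2\<^sup>2 \<le> (T * \<bar>x\<bar>)\<^sup>2" by (rule power_mono) simp
        then have "4 \<le> (T * x)\<^sup>2" by (simp add: power_mult_distrib)
        then have "exp (- ((T * x)\<^sup>2) / 2) \<le> exp (- (1::real))" by simp
        also have "\<dots> \<le> 1 / 2" using exp_ge_add_one_self[of 1] by (simp add: exp_minus field_simps)
        finally have "1 \<le> 2 * (1 - exp (- ((T * x)\<^sup>2) / 2))" by simp
        from ennreal_leI[OF this] have "1 \<le> 2 * ennreal (1 - exp (- ((T * x)\<^sup>2) / 2))"
          unfolding ennreal_mult'[of 2, OF zero_le_numeral] by simp
        then show ?thesis using True by simp
      qed simp
    qed
    also have "\<dots> = (\<integral>\<^sup>+x. 2 * ennreal (1 - exp (- ((T * x)\<^sup>2) / 2)) \<partial>\<nu>n)"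
      unfolding \<nu>n_def by (subst nn_integral_density) auto
    also have "\<dots> = 2 * (\<integral>\<^sup>+x. ennreal (1 - exp (- ((T * x)\<^sup>2) / 2)) \<partial>\<nu>n)"
      by (rule nn_integral_cmult) measurable
    also have "(\<integral>\<^sup>+x. ennreal (1 - exp (- ((T * x)\<^sup>2) / 2)) \<partial>\<nu>n)
       = (\<integral>\<^sup>+x. \<integral>\<^sup>+z. ennreal (1 - cos (T * x * z)) \<partial>std_normal_distribution \<partial>\<nu>n)"
    proof (rule nn_integral_cong)
      fix x :: real
      have "integrable std_normal_distribution (\<lambda>z. 1 - cos (T * x * z))"
        by (rule N.integrable_const_bound[where B = 2]) (auto intro!: AE_I2 abs_leI)
      then show "ennreal (1 - exp (- ((T * x)\<^sup>2) / 2)) = (\<integral>\<^sup>+z. ennreal (1 - cos (T * x * z)) \<partial>std_normal_distribution)"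
        by (subst nn_integral_eq_integral) (auto simp: integral_cos_std_normal)
    qed
    also have "\<dots> = (\<integral>\<^sup>+z. \<integral>\<^sup>+x. ennreal (1 - cos (T * x * z)) \<partial>\<nu>n \<partial>std_normal_distribution)"
      by (rule Fubini') measurable
    also have "\<dots> \<le> (\<integral>\<^sup>+z. ennreal C \<partial>std_normal_distribution)"
    proof (rule nn_integral_mono)
      fix z :: real
      have "(\<integral>\<^sup>+x. ennreal (1 - cos (T * x * z)) \<partial>\<nu>n) = (\<integral>\<^sup>+x. indicator (A n) x * ennreal (1 - cos (T * x * z)) \<partial>\<nu>)"
        unfolding \<nu>n_def by (subst nn_integral_density) auto
      also have "\<dots> \<le> (\<integral>\<^sup>+x. ennreal (1 - cos ((T * z) * x)) \<partial>\<nu>)"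
        by (rule nn_integral_mono) (auto simp: indicator_def mult_ac)
      also have "\<dots> \<le> ennreal C" by (rule nn)
      finally show "(\<integral>\<^sup>+x. ennreal (1 - cos (T * x * z)) \<partial>\<nu>n) \<le> ennreal C" .
    qed
    also have "\<dots> = ennreal C" using N.emeasure_space_1 by (simp del: space_density)
    finally show ?thesis by (simp add: mult_left_mono)
  qed
  \<comment> \<open>The bound does not depend on \<open>n\<close>, so it passes to the union, which
    misses only the massless origin.\<close>
  have "incseq A"
    by (rule incseq_SucI) (auto simp: A_def intro: order_trans[rotated] le_imp_inverse_le)
  then have "(\<lambda>n. emeasure \<nu> (A n)) \<longlonglongrightarrow> emeasure \<nu> (\<Union>n. A n)"
    by (intro Lim_emeasure_incseq) auto
  then have UA: "emeasure \<nu> (\<Union>n. A n) \<le> 2 * ennreal C"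
    by (rule LIMSEQ_le_const2) (use bound in auto)
  have "UNIV \<subseteq> {0} \<union> (\<Union>n. A n)"
  proof
    fix x :: real
    show "x \<in> {0} \<union> (\<Union>n. A n)"
    proof (cases "x = 0")
      case False
      then have "0 < \<bar>x\<bar>" by simp
      from reals_Archimedean[OF this] obtain n where "inverse (real (Suc n)) < \<bar>x\<bar>" ..
      then have "x \<in> A n" by (simp add: A_def)
      then show ?thesis by blast
    qed simp
  qed
  then have "emeasure \<nu> UNIV \<le> emeasure \<nu> ({0} \<union> (\<Union>n. A n))" by (rule emeasure_mono) measurable
  also have "\<dots> \<le> emeasure \<nu> {0} + emeasure \<nu> (\<Union>n. A n)" by (rule emeasure_subadditive) measurable
  also have "\<dots> \<le> 2 * ennreal C" using \<nu> UA by (simp add: levy_measure_def)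
  also have "\<dots> < \<infinity>" by (simp add: ennreal_mult_less_top)
  finally show ?thesis .
qed

text \<open>An atom above \<open>3 / 4\<close> keeps the real part of the characteristic function
  above \<open>1 / 2\<close> at every \<theta>. For one fixed \<open>h\<close> this bounds the real
  part of the exponent, which excludes a Gaussian part and makes \<nu> finite. A remaining drift
  would, for small \<open>h\<close> and a suitable \<theta>, rotate the characteristic function into
  the left half-plane.\<close>

lemma compound_poisson_of_zero_prob_near_1:
  assumes "prob_space M" and [measurable]: "\<And>t. X t \<in> borel_measurable M"
    and trip: "levy_triplet M X a \<sigma> \<nu>" and c: "c = 1 \<or> c = - 1"
    and near: "\<And>\<epsilon>. 0 < \<epsilon> \<Longrightarrow> \<exists>h>0. h < \<epsilon> \<and> 3 / 4 < measure M {w\<in>space M. c * X h w + b * h = 0}"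
  shows "\<sigma> = 0 \<and> emeasure \<nu> UNIV < \<infinity> \<and> c * levy_drift a \<sigma> \<nu> + b = 0"
proof -
  interpret prob_space M by fact
  have \<nu>: "levy_measure \<nu>" and \<sigma>0: "0 \<le> \<sigma>" using trip by (auto simp: levy_triplet_def)
  have ch: "char (distr M borel (X t)) \<theta> = exp (- complex_of_real t * levy_exponent a \<sigma> \<nu> \<theta>)" if "0 \<le> t" for t \<theta>
    using trip that by (simp add: levy_triplet_def)
  have half: "1 / 2 < Re (iexp (\<theta> * (b * h)) * exp (- complex_of_real h * levy_exponent a \<sigma> \<nu> (c * \<theta>)))"
    if "0 < h" "3 / 4 < measure M {w\<in>space M. c * X h w + b * h = 0}" for h \<theta>
    using Re_char_atom[of "\<lambda>w. c * X h w + b * h" \<theta>] that char_affine[of "X h" c "b * h" \<theta>] ch[of h "c * \<theta>"] by simp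
  obtain h where h: "0 < h" "3 / 4 < measure M {w\<in>space M. c * X h w + b * h = 0}" using near[of 1] by auto
  \<comment> \<open>Solving \<open>1 / 2 < exp (- h * r)\<close> for \<open>r\<close>, the real part
    of the exponent.\<close>
  define C where "C = ln 2 / h"
  have C: "Re (levy_exponent a \<sigma> \<nu> \<theta>) \<le> C" for \<theta>
  proof -
    have cc: "c * (c * \<theta>) = \<theta>" using c by auto
    have "1 / 2 < Re (iexp (c * \<theta> * (b * h)) * exp (- complex_of_real h * levy_exponent a \<sigma> \<nu> \<theta>))"
      using half[OF h, of "c * \<theta>"] unfolding cc .
    also have "\<dots> \<le> cmod (iexp (c * \<theta> * (b * h)) * exp (- complex_of_real h * levy_exponent a \<sigma> \<nu> \<theta>))"
      by (rule complex_Re_le_cmod)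
    also have "\<dots> = exp (- h * Re (levy_exponent a \<sigma> \<nu> \<theta>))"
      by (simp add: norm_mult del: of_real_mult)
    finally have "exp (ln (1 / 2)) < exp (- h * Re (levy_exponent a \<sigma> \<nu> \<theta>))" by simp
    then have "ln (1 / 2) < - h * Re (levy_exponent a \<sigma> \<nu> \<theta>)" unfolding exp_less_cancel_iff .
    then show ?thesis using h(1) by (simp add: C_def ln_div field_simps)
  qed
  have nonneg: "0 \<le> (\<integral>x. 1 - cos (\<theta> * x) \<partial>\<nu>)" for \<theta>
    by (rule Bochner_Integration.integral_nonneg) simp
  have \<sigma>: "\<sigma> = 0"
  proof (rule ccontr)
    assume "\<sigma> \<noteq> 0"
    have "\<sigma>\<^sup>2 * \<theta>\<^sup>2 / 2 \<le> C" for \<theta>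
      using C[of \<theta>] nonneg[of \<theta>] unfolding Re_levy_exponent[OF \<nu>] by linarith
    \<comment> \<open>At this argument the Gaussian term equals
      \<open>\<bar>C\<bar> + 1\<close>.\<close>
    from this[of "sqrt (2 * (\<bar>C\<bar> + 1)) / \<sigma>"] \<open>\<sigma> \<noteq> 0\<close> show False
      by (simp add: power_divide)
  qed
  have fin: "emeasure \<nu> UNIV < \<infinity>"
  proof (rule levy_measure_finite_of_bounded[OF \<nu>])
    show "(\<integral>x. 1 - cos (\<theta> * x) \<partial>\<nu>) \<le> C" for \<theta>
      using C[of \<theta>] unfolding Re_levy_exponent[OF \<nu>] by (simp add: \<sigma>)
  qed
  note [measurable_cong] = sets_levy_measure[OF \<nu>]
  have sp: "space \<nu> = UNIV" using sets_eq_imp_space_eq[OF sets_levy_measure[OF \<nu>]] by simp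
  interpret n: finite_measure \<nu> by (rule finite_measureI) (use fin sp in auto)
  define D where "D = c * levy_drift a 0 \<nu> + b"
  define \<eta> where "\<eta> \<theta> = (CLINT x|\<nu>. 1 - iexp (\<theta> * x))" for \<theta> :: real
  define l where "l = 2 * measure \<nu> UNIV + 1"
  have l: "0 < l" by (simp add: l_def add_nonneg_pos)
  have \<eta>: "cmod (\<eta> \<theta>) < l" for \<theta>
  proof -
    have "cmod (\<eta> \<theta>) \<le> (\<integral>x. cmod (1 - iexp (\<theta> * x)) \<partial>\<nu>)" unfolding \<eta>_def by (rule integral_norm_bound)
    also have "\<dots> \<le> (\<integral>x. 2 \<partial>\<nu>)"
    proof (rule integral_mono)
      show b: "cmod (1 - iexp (\<theta> * x)) \<le> 2" for x
        by (rule order_trans[OF norm_triangle_ineq4]) (simp del: of_real_mult)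
      show "integrable \<nu> (\<lambda>x. cmod (1 - iexp (\<theta> * x)))"
        by (rule n.integrable_const_bound[where B = 2]) (use b in auto)
    qed simp
    also have "\<dots> < l" by (simp add: l_def sp)
    finally show ?thesis .
  qed
  have "D = 0"
  proof (rule ccontr)
    assume "D \<noteq> 0"
    obtain h where h: "0 < h" "h < 1 / l" "3 / 4 < measure M {w\<in>space M. c * X h w + b * h = 0}"
      using near[of "1 / l"] l by auto
    \<comment> \<open>The drift rotates by the angle \<open>pi\<close> at this \<theta>, while the
      jump part rotates by less than 1 because \<open>h * l < 1\<close>.\<close>
    define \<theta> where "\<theta> = pi / (h * D)"
    define z where "z = - complex_of_real h * \<eta> (c * \<theta>)"
    have "1 / 2 < Re (iexp (\<theta> * (b * h)) * exp (- complex_of_real h * levy_exponent a \<sigma> \<nu> (c * \<theta>)))"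
      by (rule half[OF h(1,3)])
    also have "iexp (\<theta> * (b * h)) * exp (- complex_of_real h * levy_exponent a \<sigma> \<nu> (c * \<theta>)) = iexp (\<theta> * (h * D)) * exp z"
      unfolding \<sigma> levy_exponent_drift[OF \<nu> fin] exp_add[symmetric]
      by (rule arg_cong[of _ _ exp]) (simp add: z_def \<eta>_def D_def algebra_simps)
    also have "iexp (\<theta> * (h * D)) = - 1" using h(1) \<open>D \<noteq> 0\<close> by (simp add: \<theta>_def mult.commute[of \<i>])
    finally have neg: "Re (exp z) < 0" by simp
    have "cmod z = h * cmod (\<eta> (c * \<theta>))" using h(1) by (simp add: z_def norm_mult)
    also have "\<dots> < h * l" using \<eta> h(1) by (intro mult_strict_left_mono)
    also have "\<dots> < 1" using h(2) l by (simp add: field_simps)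
    finally have "\<bar>Im z\<bar> < 1" using abs_Im_le_cmod[of z] by linarith
    then have "\<bar>Im z\<bar> < pi / 2" using pi_gt3 by linarith
    then have "0 < cos (Im z)" by (intro cos_gt_zero_pi) auto
    with neg show False by (simp add: Re_exp mult_less_0_iff not_less)
  qed
  then show ?thesis using \<sigma> fin by (simp add: D_def)
qed

section \<open>A lower bound for the atom of a compound Poisson law\<close>

lemma integral_nonneg_Reals:
  assumes "\<And>x. f x \<in> \<real>\<^sub>\<ge>\<^sub>0"
  shows "(CLINT x|M. f x) \<in> \<real>\<^sub>\<ge>\<^sub>0"
proof -
  have f: "f x = complex_of_real (Re (f x))" "0 \<le> Re (f x)" for x
    using assms[of x] by (auto simp: complex_nonneg_Reals_iff complex_eq_iff)
  have "(CLINT x|M. f x) = (CLINT x|M. complex_of_real (Re (f x)))"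
    by (rule Bochner_Integration.integral_cong) (use f(1) in auto)
  also have "\<dots> = complex_of_real (\<integral>x. Re (f x) \<partial>M)" by simp
  also have "\<dots> \<in> \<real>\<^sub>\<ge>\<^sub>0" using f(2) by (simp only: nonneg_Reals_of_real_iff) (rule Bochner_Integration.integral_nonneg)
  finally show ?thesis .
qed

text \<open>The powers of the Fourier transform of \<open>\<nu>\<close> are Fourier transforms of the convolution powers of
  \<open>\<nu>\<close>, hence positive definite.\<close>

lemma gaussian_integral_nu_hat_power:
  assumes "finite_measure \<nu>" and s [measurable_cong]: "sets \<nu> = sets borel"
  shows "(CLINT z|std_normal_distribution. nu_hat \<nu> (T * z) ^ n * iexp (y * z)) \<in> \<real>\<^sub>\<ge>\<^sub>0"
proof (induction n arbitrary: y)
  case 0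
  have "(CLINT z|std_normal_distribution. iexp (y * z)) = complex_of_real (exp (- (y\<^sup>2) / 2))"
    using fun_cong[OF char_std_normal_distribution, of y] by (simp add: char_def)
  also have "\<dots> \<in> \<real>\<^sub>\<ge>\<^sub>0" by (simp only: nonneg_Reals_of_real_iff) simp
  finally show ?case by simp
next
  case (Suc n)
  interpret n: finite_measure \<nu> by fact
  interpret N: prob_space std_normal_distribution by simp
  interpret P: finite_measure "std_normal_distribution \<Otimes>\<^sub>M \<nu>"
    by (rule finite_measure_pair_measure) unfold_locales
  interpret pair_sigma_finite std_normal_distribution \<nu> ..
  define K where "K = measure \<nu> (space \<nu>)"
  have b: "cmod (nu_hat \<nu> \<theta>) \<le> K" for \<theta> unfolding K_def by (rule norm_nu_hat_le)
  note [measurable] = nu_hat_measurable[OF assms(1) s]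
  \<comment> \<open>One factor \<open>nu_hat \<nu> (T * z)\<close> is opened as an integral over
    \<open>x\<close>. Its exponential merely shifts \<open>y\<close> to \<open>y + T * x\<close>,
    which is why the induction leaves \<open>y\<close> arbitrary.\<close>
  have "(CLINT z|std_normal_distribution. nu_hat \<nu> (T * z) ^ Suc n * iexp (y * z))
     = (CLINT z|std_normal_distribution. CLINT x|\<nu>. nu_hat \<nu> (T * z) ^ n * iexp ((y + T * x) * z))"
  proof (rule Bochner_Integration.integral_cong)
    fix z :: real
    have "iexp ((y + T * x) * z) = iexp (y * z) * iexp (T * z * x)" for x
      by (simp add: exp_add[symmetric] algebra_simps)
    then have "(CLINT x|\<nu>. nu_hat \<nu> (T * z) ^ n * iexp ((y + T * x) * z))
      = (CLINT x|\<nu>. (nu_hat \<nu> (T * z) ^ n * iexp (y * z)) * iexp (T * z * x))"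
      by (simp add: mult.assoc del: of_real_mult of_real_add)
    also have "\<dots> = (nu_hat \<nu> (T * z) ^ n * iexp (y * z)) * nu_hat \<nu> (T * z)"
      unfolding nu_hat_def[of \<nu> "T * z"] by (rule integral_mult_right_zero)
    finally show "nu_hat \<nu> (T * z) ^ Suc n * iexp (y * z) = (CLINT x|\<nu>. nu_hat \<nu> (T * z) ^ n * iexp ((y + T * x) * z))"
      by (simp only: power_Suc mult_ac)
  qed simp
  also have "\<dots> = (CLINT x|\<nu>. CLINT z|std_normal_distribution. nu_hat \<nu> (T * z) ^ n * iexp ((y + T * x) * z))"
  proof (rule Fubini_integral[symmetric])
    show "integrable (std_normal_distribution \<Otimes>\<^sub>M \<nu>) (\<lambda>(z, x). nu_hat \<nu> (T * z) ^ n * iexp ((y + T * x) * z))"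
    proof (rule P.integrable_const_bound[where B = "K ^ n"])
      show "AE p in std_normal_distribution \<Otimes>\<^sub>M \<nu>. cmod (case p of (z, x) \<Rightarrow> nu_hat \<nu> (T * z) ^ n * iexp ((y + T * x) * z)) \<le> K ^ n"
        using power_mono[OF b norm_ge_zero, of _ n]
        by (intro AE_I2) (auto simp: norm_mult norm_power simp del: of_real_mult of_real_add split: prod.split)
    qed measurable
  qed
  also have "\<dots> \<in> \<real>\<^sub>\<ge>\<^sub>0" by (rule integral_nonneg_Reals) (rule Suc.IH)
  finally show ?case .
qed

text \<open>In the exponential series every term has a nonnegative Gaussian integral by
  \<open>gaussian_integral_nu_hat_power\<close> at \<open>y = 0\<close>, and the term of index 0
  alone contributes 1.\<close>

lemma gaussian_integral_exp_nu_hat: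
  assumes "finite_measure \<nu>" and s [measurable_cong]: "sets \<nu> = sets borel" and "0 \<le> h"
  shows "1 \<le> Re (CLINT z|std_normal_distribution. exp (complex_of_real h * nu_hat \<nu> (T * z)))"
proof -
  interpret n: finite_measure \<nu> by fact
  interpret N: prob_space std_normal_distribution by simp
  define K where "K = measure \<nu> (space \<nu>)"
  have b: "cmod (nu_hat \<nu> \<theta>) \<le> K" for \<theta> unfolding K_def by (rule norm_nu_hat_le)
  note [measurable] = nu_hat_measurable[OF assms(1) s]
  have K0: "0 \<le> K" by (simp add: K_def)
  define t where "t k z = (complex_of_real h * nu_hat \<nu> (T * z)) ^ k /\<^sub>R fact k" for k and z :: real
  have tm [measurable]: "t k \<in> borel_measurable std_normal_distribution" for k unfolding t_def[abs_def] by measurable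
  have t_bound: "cmod (t k z) \<le> (h * K) ^ k /\<^sub>R fact k" for k z
  proof -
    have "cmod (complex_of_real h * nu_hat \<nu> (T * z)) \<le> h * K"
      using b \<open>0 \<le> h\<close> by (auto simp: norm_mult intro!: mult_left_mono)
    then show ?thesis unfolding t_def by (auto simp: norm_power intro!: mult_left_mono power_mono)
  qed
  have t_int: "integrable std_normal_distribution (t k)" for k
    by (rule N.integrable_const_bound[OF AE_I2[OF t_bound]]) measurable
  have "(\<lambda>m. CLINT z|std_normal_distribution. \<Sum>k<m. t k z) \<longlonglongrightarrow> (CLINT z|std_normal_distribution. exp (complex_of_real h * nu_hat \<nu> (T * z)))"
  proof (rule integral_dominated_convergence[where w = "\<lambda>_. exp (h * K)"])
    show "AE z in std_normal_distribution. (\<lambda>m. \<Sum>k<m. t k z) \<longlonglongrightarrow> exp (complex_of_real h * nu_hat \<nu> (T * z))"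
      using exp_converges[of "complex_of_real h * nu_hat \<nu> (T * _)"] by (intro AE_I2) (simp add: t_def sums_def)
    fix m
    show "AE z in std_normal_distribution. cmod (\<Sum>k<m. t k z) \<le> exp (h * K)"
    proof (rule AE_I2)
      fix z
      have "cmod (\<Sum>k<m. t k z) \<le> (\<Sum>k<m. (h * K) ^ k /\<^sub>R fact k)"
        using t_bound by (rule sum_norm_le)
      also have "\<dots> \<le> exp (h * K)"
        using exp_converges[of "h * K"] \<open>0 \<le> h\<close> K0 by (intro sum_le_suminf[THEN order_trans]) (auto simp: sums_iff)
      finally show "cmod (\<Sum>k<m. t k z) \<le> exp (h * K)" .
    qed
  qed measurable
  from tendsto_Re[OF this] show ?thesis
  proof (rule LIMSEQ_le_const, intro exI[of _ 1] allI impI)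
    fix m :: nat assume m: "1 \<le> m"
    have t_nonneg: "(CLINT z|std_normal_distribution. t k z) \<in> \<real>\<^sub>\<ge>\<^sub>0" for k
    proof -
      have "(CLINT z|std_normal_distribution. t k z)
        = (CLINT z|std_normal_distribution. complex_of_real (h ^ k / fact k) * (nu_hat \<nu> (T * z) ^ k * iexp (0 * z)))"
        by (rule Bochner_Integration.integral_cong) (auto simp: t_def scaleR_conv_of_real power_mult_distrib field_simps)
      also have "\<dots> = complex_of_real (h ^ k / fact k) * (CLINT z|std_normal_distribution. nu_hat \<nu> (T * z) ^ k * iexp (0 * z))"
        by (rule integral_mult_right_zero)
      also have "\<dots> \<in> \<real>\<^sub>\<ge>\<^sub>0"
        using gaussian_integral_nu_hat_power[OF assms(1) s, of T k 0] \<open>0 \<le> h\<close>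
        by (intro nonneg_Reals_mult_I) (simp_all only: nonneg_Reals_of_real_iff, simp)
      finally show ?thesis .
    qed
    have "1 = Re (CLINT z|std_normal_distribution. t 0 z)" using N.prob_space by (simp add: t_def)
    also have "\<dots> \<le> (\<Sum>k<m. Re (CLINT z|std_normal_distribution. t k z))"
      using m t_nonneg by (intro member_le_sum[of 0 "{..<m}"]) (auto simp: complex_nonneg_Reals_iff)
    also have "\<dots> = Re (CLINT z|std_normal_distribution. \<Sum>k<m. t k z)"
      using t_int by (simp add: Re_sum)
    finally show "1 \<le> Re (CLINT z|std_normal_distribution. \<Sum>k<m. t k z)" .
  qed
qed

text \<open>The left side is the probability of no jump. Averaging the characteristic function over
  a normal variable of scale \<open>T\<close> gives the expectation of
  \<open>exp (- ((T * Y)\<^sup>2) / 2)\<close>, which tends to the atom as \<open>T\<close> grows;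
  \<open>gaussian_integral_exp_nu_hat\<close> bounds the same average from below for every
  \<open>T\<close>.\<close>

lemma (in prob_space) compound_poisson_zero_prob:
  assumes [measurable]: "Y \<in> borel_measurable M"
    and \<nu>: "finite_measure \<nu>" and s [measurable_cong]: "sets \<nu> = sets borel" and h: "0 \<le> h"
    and ch: "\<And>\<theta>. char (distr M borel Y) \<theta> = exp (- complex_of_real h * (CLINT x|\<nu>. 1 - iexp (c * \<theta> * x)))"
  shows "exp (- h * measure \<nu> UNIV) \<le> prob {w\<in>space M. Y w = 0}"
proof -
  interpret n: finite_measure \<nu> by fact
  interpret N: prob_space std_normal_distribution by simp
  interpret P: finite_measure "std_normal_distribution \<Otimes>\<^sub>M M"
    by (rule finite_measure_pair_measure) unfold_locales
  interpret pair_sigma_finite std_normal_distribution M ..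
  have sp: "space \<nu> = UNIV" using sets_eq_imp_space_eq[OF s] by simp
  have ch': "char (distr M borel Y) \<theta> = complex_of_real (exp (- h * measure \<nu> UNIV)) * exp (complex_of_real h * nu_hat \<nu> (c * \<theta>))" for \<theta>
  proof -
    have "integrable \<nu> (\<lambda>x. iexp (c * \<theta> * x))"
      by (rule n.integrable_const_bound[where B = 1]) (auto simp del: of_real_mult)
    then have e: "(CLINT x|\<nu>. 1 - iexp (c * \<theta> * x)) = complex_of_real (measure \<nu> UNIV) - nu_hat \<nu> (c * \<theta>)"
      unfolding nu_hat_def by (subst Bochner_Integration.integral_diff) (simp_all add: sp scaleR_conv_of_real)
    show ?thesis unfolding ch e exp_of_real[symmetric] exp_add[symmetric] by (simp add: algebra_simps)
  qed
  have lower: "exp (- h * measure \<nu> UNIV) \<le> (\<integral>w. exp (- ((T * Y w)\<^sup>2) / 2) \<partial>M)" for T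
  proof -
    have "(CLINT z|std_normal_distribution. char (distr M borel Y) (T * z)) = (CLINT z|std_normal_distribution. CLINT w|M. iexp (T * z * Y w))"
      by (simp add: char_def integral_distr)
    also have "\<dots> = (CLINT w|M. CLINT z|std_normal_distribution. iexp (T * z * Y w))"
    proof (rule Fubini_integral[symmetric])
      show "integrable (std_normal_distribution \<Otimes>\<^sub>M M) (\<lambda>(z, w). iexp (T * z * Y w))"
        by (rule P.integrable_const_bound[where B = 1]) (auto simp del: of_real_mult)
    qed
    also have "\<dots> = (CLINT w|M. complex_of_real (exp (- ((T * Y w)\<^sup>2) / 2)))"
    proof (rule Bochner_Integration.integral_cong)
      fix w
      have "(CLINT z|std_normal_distribution. iexp (T * z * Y w)) = char std_normal_distribution (T * Y w)"
        by (simp add: char_def mult_ac)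
      then show "(CLINT z|std_normal_distribution. iexp (T * z * Y w)) = complex_of_real (exp (- ((T * Y w)\<^sup>2) / 2))"
        unfolding char_std_normal_distribution .
    qed simp
    also have "\<dots> = complex_of_real (\<integral>w. exp (- ((T * Y w)\<^sup>2) / 2) \<partial>M)"
      by (rule integral_of_real, rule integrable_const_bound[where B = 1]) auto
    finally have e: "(CLINT z|std_normal_distribution. char (distr M borel Y) (T * z)) = complex_of_real (\<integral>w. exp (- ((T * Y w)\<^sup>2) / 2) \<partial>M)" .
    have "(\<integral>w. exp (- ((T * Y w)\<^sup>2) / 2) \<partial>M) = Re (CLINT z|std_normal_distribution. char (distr M borel Y) (T * z))"
      unfolding e Re_complex_of_real by (rule refl)
    also have "\<dots> = exp (- h * measure \<nu> UNIV) * Re (CLINT z|std_normal_distribution. exp (complex_of_real h * nu_hat \<nu> (c * T * z)))"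
      unfolding ch' by (simp add: mult.assoc)
    also have "\<dots> \<ge> exp (- h * measure \<nu> UNIV) * 1"
      by (intro mult_left_mono gaussian_integral_exp_nu_hat \<nu> s h) simp
    finally show ?thesis by simp
  qed
  have "(\<lambda>n. \<integral>w. exp (- ((real n * Y w)\<^sup>2) / 2) \<partial>M) \<longlonglongrightarrow> (\<integral>w. indicator {w\<in>space M. Y w = 0} w \<partial>M)"
  proof (rule integral_dominated_convergence[where w = "\<lambda>_. 1"])
    show "AE w in M. (\<lambda>n. exp (- ((real n * Y w)\<^sup>2) / 2)) \<longlonglongrightarrow> indicator {w\<in>space M. Y w = 0} w"
    proof (rule AE_I2)
      fix w assume w: "w \<in> space M"
      show "(\<lambda>n. exp (- ((real n * Y w)\<^sup>2) / 2)) \<longlonglongrightarrow> indicator {w\<in>space M. Y w = 0} w"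
      proof (cases "Y w = 0")
        case False
        let ?q = "exp (- ((Y w)\<^sup>2) / 2)"
        have "(\<lambda>n. ?q ^ n) \<longlonglongrightarrow> 0" using False by (intro LIMSEQ_power_zero) simp
        then have "(\<lambda>n. exp (- ((real n * Y w)\<^sup>2) / 2)) \<longlonglongrightarrow> 0"
        proof (rule tendsto_sandwich[OF _ _ tendsto_const, rotated 2])
          show "\<forall>\<^sub>F n in sequentially. exp (- ((real n * Y w)\<^sup>2) / 2) \<le> ?q ^ n"
          proof (rule always_eventually, rule allI)
            fix n :: nat
            have "real n \<le> (real n)\<^sup>2" by (cases n) (auto simp: power2_eq_square)
            then have "real n * (Y w)\<^sup>2 \<le> (real n)\<^sup>2 * (Y w)\<^sup>2" by (rule mult_right_mono) simp
            then show "exp (- ((real n * Y w)\<^sup>2) / 2) \<le> ?q ^ n"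
              by (simp add: exp_of_nat_mult[symmetric] power_mult_distrib)
          qed
        qed simp
        with False show ?thesis by simp
      qed (use w in simp)
    qed
  qed (auto simp: prob_space)
  then have "exp (- h * measure \<nu> UNIV) \<le> (\<integral>w. indicator {w\<in>space M. Y w = 0} w \<partial>M)"
    by (rule LIMSEQ_le_const) (use lower in blast)
  then show ?thesis by simp
qed

section \<open>The Lebesgue measure of the set of contact times\<close>

context two_sided_levy_process
begin

text \<open>Probabilities of independent zero increments multiply, and so does the exponential
  bound. The result depends on the total time only and not on the mesh.\<close>

lemma prob_zero_grid:
  assumes "0 < h" and l: "\<And>h. 0 \<le> h \<Longrightarrow> exp (- h * l) \<le> zero_prob h"
  shows "exp (- (real n * h) * l) \<le> prob {w\<in>space M. \<forall>j\<le>n. X (real j * h) w = 0}"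
proof -
  have "exp (- (real n * h) * l) = exp (- h * l) ^ n" by (simp add: exp_of_nat_mult[symmetric] mult.assoc)
  also have "\<dots> \<le> zero_prob h ^ n" using l[of h] \<open>0 < h\<close> by (intro power_mono) auto
  also have "\<dots> = (\<Prod>i<n. prob {w\<in>space M. X (real (Suc i) * h - real i * h) w \<in> {0}})"
    by (simp add: algebra_simps)
  also have "\<dots> = prob {w\<in>space M. \<forall>i<n. X (real (Suc i) * h) w - X (real i * h) w \<in> {0}}"
    using chain_indep[of n "\<lambda>i. real i * h" "space M" "\<lambda>_. {0}"] \<open>0 < h\<close>
    by (simp add: prob_space sets.top[of "past 0", simplified])
  also have "\<dots> \<le> prob {w\<in>space M. \<forall>j\<le>n. X (real j * h) w = 0}"
  proof (rule prob_Collect_mono)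
    fix w assume w: "w \<in> space M" and A: "\<forall>i<n. X (real (Suc i) * h) w - X (real i * h) w \<in> {0}"
    have "X (real j * h) w = 0" if "j \<le> n" for j
      using that
    proof (induction j)
      case (Suc j)
      then show ?case using A by (auto dest!: spec[of _ j])
    qed (use w in \<open>simp add: start_at_zero\<close>)
    then show "\<forall>j\<le>n. X (real j * h) w = 0" by blast
  qed measurable
  finally show ?thesis .
qed

text \<open>The bound of \<open>prob_zero_grid\<close> at time 1 is the same for all dyadic grids;
  as these are nested, it passes to the intersection.\<close>

lemma prob_zero_initially:
  assumes l: "\<And>h. 0 \<le> h \<Longrightarrow> exp (- h * l) \<le> zero_prob h"
  shows "exp (- l) \<le> prob {w\<in>space M. \<forall>k j::nat. real j / 2 ^ k \<le> 1 \<longrightarrow> X (real j / 2 ^ k) w = 0}"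
proof -
  define A where "A i = {w\<in>space M. \<forall>j\<le>2 ^ i. X (real j * (1 / 2 ^ i)) w = 0}" for i :: nat
  have Ae: "A i \<in> events" for i unfolding A_def by measurable
  have "decseq A"
  proof (rule decseq_SucI, rule subsetI)
    fix i w assume A: "w \<in> A (Suc i)"
    have "X (real j * (1 / 2 ^ i)) w = 0" if "j \<le> 2 ^ i" for j
    proof -
      have "X (real (2 * j) * (1 / 2 ^ Suc i)) w = 0" using A that unfolding A_def by (auto simp del: of_nat_mult)
      then show ?thesis by simp
    qed
    then show "w \<in> A i" using A by (simp add: A_def)
  qed
  then have "(\<lambda>i. prob (A i)) \<longlonglongrightarrow> prob (\<Inter>i. A i)"
    using Ae by (intro finite_Lim_measure_decseq) auto
  moreover have "exp (- l) \<le> prob (A i)" for i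
    using prob_zero_grid[of "1 / 2 ^ i" l "2 ^ i"] l by (simp add: A_def)
  ultimately have "exp (- l) \<le> prob (\<Inter>i. A i)" by (intro LIMSEQ_le_const) auto
  also have "(\<Inter>i. A i) \<subseteq> {w\<in>space M. \<forall>k j::nat. real j / 2 ^ k \<le> 1 \<longrightarrow> X (real j / 2 ^ k) w = 0}"
  proof (rule subsetI)
    fix w assume w: "w \<in> (\<Inter>i. A i)"
    have "X (real j / 2 ^ k) w = 0" if "real j / 2 ^ k \<le> 1" for k j :: nat
    proof -
      have "real j \<le> real (2 ^ k)" using that by (simp add: field_simps)
      then have "j \<le> 2 ^ k" by (simp only: of_nat_le_iff)
      moreover have "w \<in> A k" using w by blast
      ultimately have "X (real j * (1 / 2 ^ k)) w = 0" by (auto simp only: A_def)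
      then show ?thesis by simp
    qed
    moreover have "w \<in> space M" using w by (auto simp: A_def)
    ultimately show "w \<in> {w\<in>space M. \<forall>k j::nat. real j / 2 ^ k \<le> 1 \<longrightarrow> X (real j / 2 ^ k) w = 0}" by blast
  qed
  then have "prob (\<Inter>i. A i) \<le> prob {w\<in>space M. \<forall>k j::nat. real j / 2 ^ k \<le> 1 \<longrightarrow> X (real j / 2 ^ k) w = 0}"
    by (rule finite_measure_mono) measurable
  finally show ?thesis .
qed

text \<open>Leaving 0 before time \<open>h = 1 / 2 ^ m\<close> has probability at most
  \<open>\<delta> = 1 - exp (- h * l)\<close>, which is at most \<open>h * l\<close>. After the
  first negative grid value, becoming positive at \<open>h\<close> needs a nonzero further
  increment, which costs a second factor \<delta>.\<close>

lemma prob_negative_then_positive: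
  assumes "0 \<le> l" and l: "\<And>h. 0 \<le> h \<Longrightarrow> exp (- h * l) \<le> zero_prob h"
  shows "prob {w\<in>space M. \<exists>j\<le>2 ^ i. X (real j / 2 ^ (m + i)) w < 0 \<and> 0 < X (1 / 2 ^ m) w} \<le> (l / 2 ^ m)\<^sup>2"
proof -
  define h where "h = 1 / (2 ^ m :: real)"
  define \<delta> where "\<delta> = 1 - exp (- h * l)"
  \<comment> \<open>The cap turns the finite grid on \<open>[0, h]\<close> into an infinite monotone
    sequence, as the first-hit lemmas expect.\<close>
  define u where "u j = real (min j (2 ^ i)) / 2 ^ (m + i)" for j
  have h0: "0 < h" by (simp add: h_def)
  have u: "mono u" "0 \<le> u j" for j by (auto simp: mono_def u_def intro!: divide_right_mono)
  have uh: "u j \<le> h" for j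
  proof -
    have "real (min j (2 ^ i)) \<le> 2 ^ i"
      using of_nat_le_iff[of "min j (2 ^ i)" "2 ^ i", where 'a = real] by simp
    then show ?thesis by (simp add: u_def h_def power_add field_simps)
  qed
  have \<delta>0: "0 \<le> \<delta>" using h0 \<open>0 \<le> l\<close> by (simp add: \<delta>_def)
  let ?S = "\<lambda>j x. x (h - u j) \<noteq> (0::real)"
  have Sm: "{x. ?S j x} \<in> sets paths" for j by (rule sets_paths_Collect) measurable
  have S: "prob {w\<in>space M. ?S j (path_from 0 w)} \<le> \<delta>" for j
  proof -
    have "prob {w\<in>space M. ?S j (path_from 0 w)} = prob {w\<in>space M. \<not> X (h - u j) w = 0}"
      using uh[of j] by (simp add: path_from_0 cong: conj_cong)
    also have "\<dots> = 1 - zero_prob (h - u j)" by (rule prob_neg) measurable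
    also have "\<dots> \<le> 1 - exp (- (h - u j) * l)" using l[of "h - u j"] uh[of j] by simp
    also have "\<dots> \<le> \<delta>" using u(2)[of j] \<open>0 \<le> l\<close> by (simp add: \<delta>_def algebra_simps)
    finally show ?thesis .
  qed
  have hit: "prob {w\<in>space M. \<exists>j. X (u j) w \<in> {..<0}} \<le> \<delta>"
  proof -
    let ?Z = "{w\<in>space M. \<forall>j\<le>2 ^ i. X (real j * (1 / 2 ^ (m + i))) w = 0}"
    have "exp (- h * l) \<le> prob ?Z"
      using prob_zero_grid[of "1 / 2 ^ (m + i)" l "2 ^ i"] l by (simp add: h_def power_add)
    then have "prob (space M - ?Z) \<le> \<delta>" by (simp add: prob_compl \<delta>_def)
    moreover have "{w\<in>space M. \<exists>j. X (u j) w \<in> {..<0}} \<subseteq> space M - ?Z"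
    proof (rule subsetI)
      fix w assume "w \<in> {w\<in>space M. \<exists>j. X (u j) w \<in> {..<0}}"
      then obtain j where j: "w \<in> space M" "X (u j) w < 0" by auto
      have "min j (2 ^ i) \<le> 2 ^ i" "X (real (min j (2 ^ i)) * (1 / 2 ^ (m + i))) w \<noteq> 0"
        using j(2) by (simp_all add: u_def)
      then show "w \<in> space M - ?Z" using j(1) by blast
    qed
    then have "prob {w\<in>space M. \<exists>j. X (u j) w \<in> {..<0}} \<le> prob (space M - ?Z)"
      by (rule finite_measure_mono) measurable
    ultimately show ?thesis by simp
  qed
  have "prob {w\<in>space M. \<exists>j\<le>2 ^ i. X (real j / 2 ^ (m + i)) w < 0 \<and> 0 < X (1 / 2 ^ m) w}
    \<le> prob {w\<in>space M. \<exists>j. X (u j) w \<in> {..<0} \<and> (\<forall>i<j. X (u i) w \<notin> {..<0}) \<and> ?S j (path_from (u j) w)}"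
  proof (rule prob_Collect_mono)
    fix w assume "\<exists>j\<le>2 ^ i. X (real j / 2 ^ (m + i)) w < 0 \<and> 0 < X (1 / 2 ^ m) w"
    then obtain j where j: "j \<le> 2 ^ i" "X (real j / 2 ^ (m + i)) w < 0" "0 < X h w" by (auto simp: h_def)
    then have "X (u j) w \<in> {..<0}" by (simp add: u_def min_def)
    then obtain j' where j': "X (u j') w \<in> {..<0}" "\<forall>i<j'. X (u i) w \<notin> {..<0}"
      using exists_least_iff[of "\<lambda>j. X (u j) w \<in> {..<0}"] by blast
    moreover have "?S j' (path_from (u j') w)" using j' j(3) uh[of j'] by (simp add: path_from_def)
    ultimately show "\<exists>j. X (u j) w \<in> {..<0} \<and> (\<forall>i<j. X (u i) w \<notin> {..<0}) \<and> ?S j (path_from (u j) w)"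
      by blast
  qed (unfold path_from_def, measurable)
  also have "\<dots> \<le> \<delta> * prob {w\<in>space M. \<exists>j. X (u j) w \<in> {..<0}}"
    by (rule first_hit_upper[OF u(1) _ Sm S]) simp
  also have "\<dots> \<le> \<delta> * \<delta>" using hit \<delta>0 by (intro mult_left_mono)
  also have "\<dots> \<le> (h * l) * (h * l)"
  proof (rule mult_mono)
    show "\<delta> \<le> h * l" "\<delta> \<le> h * l" using exp_ge_add_one_self[of "- h * l"] by (auto simp: \<delta>_def)
  qed (use \<delta>0 h0 \<open>0 \<le> l\<close> in auto)
  finally show ?thesis by (simp add: h_def power2_eq_square)
qed

text \<open>Up to time \<open>h\<close> the process becomes positive with probability of order \<open>h\<close>, whereas it takes two jumps to
  become positive after having been negative.\<close>

lemma prob_nonneg_pos_of_zero_prob: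
  assumes "integrable M (X 1)" "0 < (\<integral>w. X 1 w \<partial>M)"
    and "0 \<le> l" and l: "\<And>h. 0 \<le> h \<Longrightarrow> exp (- h * l) \<le> zero_prob h"
  shows "0 < prob {w\<in>space M. \<forall>k j::nat. 0 \<le> X (real j / 2 ^ k) w}"
proof -
  define \<kappa> where "\<kappa> = prob {w\<in>space M. 0 < X 1 w}"
  have \<kappa>: "0 < \<kappa>"
  proof (rule ccontr)
    assume "\<not> 0 < \<kappa>"
    then have "\<kappa> = 0" by (simp add: \<kappa>_def zero_less_measure_iff)
    then have "AE w in M. \<not> 0 < X 1 w" unfolding \<kappa>_def by (subst (asm) prob_eq_0) auto
    then have "AE w in M. X 1 w \<le> 0" by eventually_elim simp
    then have "(\<integral>w. X 1 w \<partial>M) \<le> (\<integral>w. 0 \<partial>M)" using assms(1) by (intro integral_mono_AE) auto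
    with assms(2) show False by simp
  qed
  \<comment> \<open>The estimates to be compared are \<open>\<kappa> / 2 ^ m\<close> and
    \<open>(l / 2 ^ m)\<^sup>2\<close>; this \<open>m\<close> makes the first one larger.\<close>
  obtain m :: nat where m: "(1/2) ^ m * l\<^sup>2 < \<kappa>"
  proof -
    have "(\<lambda>m. (1/2) ^ m * l\<^sup>2) \<longlonglongrightarrow> 0 * l\<^sup>2" by (intro tendsto_intros LIMSEQ_power_zero) auto
    then have "\<forall>\<^sub>F m in sequentially. (1/2) ^ m * l\<^sup>2 < \<kappa>" using \<kappa> by (intro order_tendstoD) auto
    then show ?thesis using that by (auto simp: eventually_sequentially)
  qed
  let ?h = "1 / (2 ^ m :: real)"
  have up: "\<kappa> \<le> 2 ^ m * prob {w\<in>space M. 0 < X ?h w}"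
  proof -
    let ?I = "\<lambda>j. {w\<in>space M. 0 < path_from (real j * ?h) w ?h}"
    have Iev: "?I j \<in> events" for j unfolding path_from_def by measurable
    \<comment> \<open>If none of the \<open>2 ^ m\<close> increments is positive, neither is their
      sum \<open>X 1\<close>; the union bound then gives the factor \<open>2 ^ m\<close>.\<close>
    have "{w\<in>space M. 0 < X 1 w} \<subseteq> (\<Union>j\<in>{..<2 ^ m}. ?I j)"
    proof (rule subsetI, rule ccontr)
      fix w assume w: "w \<in> {w\<in>space M. 0 < X 1 w}" and n: "w \<notin> (\<Union>j\<in>{..<2 ^ m}. ?I j)"
      have "X (real j * ?h) w \<le> 0" if "j \<le> 2 ^ m" for j
        using that
      proof (induction j)
        case (Suc j)
        then have "path_from (real j * ?h) w ?h \<le> 0" using n w by (auto simp: not_less)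
        then have "X (real j * ?h + ?h) w \<le> X (real j * ?h) w" by (simp add: path_from_def)
        moreover have "real j * ?h + ?h = real (Suc j) * ?h" by (simp add: field_simps)
        ultimately show ?case using Suc by simp
      qed (use w in \<open>simp add: start_at_zero\<close>)
      from this[of "2 ^ m"] w show False by simp
    qed
    then have "\<kappa> \<le> prob (\<Union>j\<in>{..<2 ^ m}. ?I j)" unfolding \<kappa>_def using Iev by (intro finite_measure_mono) auto
    also have "\<dots> \<le> (\<Sum>j\<in>{..<2 ^ m}. prob (?I j))" using Iev by (intro finite_measure_subadditive_finite) auto
    also have "\<dots> = (\<Sum>j\<in>{..<2 ^ m::nat}. prob {w\<in>space M. 0 < X ?h w})"
    proof (rule sum.cong[OF refl])
      fix j
      have "prob (?I j) = prob {w\<in>space M. 0 < path_from 0 w ?h}"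
        by (rule path_from_law, rule sets_paths_Collect) measurable
      also have "\<dots> = prob {w\<in>space M. 0 < X ?h w}" by (simp add: path_from_0 cong: conj_cong)
      finally show "prob (?I j) = prob {w\<in>space M. 0 < X ?h w}" .
    qed
    finally show ?thesis by simp
  qed
  define B where "B i = {w\<in>space M. \<exists>j\<le>2 ^ i. X (real j / 2 ^ (m + i)) w < 0 \<and> 0 < X ?h w}" for i :: nat
  have Bev: "B i \<in> events" for i unfolding B_def by measurable
  have "incseq B"
  proof (rule incseq_SucI, rule subsetI)
    fix i w assume "w \<in> B i"
    then obtain j where j: "w \<in> space M" "j \<le> 2 ^ i" "X (real j / 2 ^ (m + i)) w < 0" "0 < X ?h w" by (auto simp: B_def)
    then show "w \<in> B (Suc i)" unfolding B_def by (auto intro!: exI[of _ "2 * j"])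
  qed
  then have "(\<lambda>i. prob (B i)) \<longlonglongrightarrow> prob (\<Union>i. B i)" using Bev by (intro finite_Lim_measure_incseq) auto
  moreover have "prob (B i) \<le> (l / 2 ^ m)\<^sup>2" for i
    unfolding B_def by (rule prob_negative_then_positive[OF \<open>0 \<le> l\<close> l])
  ultimately have B: "prob (\<Union>i. B i) \<le> (l / 2 ^ m)\<^sup>2" by (intro LIMSEQ_le_const2) auto
  let ?G = "{w\<in>space M. (\<forall>k j::nat. real j / 2 ^ k \<le> ?h \<longrightarrow> 0 \<le> X (real j / 2 ^ k) w) \<and> 0 < X ?h w}"
  have "{w\<in>space M. 0 < X ?h w} \<subseteq> ?G \<union> (\<Union>i. B i)"
  proof (rule subsetI)
    fix w assume w: "w \<in> {w\<in>space M. 0 < X ?h w}"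
    show "w \<in> ?G \<union> (\<Union>i. B i)"
    proof (cases "w \<in> ?G")
      case False
      then obtain k j :: nat where kj: "real j / 2 ^ k \<le> ?h" "X (real j / 2 ^ k) w < 0" using w by (auto simp: not_le)
      have "real (j * 2 ^ m) \<le> real (2 ^ k)" using kj(1) by (simp add: field_simps)
      then have "j * 2 ^ m \<le> 2 ^ k" by (simp only: of_nat_le_iff)
      moreover have "real (j * 2 ^ m) / 2 ^ (m + k) = real j / 2 ^ k" by (simp add: power_add)
      ultimately have "w \<in> B k" using kj(2) w unfolding B_def by (auto intro!: exI[of _ "j * 2 ^ m"])
      then show ?thesis by blast
    qed blast
  qed
  then have "prob {w\<in>space M. 0 < X ?h w} \<le> prob (?G \<union> (\<Union>i. B i))"
    using Bev by (intro finite_measure_mono) auto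
  also have "\<dots> \<le> prob ?G + prob (\<Union>i. B i)"
    using Bev by (intro measure_Un_le) auto
  finally have le: "\<kappa> \<le> 2 ^ m * (prob ?G + (l / 2 ^ m)\<^sup>2)"
    using B up by (smt (verit) mult_left_mono zero_le_power)
  have "0 < prob ?G"
  proof (rule ccontr)
    assume "\<not> 0 < prob ?G"
    then have "prob ?G = 0" by (simp only: zero_less_measure_iff simp_thms)
    with le have "\<kappa> \<le> (1/2) ^ m * l\<^sup>2" by (simp add: power2_eq_square power_divide field_simps)
    with m show False by simp
  qed
  then show ?thesis by (intro prob_nonneg_pos[OF assms(1,2), of ?h]) auto
qed

text \<open>Dyadic displacements suffice by right continuity; the predicate \<open>P\<close> restricts their size, which makes contact
  at distant times independent.\<close>

definition local_contact :: "real \<Rightarrow> (real \<Rightarrow> bool) \<Rightarrow> real \<Rightarrow> 'a \<Rightarrow> bool" where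
  "local_contact \<alpha> P t w \<longleftrightarrow> (\<forall>k j::nat. P (real j / 2 ^ k) \<longrightarrow>
     0 \<le> X (t + real j / 2 ^ k) w - X t w + \<alpha> * (real j / 2 ^ k) \<and>
     0 \<le> X (t - real j / 2 ^ k) w - X t w + \<alpha> * (real j / 2 ^ k))"

lemma local_contact_measurable [measurable]:
  "Measurable.pred (borel \<Otimes>\<^sub>M M) (\<lambda>x. local_contact \<alpha> P (fst x) (snd x))"
  unfolding local_contact_def by measurable

lemma local_contact_borel:
  assumes w: "w \<in> space M"
  shows "{t. local_contact \<alpha> P t w} \<in> sets borel"
proof -
  have [measurable]: "(\<lambda>t. X (t + c) w) \<in> borel_measurable borel" "(\<lambda>t. X (t - c) w) \<in> borel_measurable borel"
    "(\<lambda>t. X t w) \<in> borel_measurable borel" for c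
    using w by measurable
  have "{t\<in>space borel. local_contact \<alpha> P t w} \<in> sets borel" unfolding local_contact_def by measurable
  then show ?thesis by simp
qed

lemma local_contact_event [measurable]: "Measurable.pred M (local_contact \<alpha> P t)"
  unfolding local_contact_def by measurable

text \<open>Both factors concern the process run forward from 0. The second one stands for the
  condition on the past of a contact time, by time reversal.\<close>

definition contact_prob :: "real \<Rightarrow> (real \<Rightarrow> bool) \<Rightarrow> real" where
  "contact_prob \<alpha> P = prob {w\<in>space M. \<forall>k j::nat. P (real j / 2 ^ k) \<longrightarrow> 0 \<le> X (real j / 2 ^ k) w + \<alpha> * (real j / 2 ^ k)} *
     prob {w\<in>space M. \<forall>k j::nat. P (real j / 2 ^ k) \<longrightarrow> 0 \<le> - X (real j / 2 ^ k) w + \<alpha> * (real j / 2 ^ k)}"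

text \<open>The condition to the left of \<open>t\<close> is an event of \<open>past t\<close> about
  \<open>path_to t\<close>, the condition to the right concerns \<open>path_from t\<close>; so
  \<open>markov\<close> and \<open>path_to_law\<close> give the product.\<close>

lemma prob_local_contact: "prob {w\<in>space M. local_contact \<alpha> P t w} = contact_prob \<alpha> P"
proof -
  define A where "A = {w\<in>space M. \<forall>k j::nat. P (real j / 2 ^ k) \<longrightarrow> 0 \<le> - path_to t w (real j / 2 ^ k) + \<alpha> * (real j / 2 ^ k)}"
  have "A \<in> sets (past t)"
  proof -
    have [measurable]: "X (t - real j / 2 ^ k) \<in> borel_measurable (past t)" for k j :: nat by (rule measurable_past) simp
    have [measurable]: "X t \<in> borel_measurable (past t)" by (rule measurable_past) simp
    have "A = {w\<in>space (past t). \<forall>k j::nat. P (real j / 2 ^ k) \<longrightarrow> 0 \<le> - (X t w - X (t - real j / 2 ^ k) w) + \<alpha> * (real j / 2 ^ k)}"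
      by (simp add: A_def path_to_def)
    also have "\<dots> \<in> sets (past t)" by measurable
    finally show ?thesis .
  qed
  note Am = this
  let ?S = "\<lambda>x::real \<Rightarrow> real. \<forall>k j::nat. P (real j / 2 ^ k) \<longrightarrow> 0 \<le> x (real j / 2 ^ k) + \<alpha> * (real j / 2 ^ k)"
  let ?S' = "\<lambda>x::real \<Rightarrow> real. \<forall>k j::nat. P (real j / 2 ^ k) \<longrightarrow> 0 \<le> - x (real j / 2 ^ k) + \<alpha> * (real j / 2 ^ k)"
  have Sm: "{x. ?S x} \<in> sets paths" "{x. ?S' x} \<in> sets paths"
    by (rule sets_paths_Collect, measurable)+
  have "{w\<in>space M. local_contact \<alpha> P t w} = {w\<in>A. ?S (path_from t w)}"
    by (auto simp: A_def local_contact_def path_from_def path_to_def)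
  then have "prob {w\<in>space M. local_contact \<alpha> P t w} = prob A * prob {w\<in>space M. ?S (path_from 0 w)}"
    using markov[OF Am Sm(1)] by simp
  also have "prob A = prob {w\<in>space M. ?S' (path_from 0 w)}"
    unfolding A_def by (rule path_to_law[OF Sm(2)])
  finally show ?thesis by (simp add: contact_prob_def path_from_0 mult.commute cong: conj_cong)
qed

text \<open>With displacements at most \<open>K\<close>, contact at \<open>s\<close> is decided by
  time \<open>s + K\<close>, and contact at \<open>t\<close> depends only on increments after
  \<open>t - K\<close>. The two windows meet at most at an endpoint.\<close>

lemma local_contact_indep:
  assumes P: "\<And>q. P q \<Longrightarrow> q \<le> K" and "0 \<le> K" "s + 2 * K \<le> t"
  shows "prob {w\<in>space M. local_contact \<alpha> P s w \<and> local_contact \<alpha> P t w} = contact_prob \<alpha> P * contact_prob \<alpha> P"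
proof -
  \<comment> \<open>\<open>r\<close> separates the windows. Seen from \<open>r\<close>, the time
    \<open>t\<close> has position \<open>K\<close>, so contact at \<open>t\<close> is a condition on
    \<open>path_from r\<close> around that position.\<close>
  define r where "r = t - K"
  let ?S = "\<lambda>x::real \<Rightarrow> real. \<forall>k j::nat. P (real j / 2 ^ k) \<longrightarrow>
     0 \<le> x (K + real j / 2 ^ k) - x K + \<alpha> * (real j / 2 ^ k) \<and> 0 \<le> x (K - real j / 2 ^ k) - x K + \<alpha> * (real j / 2 ^ k)"
  have Sm: "{x. ?S x} \<in> sets paths" by (rule sets_paths_Collect) measurable
  have S: "local_contact \<alpha> P t w \<longleftrightarrow> ?S (path_from r w)" for w
  proof -
    have *: "r + \<bar>K\<bar> = t" "r + \<bar>K + real j / 2 ^ k\<bar> = t + real j / 2 ^ k" for j k :: nat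
      using \<open>0 \<le> K\<close> by (auto simp: r_def)
    have **: "r + \<bar>K - real j / 2 ^ k\<bar> = t - real j / 2 ^ k" if "P (real j / 2 ^ k)" for j k :: nat
      using P[OF that] by (auto simp: r_def)
    have "path_from r w (K + real j / 2 ^ k) - path_from r w K = X (t + real j / 2 ^ k) w - X t w" for j k :: nat
      unfolding path_from_def * by simp
    moreover have "path_from r w (K - real j / 2 ^ k) - path_from r w K = X (t - real j / 2 ^ k) w - X t w"
      if "P (real j / 2 ^ k)" for j k :: nat
      unfolding path_from_def * **[OF that] by simp
    ultimately show ?thesis unfolding local_contact_def by simp
  qed
  have A: "{w\<in>space M. local_contact \<alpha> P s w} \<in> sets (past r)"
  proof -
    have [measurable]: "X (min u r) \<in> borel_measurable (past r)" for u by (rule measurable_past) simp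
    have m: "s \<le> r" "s - real j / 2 ^ k \<le> r" for j k :: nat
    proof -
      show "s \<le> r" using assms(2,3) by (simp add: r_def)
      then show "s - real j / 2 ^ k \<le> r" by (rule order_trans[rotated]) simp
    qed
    have m': "s + real j / 2 ^ k \<le> r" if "P (real j / 2 ^ k)" for j k :: nat
      using P[OF that] assms(3) by (simp add: r_def)
    have "{w\<in>space M. local_contact \<alpha> P s w} = {w\<in>space (past r). \<forall>k j::nat. P (real j / 2 ^ k) \<longrightarrow>
     0 \<le> X (min (s + real j / 2 ^ k) r) w - X (min s r) w + \<alpha> * (real j / 2 ^ k) \<and>
     0 \<le> X (min (s - real j / 2 ^ k) r) w - X (min s r) w + \<alpha> * (real j / 2 ^ k)}"
      using m m' by (simp add: local_contact_def min_absorb1)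
    also have "\<dots> \<in> sets (past r)" by measurable
    finally show ?thesis .
  qed
  have "{w\<in>space M. local_contact \<alpha> P s w \<and> local_contact \<alpha> P t w} = {w\<in>{w\<in>space M. local_contact \<alpha> P s w}. ?S (path_from r w)}"
    using S by blast
  then have "prob {w\<in>space M. local_contact \<alpha> P s w \<and> local_contact \<alpha> P t w}
     = prob {w\<in>space M. local_contact \<alpha> P s w} * prob {w\<in>space M. ?S (path_from 0 w)}"
    using markov[OF A Sm] by simp
  also have "prob {w\<in>space M. ?S (path_from 0 w)} = prob {w\<in>space M. ?S (path_from r w)}"
    by (rule path_from_law[OF Sm, symmetric])
  also have "\<dots> = prob {w\<in>space M. local_contact \<alpha> P t w}" using S by simp
  finally show ?thesis by (simp add: prob_local_contact)
qed

end

text \<open>The count has variance at most \<open>N\<close>, and \<open>2 * \<bar>y\<bar> \<le> y\<^sup>2 / sqrt N + sqrt N\<close>.\<close>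

lemma (in prob_space) pairwise_indep_count:
  fixes E :: "nat \<Rightarrow> 'a set"
  assumes E: "\<And>i. E i \<in> events" and p: "\<And>i. prob (E i) = p"
    and indep: "\<And>i j. i < j \<Longrightarrow> prob (E i \<inter> E j) = p * p" and N: "0 < N"
  shows "(\<integral>w. \<bar>(\<Sum>i<N. indicator (E i) w) - real N * p\<bar> \<partial>M) \<le> sqrt (real N)"
proof -
  define f where "f i w = indicator (E i) w - p" for i w
  have [measurable]: "E i \<in> events" for i by (rule E)
  have p01: "0 \<le> p" "p \<le> 1" using p[of 0] by (auto simp: p[of 0, symmetric])
  have fb: "\<bar>f i w\<bar> \<le> 1" for i w using p01 by (auto simp: f_def indicator_def)
  have ff: "\<bar>f i w * f j w\<bar> \<le> 1" for i j w
    using mult_mono[OF fb[of i w] fb[of j w]] by (simp add: abs_mult)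
  have fm [measurable]: "f i \<in> borel_measurable M" for i unfolding f_def[abs_def] by measurable
  have int: "integrable M (\<lambda>w. f i w * f j w)" for i j
    by (rule integrable_const_bound[where B = 1]) (use ff in auto)
  have cov: "(\<integral>w. f i w * f j w \<partial>M) = 0" if "i \<noteq> j" for i j
  proof -
    have pp: "prob (E i \<inter> E j) = p * p" using indep[of i j] indep[of j i] that by (cases "i < j") (auto simp: Int_commute)
    have "f i w * f j w = indicator (E i \<inter> E j) w - p * indicator (E i) w - p * indicator (E j) w + p * p" for w
      by (simp add: f_def indicator_def algebra_simps)
    then have "(\<integral>w. f i w * f j w \<partial>M) = (\<integral>w. indicator (E i \<inter> E j) w - p * indicator (E i) w - p * indicator (E j) w + p * p \<partial>M)"
      by simp
    also have "\<dots> = p * p - p * p - p * p + p * p"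
      by (simp add: emeasure_eq_measure p pp prob_space)
    finally show ?thesis by simp
  qed
  define Y where "Y w = (\<Sum>i<N. f i w)" for w
  have Ym [measurable]: "Y \<in> borel_measurable M" unfolding Y_def[abs_def] by measurable
  have Yb: "\<bar>Y w\<bar> \<le> real N" for w
    unfolding Y_def using sum_bounded_above[of "{..<N}" "\<lambda>i. \<bar>f i w\<bar>" 1] fb by (intro order_trans[OF sum_abs]) simp
  have Y1: "integrable M (\<lambda>w. \<bar>Y w\<bar>)" by (rule integrable_const_bound[where B = "real N"]) (use Yb in auto)
  have Y2: "integrable M (\<lambda>w. (Y w)\<^sup>2)"
    by (rule integrable_const_bound[where B = "(real N)\<^sup>2"]) (use Yb in \<open>auto simp: abs_le_square_iff[symmetric]\<close>)
  have "(\<integral>w. (Y w)\<^sup>2 \<partial>M) = (\<integral>w. (\<Sum>i<N. \<Sum>j<N. f i w * f j w) \<partial>M)"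
    by (simp add: Y_def power2_eq_square sum_product)
  also have "\<dots> = (\<Sum>i<N. \<Sum>j<N. \<integral>w. f i w * f j w \<partial>M)" using int by simp
  also have "\<dots> = (\<Sum>i<N. \<integral>w. f i w * f i w \<partial>M)"
  proof (rule sum.cong[OF refl])
    fix i assume "i \<in> {..<N}"
    then have "(\<Sum>j<N. \<integral>w. f i w * f j w \<partial>M) = (\<Sum>j\<in>{i}. \<integral>w. f i w * f j w \<partial>M)"
      by (intro sum.mono_neutral_right) (auto simp: cov)
    then show "(\<Sum>j<N. \<integral>w. f i w * f j w \<partial>M) = (\<integral>w. f i w * f i w \<partial>M)" by simp
  qed
  also have "\<dots> \<le> (\<Sum>i<N. 1)"
  proof (rule sum_mono)
    fix i
    have "(\<integral>w. f i w * f i w \<partial>M) \<le> (\<integral>w. 1 \<partial>M)"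
      by (rule integral_mono[OF int]) (use ff[of i _ i] in \<open>auto simp: abs_le_iff\<close>)
    then show "(\<integral>w. f i w * f i w \<partial>M) \<le> 1" by (simp add: prob_space)
  qed
  finally have var: "(\<integral>w. (Y w)\<^sup>2 \<partial>M) \<le> real N" by simp
  have N': "0 < sqrt (real N)" using N by simp
  have "(\<integral>w. \<bar>Y w\<bar> \<partial>M) \<le> (\<integral>w. ((Y w)\<^sup>2 / sqrt (real N) + sqrt (real N)) / 2 \<partial>M)"
  proof (rule integral_mono)
    show "integrable M (\<lambda>w. ((Y w)\<^sup>2 / sqrt (real N) + sqrt (real N)) / 2)" using Y2 by simp
    fix w
    have "0 \<le> (\<bar>Y w\<bar> - sqrt (real N))\<^sup>2" by simp
    then have "2 * \<bar>Y w\<bar> * sqrt (real N) \<le> (Y w)\<^sup>2 + sqrt (real N) * sqrt (real N)"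
      by (simp add: power2_diff algebra_simps power2_eq_square)
    then show "\<bar>Y w\<bar> \<le> ((Y w)\<^sup>2 / sqrt (real N) + sqrt (real N)) / 2"
      using N' by (simp add: field_simps)
  qed (rule Y1)
  also have "\<dots> = ((\<integral>w. (Y w)\<^sup>2 \<partial>M) / sqrt (real N) + sqrt (real N)) / 2" using Y2 by (simp add: prob_space)
  also have "\<dots> \<le> (real N / sqrt (real N) + sqrt (real N)) / 2" using var N' by (simp add: divide_right_mono)
  also have "\<dots> = sqrt (real N)" by (simp add: real_div_sqrt)
  finally show ?thesis by (simp add: Y_def f_def sum_subtractf)
qed

section \<open>Contacts at distant times\<close>

context two_sided_levy_process
begin

abbreviation "contact \<alpha> \<equiv> local_contact \<alpha> (\<lambda>_. True)"

lemma LIMSEQ_contact_prob: "(\<lambda>n. contact_prob \<alpha> (\<lambda>q. q \<le> real n)) \<longlonglongrightarrow> contact_prob \<alpha> (\<lambda>_. True)"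
proof -
  let ?A = "\<lambda>n::nat. {w\<in>space M. local_contact \<alpha> (\<lambda>q. q \<le> real n) 0 w}"
  have "decseq ?A" by (rule decseq_SucI) (fastforce simp: local_contact_def)
  moreover have "(\<Inter>n. ?A n) = {w\<in>space M. contact \<alpha> 0 w}"
  proof (intro equalityI subsetI)
    fix w assume w: "w \<in> (\<Inter>n. ?A n)"
    have "0 \<le> X (0 + real j / 2 ^ k) w - X 0 w + \<alpha> * (real j / 2 ^ k) \<and> 0 \<le> X (0 - real j / 2 ^ k) w - X 0 w + \<alpha> * (real j / 2 ^ k)" for j k :: nat
    proof -
      obtain n :: nat where "real j / 2 ^ k \<le> real n" using real_arch_simple by blast
      moreover have "local_contact \<alpha> (\<lambda>q. q \<le> real n) 0 w" using w by blast
      ultimately show ?thesis unfolding local_contact_def by blast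
    qed
    then show "w \<in> {w\<in>space M. contact \<alpha> 0 w}" using w by (auto simp: local_contact_def)
  qed (auto simp: local_contact_def)
  ultimately have "(\<lambda>n. prob (?A n)) \<longlonglongrightarrow> prob {w\<in>space M. contact \<alpha> 0 w}"
    using finite_Lim_measure_decseq[of ?A] by (simp add: image_subset_iff)
  then show ?thesis by (simp add: prob_local_contact)
qed

text \<open>At times spaced by \<open>2 * K\<close>, contacts of window \<open>K\<close> are
  pairwise independent, so their count among \<open>N\<close> deviates from \<open>N * ?pK\<close>
  by at most \<open>sqrt N\<close> in mean. Full contacts are fewer by \<open>N * (?pK - ?p)\<close>
  in mean, and on \<open>?F\<close> there are at most \<open>m\<close> of them. Dividing by
  \<open>N\<close> and letting \<open>N\<close> grow gives the bound.\<close>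

lemma contact_count_bound:
  assumes K: "1 \<le> K"
  shows "contact_prob \<alpha> (\<lambda>q. q \<le> real K) * prob {w\<in>space M. \<forall>N. (\<Sum>i<N. indicator {w. contact \<alpha> (t + real i) w} w :: real) \<le> real m}
    \<le> contact_prob \<alpha> (\<lambda>q. q \<le> real K) - contact_prob \<alpha> (\<lambda>_. True)"
    (is "?pK * prob ?F \<le> ?pK - ?p")
proof -
  let ?PK = "\<lambda>q. q \<le> real K"
  define E where "E j = {w\<in>space M. local_contact \<alpha> ?PK (t + 2 * real K * real j) w}" for j :: nat
  define C where "C j = {w\<in>space M. contact \<alpha> (t + 2 * real K * real j) w}" for j :: nat
  have ev [measurable]: "E j \<in> events" "C j \<in> events" for j unfolding E_def C_def by measurable
  have im: "(\<lambda>w. indicator {w. contact \<alpha> (t + real i) w} w :: real) \<in> borel_measurable M" for i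
    by (rule borel_measurable_indicator_Collect) measurable
  have Fm [measurable]: "?F \<in> events" using im by measurable
  have CE: "C j \<subseteq> E j" for j by (auto simp: C_def E_def local_contact_def)
  have pE: "prob (E j) = ?pK" and pC: "prob (C j) = ?p" for j
    unfolding E_def C_def by (rule prob_local_contact)+
  have indep: "prob (E i \<inter> E j) = ?pK * ?pK" if "i < j" for i j
  proof -
    have "E i \<inter> E j = {w\<in>space M. local_contact \<alpha> ?PK (t + 2 * real K * real i) w \<and> local_contact \<alpha> ?PK (t + 2 * real K * real j) w}"
      by (auto simp: E_def)
    moreover have "t + 2 * real K * real i + 2 * real K \<le> t + 2 * real K * real j"
    proof -
      have "2 * real K * (real i + 1) \<le> 2 * real K * real j" using that by (intro mult_left_mono) auto
      then show ?thesis by (simp add: algebra_simps)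
    qed
    ultimately show ?thesis using local_contact_indep[of ?PK "real K" "t + 2 * real K * real i" "t + 2 * real K * real j" \<alpha>] by simp
  qed
  have step: "?pK * prob ?F \<le> inverse (sqrt (real (Suc n))) + (?pK - ?p) + real m * inverse (real (Suc n))" for n
  proof -
    let ?N = "Suc n"
    let ?T = "\<lambda>w. (\<Sum>i<?N. indicator (E i) w) :: real" and ?S = "\<lambda>w. (\<Sum>i<?N. indicator (C i) w) :: real"
    have S: "?S w \<le> real m" if "w \<in> ?F" for w
    proof -
      \<comment> \<open>As \<open>K\<close> is a positive integer, the spaced times are distinct
        members of the sequence \<open>t + i\<close>.\<close>
      have "?S w = (\<Sum>i\<in>(\<lambda>i. 2 * K * i) ` {..<?N}. indicator {w. contact \<alpha> (t + real i) w} w)"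
        using K that by (subst sum.reindex) (auto simp: inj_on_def C_def indicator_def intro!: sum.cong)
      also have "\<dots> \<le> (\<Sum>i<2 * K * ?N. indicator {w. contact \<alpha> (t + real i) w} w)"
      proof (rule sum_mono2)
        show "(\<lambda>i. 2 * K * i) ` {..<?N} \<subseteq> {..<2 * K * ?N}"
          using K by (auto simp del: mult_Suc_right intro!: mult_strict_left_mono)
      qed auto
      also have "\<dots> \<le> real m" using that by blast
      finally show ?thesis .
    qed
    have b: "\<bar>?T w\<bar> \<le> real ?N" for w
      using sum_bounded_above[of "{..<?N}" "\<lambda>i. indicator (E i) w :: real" 1]
      by (simp del: sum.lessThan_Suc add: sum_nonneg)
    have intT: "integrable M ?T" by (rule integrable_const_bound[where B = "real ?N"]) (use b in \<open>auto simp del: sum.lessThan_Suc\<close>)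
    have intD: "integrable M (\<lambda>w. \<bar>?T w - real ?N * ?pK\<bar>)"
      by (intro integrable_abs Bochner_Integration.integrable_diff intT integrable_const)
    have intS: "integrable M ?S" by (intro Bochner_Integration.integrable_sum) (auto simp: emeasure_eq_measure)
    have "real ?N * ?pK * prob ?F = (\<integral>w. real ?N * ?pK * indicator ?F w \<partial>M)" by simp
    also have "\<dots> \<le> (\<integral>w. \<bar>?T w - real ?N * ?pK\<bar> + (?T w - ?S w) + real m \<partial>M)"
    proof (rule integral_mono)
      show "integrable M (\<lambda>w. real ?N * ?pK * indicator ?F w)" by (auto simp: emeasure_eq_measure)
      show "integrable M (\<lambda>w. \<bar>?T w - real ?N * ?pK\<bar> + (?T w - ?S w) + real m)"
        by (intro Bochner_Integration.integrable_add intD Bochner_Integration.integrable_diff intT intS integrable_const)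
      fix w
      have TS: "?S w \<le> ?T w" using CE by (intro sum_mono) (auto simp: indicator_def)
      \<comment> \<open>On \<open>?F\<close>, split \<open>N * ?pK\<close> through the counts
        \<open>?T\<close> and \<open>?S\<close> and use that \<open>?S\<close> is at most
        \<open>m\<close>; off \<open>?F\<close> every term on the right is nonnegative.\<close>
      show "real ?N * ?pK * indicator ?F w \<le> \<bar>?T w - real ?N * ?pK\<bar> + (?T w - ?S w) + real m"
      proof (cases "w \<in> ?F")
        case True
        then have "real ?N * ?pK * indicator ?F w = real ?N * ?pK" by simp
        then show ?thesis using S[OF True] abs_ge_minus_self[of "?T w - real ?N * ?pK"] by linarith
      next
        case False
        then have "real ?N * ?pK * indicator ?F w = 0" by simp
        then show ?thesis using TS by linarith
      qed
    qed
    also have "\<dots> = (\<integral>w. \<bar>?T w - real ?N * ?pK\<bar> \<partial>M) + ((\<integral>w. ?T w \<partial>M) - (\<integral>w. ?S w \<partial>M)) + real m"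
      using intD intT intS by (simp del: sum.lessThan_Suc add: prob_space)
    also have "(\<integral>w. ?T w \<partial>M) = real ?N * ?pK"
      by (subst Bochner_Integration.integral_sum) (auto simp: emeasure_eq_measure pE simp del: sum.lessThan_Suc)
    also have "(\<integral>w. ?S w \<partial>M) = real ?N * ?p"
      by (subst Bochner_Integration.integral_sum) (auto simp: emeasure_eq_measure pC simp del: sum.lessThan_Suc)
    also have "(\<integral>w. \<bar>?T w - real ?N * ?pK\<bar> \<partial>M) \<le> sqrt (real ?N)"
      by (rule pairwise_indep_count) (auto simp: pE indep)
    finally have le: "real ?N * ?pK * prob ?F \<le> sqrt (real ?N) + (real ?N * ?pK - real ?N * ?p) + real m" by simp
    have "?pK * prob ?F = inverse (real ?N) * (real ?N * ?pK * prob ?F)" by (simp del: of_nat_Suc)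
    also have "\<dots> \<le> inverse (real ?N) * (sqrt (real ?N) + (real ?N * ?pK - real ?N * ?p) + real m)"
      using le by (rule mult_left_mono) simp
    also have "\<dots> = inverse (sqrt (real ?N)) + (?pK - ?p) + real m * inverse (real ?N)"
    proof -
      have "inverse (real ?N) * sqrt (real ?N) = inverse (sqrt (real ?N))"
        by (metis divide_inverse mult.commute real_div_sqrt inverse_eq_divide divide_divide_eq_right of_nat_0_le_iff sqrt_divide_self_eq inverse_inverse_eq)
      moreover have "inverse (real ?N) * (sqrt (real ?N) + (real ?N * ?pK - real ?N * ?p) + real m)
        = inverse (real ?N) * sqrt (real ?N) + (inverse (real ?N) * real ?N) * (?pK - ?p) + real m * inverse (real ?N)"
        by (simp only: algebra_simps)
      ultimately show ?thesis by (simp del: of_nat_Suc)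
    qed
    finally show ?thesis .
  qed
  have "(\<lambda>n. inverse (sqrt (real (Suc n))) + (?pK - ?p) + real m * inverse (real (Suc n))) \<longlonglongrightarrow> sqrt 0 + (?pK - ?p) + real m * 0"
    unfolding real_sqrt_inverse[symmetric] by (intro tendsto_intros LIMSEQ_inverse_real_of_nat)
  then show ?thesis using step by (intro LIMSEQ_le_const[of _ "?pK - ?p"]) auto
qed

text \<open>As the window grows, the right side of \<open>contact_count_bound\<close> tends to 0 and
  the factor of \<open>prob ?F\<close> to a positive number, so each bounded count has probability
  0.\<close>

lemma AE_contact_infinitely_often:
  assumes p: "0 < contact_prob \<alpha> (\<lambda>_. True)"
  shows "AE w in M. (\<Sum>i. indicator {w. contact \<alpha> (t + real i) w} w :: ennreal) = \<infinity>"
proof -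
  let ?I = "\<lambda>i w. indicator {w. contact \<alpha> (t + real i) w} w :: real"
  let ?F = "\<lambda>m::nat. {w\<in>space M. \<forall>N. (\<Sum>i<N. ?I i w) \<le> real m}"
  have im: "?I i \<in> borel_measurable M" for i
    by (rule borel_measurable_indicator_Collect) measurable
  have Fm: "?F m \<in> events" for m using im by measurable
  have "AE w in M. \<not> (\<forall>N. (\<Sum>i<N. ?I i w) \<le> real m)" for m
  proof -
    have "contact_prob \<alpha> (\<lambda>_. True) * prob (?F m) \<le> contact_prob \<alpha> (\<lambda>_. True) - contact_prob \<alpha> (\<lambda>_. True)"
      by (rule LIMSEQ_le[OF tendsto_mult[OF LIMSEQ_contact_prob tendsto_const] tendsto_diff[OF LIMSEQ_contact_prob tendsto_const]])
         (use contact_count_bound in blast)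
    then have "prob (?F m) \<le> 0" using p by (simp add: mult_le_0_iff)
    then have "prob (?F m) = 0" by (simp add: measure_le_0_iff)
    then show ?thesis using prob_eq_0[OF Fm[of m]] by auto
  qed
  then have "AE w in M. \<forall>m. \<not> (\<forall>N. (\<Sum>i<N. ?I i w) \<le> real m)" 
    unfolding AE_all_countable by (rule allI)
  then show ?thesis
  proof eventually_elim
    case (elim w)
    show ?case
    proof (rule ccontr)
      assume "\<not> ?thesis"
      then obtain c where c: "(\<Sum>i. indicator {w. contact \<alpha> (t + real i) w} w :: ennreal) = ennreal c" "0 \<le> c"
        by (cases "\<Sum>i. indicator {w. contact \<alpha> (t + real i) w} w :: ennreal") auto
      obtain m :: nat where m: "c \<le> real m" using real_arch_simple by blast
      have "(\<Sum>i<N. ?I i w) \<le> real m" for N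
      proof -
        have "ennreal (\<Sum>i<N. ?I i w) = (\<Sum>i<N. indicator {w. contact \<alpha> (t + real i) w} w)"
          by (simp add: sum_ennreal[symmetric] ennreal_indicator)
        also have "\<dots> \<le> ennreal c" unfolding c(1)[symmetric] by (rule sum_le_suminf) auto
        finally have "(\<Sum>i<N. ?I i w) \<le> c" using c(2) by simp
        with m show ?thesis by simp
      qed
      with elim show False by blast
    qed
  qed
qed

text \<open>Fubini exchanges the quantifiers: almost surely, almost every \<open>t\<close> has
  infinitely many contacts among \<open>t + i\<close>. Integrating this count over \<open>t\<close>
  in the open unit interval adds up the measure of the contact times in all intervals
  \<open>(i, i + 1)\<close>.\<close>

lemma AE_emeasure_contact_infinite:
  assumes p: "0 < contact_prob \<alpha> (\<lambda>_. True)"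
  shows "AE w in M. emeasure lborel {t. contact \<alpha> t w} = \<infinity>"
proof -
  interpret pair_sigma_finite lborel M ..
  have [measurable]: "Measurable.pred (borel \<Otimes>\<^sub>M M) (\<lambda>x. contact \<alpha> (fst x + real i) (snd x))" for i
    by (rule measurable_compose[OF _ local_contact_measurable, of "\<lambda>x. (fst x + real i, snd x)", simplified]) measurable
  let ?c = "\<lambda>t w. (\<Sum>i. indicator {w. contact \<alpha> (t + real i) w} w :: ennreal)"
  have [measurable]: "(\<lambda>x. ?c (fst x) (snd x)) \<in> borel_measurable (borel \<Otimes>\<^sub>M M)"
  proof -
    have "(\<lambda>x. indicator {x. contact \<alpha> (fst x + real i) (snd x)} x :: ennreal) \<in> borel_measurable (borel \<Otimes>\<^sub>M M)" for i
      by (rule borel_measurable_indicator_Collect) measurable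
    then have "(\<lambda>x. \<Sum>i. indicator {x. contact \<alpha> (fst x + real i) (snd x)} x :: ennreal) \<in> borel_measurable (borel \<Otimes>\<^sub>M M)"
      by measurable
    then show ?thesis by (simp add: indicator_def)
  qed
  have sets_eq: "sets (lborel \<Otimes>\<^sub>M M) = sets (borel \<Otimes>\<^sub>M M)" by (intro sets_pair_measure_cong) auto
  have "{x\<in>space (borel \<Otimes>\<^sub>M M). ?c (fst x) (snd x) = \<infinity>} \<in> sets (borel \<Otimes>\<^sub>M M)" by measurable
  then have m: "{x\<in>space (lborel \<Otimes>\<^sub>M M). ?c (fst x) (snd x) = \<infinity>} \<in> sets (lborel \<Otimes>\<^sub>M M)"
    unfolding sets_eq sets_eq_imp_space_eq[OF sets_eq] .
  have "AE t in lborel. AE w in M. ?c t w = \<infinity>" using AE_contact_infinitely_often[OF p] by simp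
  then have "AE w in M. AE t in lborel. ?c t w = \<infinity>" using AE_commute[OF m] by simp
  moreover have "AE w in M. w \<in> space M" by simp
  ultimately show ?thesis
  proof eventually_elim
    case (elim w)
    let ?H = "{t. contact \<alpha> t w}"
    have H [measurable]: "?H \<in> sets borel"
      by (rule local_contact_borel[OF elim(2)])
    have Hi [measurable]: "{t. t + real i \<in> ?H \<inter> {real i<..<real i + 1}} \<in> sets borel" for i
    proof -
      have "{t\<in>space borel. t + real i \<in> ?H \<inter> {real i<..<real i + 1}} \<in> sets borel" by measurable
      then show ?thesis by simp
    qed
    have "\<infinity> = (\<integral>\<^sup>+t. \<infinity> * indicator {0<..<1::real} t \<partial>lborel)"
      by (subst nn_integral_cmult_indicator) auto
    also have "\<dots> = (\<integral>\<^sup>+t. ?c t w * indicator {0<..<1} t \<partial>lborel)"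
      by (rule nn_integral_cong_AE) (use elim(1) in eventually_elim, simp)
    also have "\<dots> = (\<integral>\<^sup>+t. (\<Sum>i. indicator {t. t + real i \<in> ?H \<inter> {real i<..<real i + 1}} t) \<partial>lborel)"
    proof (rule nn_integral_cong)
      fix t :: real
      show "?c t w * indicator {0<..<1} t = (\<Sum>i. indicator {t. t + real i \<in> ?H \<inter> {real i<..<real i + 1}} t)"
        by (cases "t \<in> {0<..<1}") (auto simp: indicator_def)
    qed
    also have "\<dots> = (\<Sum>i. \<integral>\<^sup>+t. indicator {t. t + real i \<in> ?H \<inter> {real i<..<real i + 1}} t \<partial>lborel)"
      by (rule nn_integral_suminf) measurable
    also have "\<dots> = (\<Sum>i. emeasure lborel {t. t + real i \<in> ?H \<inter> {real i<..<real i + 1}})"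
      by (intro suminf_cong nn_integral_indicator) measurable
    also have "\<dots> = (\<Sum>i. emeasure lborel (?H \<inter> {real i<..<real i + 1}))"
      by (intro suminf_cong emeasure_lborel_shift) measurable
    also have "\<dots> = emeasure lborel (\<Union>i. ?H \<inter> {real i<..<real i + 1})"
    proof (rule suminf_emeasure)
      show "disjoint_family (\<lambda>i. ?H \<inter> {real i<..<real i + 1})"
        unfolding disjoint_family_on_def
      proof (intro ballI impI)
        fix i j :: nat assume "i \<noteq> j"
        then have "real i + 1 \<le> real j \<or> real j + 1 \<le> real i" by linarith
        then show "?H \<inter> {real i<..<real i + 1} \<inter> (?H \<inter> {real j<..<real j + 1}) = {}" by auto
      qed
    qed auto
    also have "\<dots> \<le> emeasure lborel ?H" by (rule emeasure_mono) auto
    finally show ?case by (simp add: top.extremum_unique)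
  qed
qed

text \<open>If the probability is 0, Fubini makes the set null; if it is positive, the measure is
  almost surely \<infinity>, which excludes 0.\<close>

lemma AE_emeasure_contact_0_iff:
  "(AE w in M. emeasure lborel {t. contact \<alpha> t w} = 0) \<longleftrightarrow> contact_prob \<alpha> (\<lambda>_. True) = 0"
proof
  assume p: "contact_prob \<alpha> (\<lambda>_. True) = 0"
  interpret pair_sigma_finite lborel M ..
  have m: "{x\<in>space (lborel \<Otimes>\<^sub>M M). \<not> contact \<alpha> (fst x) (snd x)} \<in> sets (lborel \<Otimes>\<^sub>M M)"
    by measurable
  have "AE w in M. \<not> contact \<alpha> t w" for t
  proof -
    have "prob {w\<in>space M. contact \<alpha> t w} = 0" using prob_local_contact[of \<alpha> "\<lambda>_. True" t] p by simp
    then show ?thesis by (subst (asm) prob_eq_0) auto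
  qed
  then have "AE w in M. AE t in lborel. \<not> contact \<alpha> t w" using AE_commute[OF m] by simp
  moreover have "AE w in M. w \<in> space M" by simp
  ultimately show "AE w in M. emeasure lborel {t. contact \<alpha> t w} = 0"
  proof eventually_elim
    case (elim w)
    have "{t. contact \<alpha> t w} \<in> sets borel"
      by (rule local_contact_borel[OF elim(2)])
    then show ?case using elim(1) by (subst (asm) AE_iff_measurable[of "{t. contact \<alpha> t w}"]) auto
  qed
next
  assume 0: "AE w in M. emeasure lborel {t. contact \<alpha> t w} = 0"
  show "contact_prob \<alpha> (\<lambda>_. True) = 0"
  proof (rule ccontr)
    assume "contact_prob \<alpha> (\<lambda>_. True) \<noteq> 0"
    then have "0 < contact_prob \<alpha> (\<lambda>_. True)" by (simp add: contact_prob_def less_le)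
    from AE_emeasure_contact_infinite[OF this] 0 have "AE w in M. False"
      by eventually_elim simp
    then show False by simp
  qed
qed

end

section \<open>The Lipschitz minorant of a path\<close>

text \<open>The right side is the infimal convolution of \<open>f\<close> with the cone
  \<open>\<alpha> * \<bar>s\<bar>\<close>. A Lipschitz \<open>g\<close> below \<open>f\<close>
  satisfies \<open>g t \<le> g s + \<alpha> * \<bar>s - t\<bar>\<close>, hence lies below it. A
  bound with the cone at 0 suffices, since moving the apex to \<open>t\<close> costs at most
  \<open>\<alpha> * \<bar>t\<bar>\<close>.\<close>

lemma lipschitz_minorant_eq:
  fixes f :: "real \<Rightarrow> real"
  assumes \<alpha>: "0 < \<alpha>" and bound: "\<And>s. c \<le> f s + \<alpha> * \<bar>s\<bar>"
  shows "lipschitz_minorant \<alpha> f = (\<lambda>t. INF s. f s + \<alpha> * \<bar>s - t\<bar>)"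
    and "bdd_below (range (\<lambda>s. f s + \<alpha> * \<bar>s - t\<bar>))"
proof -
  have lower: "c - \<alpha> * \<bar>t\<bar> \<le> f s + \<alpha> * \<bar>s - t\<bar>" for s t
  proof -
    have "\<alpha> * \<bar>s\<bar> \<le> \<alpha> * (\<bar>s - t\<bar> + \<bar>t\<bar>)" using \<alpha> by (intro mult_left_mono) auto
    then show ?thesis using bound[of s] by (simp add: algebra_simps)
  qed
  show bdd: "bdd_below (range (\<lambda>s. f s + \<alpha> * \<bar>s - t\<bar>))" for t
    by (rule bdd_belowI2[of _ "c - \<alpha> * \<bar>t\<bar>"]) (rule lower)
  define m where "m t = (INF s. f s + \<alpha> * \<bar>s - t\<bar>)" for t
  have m_le: "m t \<le> f s + \<alpha> * \<bar>s - t\<bar>" for s t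
    unfolding m_def by (rule cINF_lower[OF bdd]) simp
  have m_diff: "m t \<le> m u + \<alpha> * \<bar>t - u\<bar>" for t u
  proof -
    have "m t - \<alpha> * \<bar>t - u\<bar> \<le> m u"
      unfolding m_def[of u]
    proof (rule cINF_greatest)
      fix s
      have "\<alpha> * \<bar>s - t\<bar> \<le> \<alpha> * (\<bar>s - u\<bar> + \<bar>t - u\<bar>)" using \<alpha> by (intro mult_left_mono) auto
      then show "m t - \<alpha> * \<bar>t - u\<bar> \<le> f s + \<alpha> * \<bar>s - u\<bar>" using m_le[of t s] by (simp add: algebra_simps)
    qed simp
    then show ?thesis by simp
  qed
  have "lipschitz_minorant \<alpha> f = m"
    unfolding lipschitz_minorant_def
  proof (rule Greatest_equality)
    show "\<alpha>-lipschitz_on UNIV m \<and> m \<le> f"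
    proof
      show "\<alpha>-lipschitz_on UNIV m"
      proof (rule lipschitz_onI)
        fix t u show "dist (m t) (m u) \<le> \<alpha> * dist t u"
          using m_diff[of t u] m_diff[of u t] by (simp add: dist_real_def abs_minus_commute abs_le_iff algebra_simps)
      qed (use \<alpha> in simp)
      show "m \<le> f" unfolding le_fun_def using m_le[of t t for t] by simp
    qed
    fix g assume g: "\<alpha>-lipschitz_on UNIV g \<and> g \<le> f"
    show "g \<le> m"
      unfolding le_fun_def m_def
    proof (intro allI cINF_greatest)
      fix t s
      have "\<bar>g t - g s\<bar> \<le> \<alpha> * \<bar>t - s\<bar>"
        using lipschitz_onD[of \<alpha> UNIV g t s] g by (simp add: dist_real_def)
      moreover have "g s \<le> f s" using g by (simp add: le_fun_def)
      ultimately show "g t \<le> f s + \<alpha> * \<bar>s - t\<bar>" by (simp add: abs_minus_commute)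
    qed simp
  qed
  then show "lipschitz_minorant \<alpha> f = (\<lambda>t. INF s. f s + \<alpha> * \<bar>s - t\<bar>)" by (simp add: m_def fun_eq_iff)
qed

text \<open>Letting \<open>s\<close> tend to \<open>t\<close> from the left shows that the minorant
  at \<open>t\<close> is at most \<open>L\<close>; it is also at most \<open>f t\<close>. Equality
  with the minimum is thus a single family of inequalities.\<close>

lemma mem_contact_set_iff:
  fixes f :: "real \<Rightarrow> real"
  assumes \<alpha>: "0 < \<alpha>" and bound: "\<And>s. c \<le> f s + \<alpha> * \<bar>s\<bar>" and L: "(f \<longlongrightarrow> L) (at_left t)"
  shows "t \<in> contact_set \<alpha> f \<longleftrightarrow> (\<forall>s. min (f t) L \<le> f s + \<alpha> * \<bar>s - t\<bar>)"
proof -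
  note eq = lipschitz_minorant_eq[of \<alpha> c f, OF \<alpha> bound]
  let ?m = "INF s. f s + \<alpha> * \<bar>s - t\<bar>"
  have m_le: "?m \<le> f s + \<alpha> * \<bar>s - t\<bar>" for s by (rule cINF_lower[OF eq(2)]) simp
  have "((\<lambda>s. f s + \<alpha> * \<bar>s - t\<bar>) \<longlongrightarrow> L + \<alpha> * \<bar>t - t\<bar>) (at_left t)" by (intro tendsto_intros L)
  then have "?m \<le> L + \<alpha> * \<bar>t - t\<bar>"
    by (rule tendsto_lowerbound) (use m_le in auto)
  moreover have "?m \<le> f t" using m_le[of t] by simp
  ultimately have up: "?m \<le> min (f t) L" by simp
  have "t \<in> contact_set \<alpha> f \<longleftrightarrow> ?m = min (f t) L"
    using tendsto_Lim[OF _ L] by (simp add: contact_set_def eq(1))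
  also have "\<dots> \<longleftrightarrow> min (f t) L \<le> ?m" using up by auto
  also have "\<dots> \<longleftrightarrow> (\<forall>s. min (f t) L \<le> f s + \<alpha> * \<bar>s - t\<bar>)"
  proof
    assume "min (f t) L \<le> ?m"
    then show "\<forall>s. min (f t) L \<le> f s + \<alpha> * \<bar>s - t\<bar>" using m_le order_trans by blast
  next
    assume "\<forall>s. min (f t) L \<le> f s + \<alpha> * \<bar>s - t\<bar>"
    then show "min (f t) L \<le> ?m" by (intro cINF_greatest) auto
  qed
  finally show ?thesis .
qed

text \<open>A violation at \<open>s\<close> persists to the right of \<open>s\<close>, and also for
  \<open>s < t\<close> it must be met by a dyadic displacement from \<open>t\<close>, now directed
  to the left.\<close>

lemma dyadic_minorant_iff:
  fixes f :: "real \<Rightarrow> real"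
  assumes rc: "\<And>s. continuous (at_right s) f"
  shows "(\<forall>k j::nat. c \<le> f (t + real j / 2 ^ k) + \<alpha> * (real j / 2 ^ k) \<and> c \<le> f (t - real j / 2 ^ k) + \<alpha> * (real j / 2 ^ k))
    \<longleftrightarrow> (\<forall>s. c \<le> f s + \<alpha> * \<bar>s - t\<bar>)" (is "?L \<longleftrightarrow> ?R")
proof
  assume ?R
  show ?L
  proof (intro allI conjI)
    fix k j :: nat
    show "c \<le> f (t + real j / 2 ^ k) + \<alpha> * (real j / 2 ^ k)" using \<open>?R\<close>[rule_format, of "t + real j / 2 ^ k"] by simp
    show "c \<le> f (t - real j / 2 ^ k) + \<alpha> * (real j / 2 ^ k)" using \<open>?R\<close>[rule_format, of "t - real j / 2 ^ k"] by simp
  qed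
next
  assume L: ?L
  show ?R
  proof (intro allI, rule ccontr)
    fix s assume "\<not> c \<le> f s + \<alpha> * \<bar>s - t\<bar>"
    then have lt: "f s + \<alpha> * \<bar>s - t\<bar> < c" by simp
    have "((\<lambda>u. f u + \<alpha> * \<bar>u - t\<bar>) \<longlongrightarrow> f s + \<alpha> * \<bar>s - t\<bar>) (at_right s)"
      using rc[of s] by (intro tendsto_intros) (simp add: continuous_within)
    from order_tendstoD(2)[OF this lt] obtain d where d: "s < d" "\<And>u. s < u \<Longrightarrow> u < d \<Longrightarrow> f u + \<alpha> * \<bar>u - t\<bar> < c"
      unfolding eventually_at_right_field by auto
    show False
    proof (cases "t \<le> s")
      case True
      obtain k j :: nat where kj: "s - t < j / 2 ^ k" "j / 2 ^ k < d - t"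
        by (rule dyadic_between[of "s - t" "d - t"]) (use True d in auto)
      from d(2)[of "t + j / 2 ^ k"] kj have "f (t + j / 2 ^ k) + \<alpha> * \<bar>j / 2 ^ k\<bar> < c" by simp
      then show False using L by (simp add: not_le[symmetric])
    next
      case False
      \<comment> \<open>The interval on which the violation persists may extend beyond
        \<open>t\<close>; the maximum keeps the displacement positive.\<close>
      obtain k j :: nat where kj: "max 0 (t - d) < j / 2 ^ k" "j / 2 ^ k < t - s"
        by (rule dyadic_between[of "max 0 (t - d)" "t - s"]) (use False d in auto)
      from d(2)[of "t - j / 2 ^ k"] kj have "f (t - j / 2 ^ k) + \<alpha> * \<bar>j / 2 ^ k\<bar> < c" by simp
      then show False using L by (simp add: not_le[symmetric])
    qed
  qed
qed

section \<open>From the contact set of a path to the contact events\<close>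

context two_sided_levy_process
begin

lemma contact_iff:
  assumes "w \<in> space M"
  shows "contact \<alpha> t w \<longleftrightarrow> (\<forall>s. X t w \<le> X s w + \<alpha> * \<bar>s - t\<bar>)"
  unfolding dyadic_minorant_iff[OF right_continuous[OF assms], symmetric] local_contact_def
  by (simp add: algebra_simps)

text \<open>By \<open>left_limits\<close>, \<open>Lim\<close> is a true limit here and not an
  unspecified value. The sequential form serves measurability.\<close>

lemma LIMSEQ_left_limit:
  assumes "w \<in> space M"
  shows "(\<lambda>n. X (t - inverse (real (Suc n))) w) \<longlonglongrightarrow> Lim (at_left t) (\<lambda>s. X s w)"
    and "((\<lambda>s. X s w) \<longlongrightarrow> Lim (at_left t) (\<lambda>s. X s w)) (at_left t)"
proof -
  obtain l where l: "((\<lambda>s. X s w) \<longlongrightarrow> l) (at_left t)" using left_limits[OF assms] by blast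
  then show lim: "((\<lambda>s. X s w) \<longlongrightarrow> Lim (at_left t) (\<lambda>s. X s w)) (at_left t)"
    using tendsto_Lim[OF _ l] by simp
  have "(\<lambda>n. t - inverse (real (Suc n))) \<longlonglongrightarrow> t - 0" by (intro tendsto_intros LIMSEQ_inverse_real_of_nat)
  then have "filterlim (\<lambda>n. t - inverse (real (Suc n))) (at_left t) sequentially"
    unfolding filterlim_at by (auto intro!: always_eventually)
  from filterlim_compose[OF lim this] show "(\<lambda>n. X (t - inverse (real (Suc n))) w) \<longlonglongrightarrow> Lim (at_left t) (\<lambda>s. X s w)" .
qed

lemma measurable_left_limit: "(\<lambda>x. Lim (at_left (fst x)) (\<lambda>s. X s (snd x))) \<in> borel_measurable (borel \<Otimes>\<^sub>M M)"
  by (rule borel_measurable_LIMSEQ_real[OF LIMSEQ_left_limit(1)]) (auto simp: space_pair_measure)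

text \<open>By stationarity \<open>X t - X (t - h)\<close> has the law of \<open>X h\<close>, which tends to \<open>0\<close> as \<open>h\<close> decreases to \<open>0\<close>.\<close>

lemma AE_left_continuous: "AE w in M. Lim (at_left t) (\<lambda>s. X s w) = X t w"
proof -
  let ?l = "\<lambda>w. Lim (at_left t) (\<lambda>s. X s w)"
  let ?g = "\<lambda>x::real. min 1 \<bar>x\<bar>" and ?h = "\<lambda>n. inverse (real (Suc n))"
  have [measurable]: "?l \<in> borel_measurable M"
    by (rule borel_measurable_LIMSEQ_real[OF LIMSEQ_left_limit(1)]) auto
  have eq: "(\<integral>w. ?g (X t w - X (t - ?h n) w) \<partial>M) = (\<integral>w. ?g (X (?h n) w) \<partial>M)" for n
  proof -
    have "(\<integral>w. ?g (X t w - X (t - ?h n) w) \<partial>M) = (\<integral>x. ?g x \<partial>distr M borel (\<lambda>w. X t w - X (t - ?h n) w))"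
      by (subst integral_distr) auto
    also have "distr M borel (\<lambda>w. X t w - X (t - ?h n) w) = distr M borel (X (t - (t - ?h n)))"
      by (rule stationary_increments) simp
    also have "(\<integral>x. ?g x \<partial>distr M borel (X (t - (t - ?h n)))) = (\<integral>w. ?g (X (?h n) w) \<partial>M)"
      by (subst integral_distr) auto
    finally show ?thesis .
  qed
  have "(\<lambda>n. \<integral>w. ?g (X (?h n) w) \<partial>M) \<longlonglongrightarrow> (\<integral>w. 0 \<partial>M)"
  proof (rule integral_dominated_convergence[where w = "\<lambda>_. 1"])
    show "AE w in M. (\<lambda>n. ?g (X (?h n) w)) \<longlonglongrightarrow> 0"
    proof (rule AE_I2)
      fix w assume w: "w \<in> space M"
      have "filterlim ?h (at_right 0) sequentially"
        unfolding filterlim_at by (auto intro!: always_eventually LIMSEQ_inverse_real_of_nat simp del: of_nat_Suc)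
      moreover have "((\<lambda>s. X s w) \<longlongrightarrow> X 0 w) (at_right 0)"
        using right_continuous[OF w, of 0] by (simp add: continuous_within)
      ultimately have "(\<lambda>n. X (?h n) w) \<longlonglongrightarrow> 0"
        using start_at_zero[OF w] filterlim_compose by fastforce
      then have "(\<lambda>n. ?g (X (?h n) w)) \<longlonglongrightarrow> ?g 0" by (intro tendsto_intros)
      then show "(\<lambda>n. ?g (X (?h n) w)) \<longlonglongrightarrow> 0" by simp
    qed
  qed auto
  moreover have "(\<lambda>n. \<integral>w. ?g (X t w - X (t - ?h n) w) \<partial>M) \<longlonglongrightarrow> (\<integral>w. ?g (X t w - ?l w) \<partial>M)"
  proof (rule integral_dominated_convergence[where w = "\<lambda>_. 1"])
    show "AE w in M. (\<lambda>n. ?g (X t w - X (t - ?h n) w)) \<longlonglongrightarrow> ?g (X t w - ?l w)"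
      by (intro AE_I2 tendsto_intros LIMSEQ_left_limit(1))
  qed auto
  ultimately have "(\<integral>w. ?g (X t w - ?l w) \<partial>M) = 0"
    unfolding eq using LIMSEQ_unique by fastforce
  moreover have "integrable M (\<lambda>w. ?g (X t w - ?l w))"
    by (rule integrable_const_bound[where B = 1]) auto
  ultimately have "AE w in M. ?g (X t w - ?l w) = 0"
    by (subst (asm) integral_nonneg_eq_0_iff_AE) auto
  then show ?thesis by eventually_elim (auto simp: min_def split: if_splits)
qed

text \<open>Fubini turns the absence of fixed jump times into a null set of jump times for almost
  every path. This disposes of the left limit in \<open>contact_set\<close>.\<close>

lemma AE_lebesgue_left_continuous: "AE w in M. AE t in lborel. Lim (at_left t) (\<lambda>s. X s w) = X t w"
proof -
  interpret pair_sigma_finite lborel M ..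
  note [measurable] = measurable_left_limit
  have sets_eq: "sets (lborel \<Otimes>\<^sub>M M) = sets (borel \<Otimes>\<^sub>M M)" by (intro sets_pair_measure_cong) auto
  have "{x\<in>space (borel \<Otimes>\<^sub>M M). Lim (at_left (fst x)) (\<lambda>s. X s (snd x)) = X (fst x) (snd x)} \<in> sets (borel \<Otimes>\<^sub>M M)"
    by measurable
  then have m: "{x\<in>space (lborel \<Otimes>\<^sub>M M). Lim (at_left (fst x)) (\<lambda>s. X s (snd x)) = X (fst x) (snd x)} \<in> sets (lborel \<Otimes>\<^sub>M M)"
    unfolding sets_eq sets_eq_imp_space_eq[OF sets_eq] .
  show ?thesis using AE_commute[OF m] AE_left_continuous by simp
qed

text \<open>For \<open>s \<ge> 0\<close> this is boundedness below of \<open>V\<close>. For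
  \<open>s \<le> 0\<close> it is boundedness below of \<open>V'\<close>, carried over to the
  reversed path by \<open>path_to_law\<close>.\<close>

lemma AE_minorant_bound:
  assumes X1: "integrable M (X 1)" "\<bar>\<integral>w. X 1 w \<partial>M\<bar> < \<alpha>"
  shows "AE w in M. \<exists>c. \<forall>s. c \<le> X s w + \<alpha> * \<bar>s\<bar>"
proof -
  interpret V: two_sided_levy_process M "\<lambda>t w. 1 * X t w + \<alpha> * t" by (rule affine)
  interpret V': two_sided_levy_process M "\<lambda>t w. - 1 * X t w + \<alpha> * t" by (rule affine)
  have V: "AE w in M. \<exists>c. \<forall>k j::nat. c \<le> 1 * X (real j / 2 ^ k) w + \<alpha> * (real j / 2 ^ k)"
    using X1 by (intro V.AE_bounded_below) (auto simp: prob_space)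
  have V': "AE w in M. \<exists>c. \<forall>k j::nat. c \<le> - 1 * X (real j / 2 ^ k) w + \<alpha> * (real j / 2 ^ k)"
    using X1 by (intro V'.AE_bounded_below) (auto simp: prob_space)
  \<comment> \<open>A natural bound \<open>n\<close> in place of a real one keeps the event a
    countable union, hence measurable.\<close>
  let ?S = "\<lambda>x::real \<Rightarrow> real. \<exists>n::nat. \<forall>k j::nat. - real n \<le> - x (real j / 2 ^ k) + \<alpha> * (real j / 2 ^ k)"
  have Sm: "{x. ?S x} \<in> sets paths" by (rule sets_paths_Collect) measurable
  have ev: "{w\<in>space M. ?S (path_to 0 w)} \<in> events" "{w\<in>space M. ?S (path_from 0 w)} \<in> events"
    by (rule path_from_event[OF Sm])+
  have "AE w in M. w \<in> {w\<in>space M. ?S (path_from 0 w)}"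
    using V' AE_space
  proof eventually_elim
    case (elim w)
    then obtain c where c: "\<forall>k j::nat. c \<le> - X (real j / 2 ^ k) w + \<alpha> * (real j / 2 ^ k)" by auto
    obtain n :: nat where "- c \<le> real n" using real_arch_simple by blast
    then have "- real n \<le> c" by simp
    then have "\<forall>k j::nat. - real n \<le> - X (real j / 2 ^ k) w + \<alpha> * (real j / 2 ^ k)" using c order_trans by blast
    then show ?case using elim(2) by (auto simp: path_from_0)
  qed
  then have "prob {w\<in>space M. ?S (path_from 0 w)} = 1" using prob_Collect_eq_1 prob_eq_1[OF ev(2)] by blast
  then have "prob {w\<in>space M. ?S (path_to 0 w)} = 1" using path_to_law[OF Sm, of 0] by simp
  then have "AE w in M. w \<in> {w\<in>space M. ?S (path_to 0 w)}" using prob_eq_1[OF ev(1)] by blast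
  with V show ?thesis
  proof eventually_elim
    case (elim w)
    then have w: "w \<in> space M" by simp
    obtain c where c: "\<forall>k j::nat. c \<le> X (real j / 2 ^ k) w + \<alpha> * (real j / 2 ^ k)" using elim(1) by auto
    obtain n :: nat where n: "\<forall>k j::nat. - real n \<le> X (- (real j / 2 ^ k)) w + \<alpha> * (real j / 2 ^ k)"
      using elim(2) start_at_zero[OF w] by (auto simp: path_to_def)
    have "\<forall>k j::nat. min c (- real n) \<le> X (0 + real j / 2 ^ k) w + \<alpha> * (real j / 2 ^ k) \<and>
       min c (- real n) \<le> X (0 - real j / 2 ^ k) w + \<alpha> * (real j / 2 ^ k)"
      using c n by (auto simp: min_le_iff_disj)
    then have "\<forall>s. min c (- real n) \<le> X s w + \<alpha> * \<bar>s - 0\<bar>"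
      by (subst (asm) dyadic_minorant_iff[OF right_continuous[OF w]])
    then show ?case by auto
  qed
qed

text \<open>Where the path is left continuous, \<open>mem_contact_set_iff\<close> and
  \<open>contact_iff\<close> state the same condition. The contact set thus differs from a Borel set
  by a null set, which yields both its Lebesgue measurability and its measure.\<close>

lemma AE_emeasure_contact_set:
  assumes \<alpha>: "0 < \<alpha>" and X1: "integrable M (X 1)" "\<bar>\<integral>w. X 1 w \<partial>M\<bar> < \<alpha>"
  shows "AE w in M. emeasure lebesgue (contact_set \<alpha> (\<lambda>t. X t w)) = emeasure lborel {t. contact \<alpha> t w}"
  using AE_minorant_bound[OF X1] AE_lebesgue_left_continuous AE_space
proof eventually_elim
  case (elim w)
  then obtain c where c: "\<And>s. c \<le> X s w + \<alpha> * \<bar>s\<bar>" by blast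
  have H: "{t. contact \<alpha> t w} \<in> sets borel" by (rule local_contact_borel[OF elim(3)])
  have "AE t in lborel. t \<in> {t. contact \<alpha> t w} \<longleftrightarrow> t \<in> contact_set \<alpha> (\<lambda>t. X t w)"
    using elim(2)
  proof eventually_elim
    case (elim t)
    show ?case
      unfolding mem_contact_set_iff[OF \<alpha> c LIMSEQ_left_limit(2)[OF \<open>w \<in> space M\<close>]] elim
      by (simp add: contact_iff[OF \<open>w \<in> space M\<close>])
  qed
  then have AE: "AE t in lebesgue. t \<in> {t. contact \<alpha> t w} \<longleftrightarrow> t \<in> contact_set \<alpha> (\<lambda>t. X t w)"
    by (rule AE_completion)
  have Hl: "{t. contact \<alpha> t w} \<in> sets lebesgue" using H by simp
  have Cl: "contact_set \<alpha> (\<lambda>t. X t w) \<in> sets lebesgue"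
    by (rule completion.in_sets_AE[OF AE Hl]) simp
  have "emeasure lebesgue (contact_set \<alpha> (\<lambda>t. X t w)) = emeasure lebesgue {t. contact \<alpha> t w}"
    by (rule emeasure_eq_AE[OF _ Cl Hl]) (use AE in eventually_elim, auto)
  then show ?case using H by simp
qed

text \<open>The hypothesis on \<open>b\<close> cancels the linear term of the exponent, so that only
  the jump integral remains.\<close>

lemma zero_prob_compound_poisson:
  assumes trip: "levy_triplet M X a 0 \<nu>" and fin: "emeasure \<nu> UNIV < \<infinity>"
    and c: "c * levy_drift a 0 \<nu> + b = 0" and h: "0 \<le> h"
  shows "exp (- h * measure \<nu> UNIV) \<le> prob {w\<in>space M. c * X h w + b * h = 0}"
proof (rule compound_poisson_zero_prob[where c = c])
  have \<nu>: "levy_measure \<nu>" using trip by (simp add: levy_triplet_def)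
  show s: "sets \<nu> = sets borel" by (rule sets_levy_measure[OF \<nu>])
  show "finite_measure \<nu>" by (rule finite_measureI) (use fin sets_eq_imp_space_eq[OF s] in auto)
  show "char (distr M borel (\<lambda>w. c * X h w + b * h)) \<theta> = exp (- complex_of_real h * (CLINT x|\<nu>. 1 - iexp (c * \<theta> * x)))" for \<theta>
  proof -
    have b: "b = - (c * levy_drift a 0 \<nu>)" using c by simp
    have "char (distr M borel (\<lambda>w. c * X h w + b * h)) \<theta>
      = iexp (\<theta> * (b * h)) * exp (- complex_of_real h * levy_exponent a 0 \<nu> (c * \<theta>))"
      using trip h by (simp add: char_affine levy_triplet_def)
    also have "\<dots> = exp (- complex_of_real h * (CLINT x|\<nu>. 1 - iexp (c * \<theta> * x)))"
      unfolding levy_exponent_drift[OF \<nu> fin] exp_add[symmetric] b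
      by (rule arg_cong[of _ _ exp]) (simp add: algebra_simps)
    finally show ?thesis .
  qed
qed (use h in auto)

text \<open>The sign \<open>c\<close> selects the process without drift. With positive probability
  it vanishes up to time 1; there the other process equals \<open>2 * \<alpha> * t\<close>, which
  supplies a positive start for \<open>prob_nonneg_pos\<close>.\<close>

lemma contact_pos_compound_poisson:
  assumes \<alpha>: "0 < \<alpha>" and X1: "integrable M (X 1)" "\<bar>\<integral>w. X 1 w \<partial>M\<bar> < \<alpha>"
    and trip: "levy_triplet M X a 0 \<nu>" and fin: "emeasure \<nu> UNIV < \<infinity>"
    and c: "c = 1 \<or> c = - 1" "c * levy_drift a 0 \<nu> + \<alpha> = 0"
  shows "0 < prob {w\<in>space M. \<forall>k j::nat. 0 \<le> c * X (real j / 2 ^ k) w + \<alpha> * (real j / 2 ^ k)}"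
    and "0 < prob {w\<in>space M. \<forall>k j::nat. 0 \<le> - c * X (real j / 2 ^ k) w + \<alpha> * (real j / 2 ^ k)}"
proof -
  interpret V: two_sided_levy_process M "\<lambda>t w. c * X t w + \<alpha> * t" by (rule affine)
  interpret V': two_sided_levy_process M "\<lambda>t w. - c * X t w + \<alpha> * t" by (rule affine)
  have V1: "integrable M (\<lambda>w. c * X 1 w + \<alpha> * 1)" "0 < (\<integral>w. c * X 1 w + \<alpha> * 1 \<partial>M)"
    and V1': "integrable M (\<lambda>w. - c * X 1 w + \<alpha> * 1)" "0 < (\<integral>w. - c * X 1 w + \<alpha> * 1 \<partial>M)"
    using X1 c by (auto simp: prob_space)
  note l = zero_prob_compound_poisson[OF trip fin c(2)]
  show "0 < prob {w\<in>space M. \<forall>k j::nat. 0 \<le> c * X (real j / 2 ^ k) w + \<alpha> * (real j / 2 ^ k)}"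
    by (rule V.prob_nonneg_pos_of_zero_prob[OF V1 measure_nonneg l])
  have "0 < exp (- measure \<nu> UNIV)" by simp
  also have "\<dots> \<le> prob {w\<in>space M. \<forall>k j::nat. real j / 2 ^ k \<le> 1 \<longrightarrow> c * X (real j / 2 ^ k) w + \<alpha> * (real j / 2 ^ k) = 0}"
    by (rule V.prob_zero_initially[OF l])
  also have "\<dots> \<le> prob {w\<in>space M. (\<forall>k j::nat. real j / 2 ^ k \<le> 1 \<longrightarrow> 0 \<le> - c * X (real j / 2 ^ k) w + \<alpha> * (real j / 2 ^ k)) \<and> 0 < - c * X 1 w + \<alpha> * 1}"
  proof (rule prob_Collect_mono)
    fix w assume z: "\<forall>k j::nat. real j / 2 ^ k \<le> 1 \<longrightarrow> c * X (real j / 2 ^ k) w + \<alpha> * (real j / 2 ^ k) = 0"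
    have "0 \<le> - c * X (real j / 2 ^ k) w + \<alpha> * (real j / 2 ^ k)" if "real j / 2 ^ k \<le> 1" for j k :: nat
    proof -
      have "0 \<le> \<alpha> * (real j / 2 ^ k)" using \<alpha> by simp
      then show ?thesis using z[rule_format, OF that] by linarith
    qed
    moreover have "0 < - c * X 1 w + \<alpha> * 1" using z[rule_format, of 1 0] \<alpha> by simp
    ultimately show "(\<forall>k j::nat. real j / 2 ^ k \<le> 1 \<longrightarrow> 0 \<le> - c * X (real j / 2 ^ k) w + \<alpha> * (real j / 2 ^ k)) \<and> 0 < - c * X 1 w + \<alpha> * 1"
      by blast
  qed measurable
  finally show "0 < prob {w\<in>space M. \<forall>k j::nat. 0 \<le> - c * X (real j / 2 ^ k) w + \<alpha> * (real j / 2 ^ k)}"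
    using V'.prob_nonneg_pos[OF V1', of 1] by simp
qed

text \<open>Either zero is charged at every positive time, and atoms near 1 force the excluded
  compound Poisson case, or some time has no atom, and \<open>zero_prob_pos_or_avoids\<close>
  supplies the steps required by \<open>regular_prob_nonneg_0\<close>.\<close>

lemma regular_imp_prob_nonneg_0:
  assumes trip: "levy_triplet M X a \<sigma> \<nu>"
    and nex: "\<not> (\<sigma> = 0 \<and> emeasure \<nu> UNIV < \<infinity> \<and> \<bar>levy_drift a \<sigma> \<nu>\<bar> = \<alpha>)" and \<alpha>: "0 < \<alpha>"
    and c: "c = 1 \<or> c = - 1" and reg: "zero_regular_for M (\<lambda>t w. c * X t w + \<alpha> * t) {..0}"
  shows "prob {w\<in>space M. \<forall>k j::nat. 0 \<le> c * X (real j / 2 ^ k) w + \<alpha> * (real j / 2 ^ k)} = 0"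
proof -
  interpret V: two_sided_levy_process M "\<lambda>t w. c * X t w + \<alpha> * t" by (rule affine)
  have "\<exists>t>0. V.zero_prob t = 0"
  proof (rule ccontr)
    assume "\<not> ?thesis"
    then have pos: "0 < V.zero_prob t" if "0 < t" for t using that by (simp add: zero_less_measure_iff)
    have "\<sigma> = 0 \<and> emeasure \<nu> UNIV < \<infinity> \<and> c * levy_drift a \<sigma> \<nu> + \<alpha> = 0"
      by (rule compound_poisson_of_zero_prob_near_1[OF prob_space_axioms random_variable_X trip c V.zero_prob_near_1[OF pos]]) auto
    with nex c \<alpha> show False by auto
  qed
  then show ?thesis
    using V.regular_prob_nonneg_0[OF reg] V.zero_prob_pos_or_avoids by blast
qed

end

theorem theorem3p1:
  fixes M :: "'a measure" and X :: "real \<Rightarrow> 'a \<Rightarrow> real"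
    and \<alpha> a \<sigma> :: real and \<nu> :: "real measure"
  assumes "\<alpha> > 0"
    and "two_sided_levy_process M X"
    and "levy_triplet M X a \<sigma> \<nu>"
    and "\<And>t. t \<noteq> 0 \<Longrightarrow> \<not> (\<exists>c. AE \<omega> in M. X t \<omega> = c)"
    and "integrable M (X 1)"
    and "\<bar>\<integral>\<omega>. X 1 \<omega> \<partial>M\<bar> < \<alpha>"
  shows "(\<sigma> = 0 \<and> emeasure \<nu> UNIV < \<infinity> \<and> \<bar>levy_drift a \<sigma> \<nu>\<bar> = \<alpha> \<longrightarrow>
           (AE \<omega> in M. emeasure lebesgue (contact_set \<alpha> (\<lambda>t. X t \<omega>)) = \<infinity>)) \<and>
         (\<not> (\<sigma> = 0 \<and> emeasure \<nu> UNIV < \<infinity> \<and> \<bar>levy_drift a \<sigma> \<nu>\<bar> = \<alpha>) \<longrightarrow>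
           ((AE \<omega> in M. emeasure lebesgue (contact_set \<alpha> (\<lambda>t. X t \<omega>)) = 0) \<longleftrightarrow>
            zero_regular_for M (\<lambda>t \<omega>. X t \<omega> + \<alpha> * t) {..0} \<or>
            zero_regular_for M (\<lambda>t \<omega>. - X t \<omega> + \<alpha> * t) {..0}))"
proof -
  note X1 = assms(5,6)
  interpret two_sided_levy_process M X by (rule assms(2))
  interpret V: two_sided_levy_process M "\<lambda>t w. 1 * X t w + \<alpha> * t" by (rule affine)
  interpret V': two_sided_levy_process M "\<lambda>t w. - 1 * X t w + \<alpha> * t" by (rule affine)
  \<comment> \<open>The factors \<open>1\<close> and \<open>- 1\<close> are kept so that the results
    match the instances of \<open>affine\<close>.\<close>
  define p where "p = prob {w\<in>space M. \<forall>k j::nat. 0 \<le> 1 * X (real j / 2 ^ k) w + \<alpha> * (real j / 2 ^ k)}"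
  define p' where "p' = prob {w\<in>space M. \<forall>k j::nat. 0 \<le> - 1 * X (real j / 2 ^ k) w + \<alpha> * (real j / 2 ^ k)}"
  have cp: "contact_prob \<alpha> (\<lambda>_. True) = p * p'" by (simp add: contact_prob_def p_def p'_def)
  note leb = AE_emeasure_contact_set[OF assms(1) X1]
  have "AE w in M. emeasure lebesgue (contact_set \<alpha> (\<lambda>t. X t w)) = \<infinity>"
    if ex: "\<sigma> = 0" "emeasure \<nu> UNIV < \<infinity>" "\<bar>levy_drift a \<sigma> \<nu>\<bar> = \<alpha>"
  proof -
    have trip: "levy_triplet M X a 0 \<nu>" using assms(3) ex(1) by simp
    note pos = contact_pos_compound_poisson[OF assms(1) X1 trip ex(2)]
    \<comment> \<open>The sign of the drift decides which of \<open>V\<close> and \<open>V'\<close>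
      has no drift.\<close>
    consider "1 * levy_drift a 0 \<nu> + \<alpha> = 0" | "- 1 * levy_drift a 0 \<nu> + \<alpha> = 0" using ex(1,3) by force
    then have "0 < p \<and> 0 < p'"
    proof cases
      case 1
      then show ?thesis using pos[of 1] by (simp add: p_def p'_def)
    next
      case 2
      then show ?thesis using pos[of "- 1"] by (simp add: p_def p'_def)
    qed
    then have "0 < contact_prob \<alpha> (\<lambda>_. True)" by (simp add: cp)
    from leb AE_emeasure_contact_infinite[OF this] show ?thesis by eventually_elim simp
  qed
  moreover have "(AE w in M. emeasure lebesgue (contact_set \<alpha> (\<lambda>t. X t w)) = 0) \<longleftrightarrow>
      zero_regular_for M (\<lambda>t w. X t w + \<alpha> * t) {..0} \<or> zero_regular_for M (\<lambda>t w. - X t w + \<alpha> * t) {..0}"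
    if nex: "\<not> (\<sigma> = 0 \<and> emeasure \<nu> UNIV < \<infinity> \<and> \<bar>levy_drift a \<sigma> \<nu>\<bar> = \<alpha>)"
  proof -
    have V1: "integrable M (\<lambda>w. 1 * X 1 w + \<alpha> * 1)" "0 < (\<integral>w. 1 * X 1 w + \<alpha> * 1 \<partial>M)"
      and V1': "integrable M (\<lambda>w. - 1 * X 1 w + \<alpha> * 1)" "0 < (\<integral>w. - 1 * X 1 w + \<alpha> * 1 \<partial>M)"
      using X1 by (auto simp: prob_space)
    note zero = regular_imp_prob_nonneg_0[OF assms(3) nex assms(1)]
    have p: "zero_regular_for M (\<lambda>t w. X t w + \<alpha> * t) {..0} \<longleftrightarrow> p = 0"
    proof
      show "zero_regular_for M (\<lambda>t w. X t w + \<alpha> * t) {..0} \<Longrightarrow> p = 0" using zero[of 1] by (simp add: p_def)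
      show "p = 0 \<Longrightarrow> zero_regular_for M (\<lambda>t w. X t w + \<alpha> * t) {..0}"
        using V.not_regular_prob_nonneg_pos[OF V1] by (simp add: p_def) blast
    qed
    have p': "zero_regular_for M (\<lambda>t w. - X t w + \<alpha> * t) {..0} \<longleftrightarrow> p' = 0"
    proof
      show "zero_regular_for M (\<lambda>t w. - X t w + \<alpha> * t) {..0} \<Longrightarrow> p' = 0" using zero[of "- 1"] by (simp add: p'_def)
      show "p' = 0 \<Longrightarrow> zero_regular_for M (\<lambda>t w. - X t w + \<alpha> * t) {..0}"
        using V'.not_regular_prob_nonneg_pos[OF V1'] by (simp add: p'_def) blast
    qed
    have "(AE w in M. emeasure lebesgue (contact_set \<alpha> (\<lambda>t. X t w)) = 0) \<longleftrightarrow> (AE w in M. emeasure lborel {t. contact \<alpha> t w} = 0)"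
    proof
      assume "AE w in M. emeasure lebesgue (contact_set \<alpha> (\<lambda>t. X t w)) = 0"
      with leb show "AE w in M. emeasure lborel {t. contact \<alpha> t w} = 0" by eventually_elim simp
    next
      assume "AE w in M. emeasure lborel {t. contact \<alpha> t w} = 0"
      with leb show "AE w in M. emeasure lebesgue (contact_set \<alpha> (\<lambda>t. X t w)) = 0" by eventually_elim simp
    qed
    then show ?thesis unfolding AE_emeasure_contact_0_iff cp p p' by simp
  qed
  ultimately show ?thesis by blast
qed

end
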